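(* Fix constants $\alpha,K,M_0,M>0$. For each $\mathcal J\in\{\mathcal G,\mathcal H\}$, along sequences $(n,d,\rho)$ in the asymptotic regime described in the context, $$ \inf_{\hat\Sigma\in\mathcal M_\rho}\ \sup_{P\in\mathcal P_\alpha^{\mathcal J}}\frac1d\,\mathbb E_P\|\hat\Sigma-\Sigma(P)\|_F^2 \;\gtrsim\; \Bigl(n^{-\frac{2\alpha+1}{2(\alpha+1)}}\wedge\frac dn\Bigr)+\Bigl(\bigl(\tfrac{d}{\rho n^2}\bigr)^{\frac{2\alpha+1}{2\alpha+3}}\wedge\frac{d^3}{\rho n^2}\Bigr). $$
   Context: Norms: $\|\cdot\|_F$ is the Frobenius norm; $a\wedge b=\min(a,b)$. For a random variable $\xi$, $\|\xi\|_{\psi_2}=\inf\{t>0:\mathbb E e^{\xi^2/t^2}\le2\}$; for a random vector $X$, $\|X\|_{\psi_2}=\sup_{\|v\|_2=1}\|\langle X,v\rangle\|_{\psi_2}$. Privacy. Two datasets of $n$ points of $\mathbb R^d$ are adjacent if they differ in one observation. For $\lambda>1$ the R\'enyi divergence of laws $P,Q$ is $D_\lambda(P\|Q)=\frac1{\lambda-1}\log\int(\frac{dP}{dQ})^\lambda dQ$ ($=\infty$ if $P\not\ll Q$). A randomized algorithm $A$ is $\rho$-zCDP if $D_\lambda(A(S)\|A(S'))\le\rho\lambda$ for all adjacent $S,S'$ and all $\lambda\in(1,\infty)$ (divergence over the internal randomness of $A$ only). $\mathcal M_\rho$ is the set of all $\rho$-zCDP estimators (random $d\times d$ matrices) based on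 $n$ observations. Covariance classes. The pointwise-decay class $\mathcal H_\alpha(M_0,M)$ is the set of $d\times d$ covariance matrices with $0\preceq\Sigma\preceq M_0I_d$ and $|\Sigma_{ij}|\le M|i-j|^{-(\alpha+1)}$ for $i\ne j$. The row-tail class $\mathcal G_\alpha(M_0,M)$ is the set of $d\times d$ covariance matrices with $0\preceq\Sigma\preceq M_0I_d$ and $\max_{j}\sum_{i:|i-j|>k}|\Sigma_{ij}|\le Mk^{-\alpha}$ for all $k\ge1$. Model. For $\mathcal J\in\{\mathcal G,\mathcal H\}$, $\mathcal P_\alpha^{\mathcal J}=\mathcal P_\alpha^{\mathcal J}(K,M_0,M)$ is the set of distributions $P$ on $\mathbb R^d$ such that $X\sim P$ with mean $\mu$ and covariance $\Sigma(P)$ satisfies $\|X-\mu\|_{\psi_2}\le K$ and $\Sigma(P)\in\mathcal J_\alpha(M_0,M)$. $\mathbb E_P$ is expectation over $n$ i.i.d. observations from $P$ and over the randomness of the estimator. Asymptotic regime. Statements are along sequences $(n,d,\rho)=(n,d_n,\rho_n)$, $n\to\infty$, with $d\gtrsim\log n$, $0<\rho\lesssim1$ (a fixed upper bound), and $d/(\rho n^2)\to0$. $a\gtrsim b$ means $a\ge cb$ for all sufficiently large $n$ with $c>0$ not depending on $n,d,\rho$ (it may depend on $\alpha,K,M_0,M$ and on the fixed constants in the regime conditions). *)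

theory Defs
  imports "HOL-Probability.Probability"
begin

text \<open>
  The dimension varies with the sample size, so \<open>\<real>\<^sup>d\<close> is carried by the extensional functions on
  \<open>{..<d}\<close>, and \<open>d \<times> d\<close> matrices by the extensional functions on \<open>{..<d} \<times> {..<d}\<close>, both with the
  product Borel sigma-algebra. Indices are zero-based.
\<close>

type_synonym vec = "nat \<Rightarrow> real"
type_synonym mtx = "nat \<times> nat \<Rightarrow> real"
type_synonym dataset = "nat \<Rightarrow> vec"

definition vec_space :: "nat \<Rightarrow> vec measure" where
  "vec_space d = (\<Pi>\<^sub>M i\<in>{..<d}. borel)"

definition mat_space :: "nat \<Rightarrow> mtx measure" where
  "mat_space d = (\<Pi>\<^sub>M ij\<in>{..<d} \<times> {..<d}. borel)"

definition data_space :: "nat \<Rightarrow> nat \<Rightarrow> dataset measure" where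
  "data_space n d = (\<Pi>\<^sub>M k\<in>{..<n}. vec_space d)"

definition inner_vec :: "nat \<Rightarrow> vec \<Rightarrow> vec \<Rightarrow> real" where
  "inner_vec d x v = (\<Sum>i<d. x i * v i)"

definition frob_norm :: "nat \<Rightarrow> mtx \<Rightarrow> real" where
  "frob_norm d A = L2_set A ({..<d} \<times> {..<d})"


subsection \<open>Sub-Gaussian norms\<close>

text \<open>These take values in \<^typ>\<open>ennreal\<close>; the infimum of the empty set is \<open>\<infinity>\<close>.\<close>

definition psi2_norm :: "'a measure \<Rightarrow> ('a \<Rightarrow> real) \<Rightarrow> ennreal" where
  "psi2_norm P \<xi> =
     (INF t\<in>{t::real. 0 < t \<and> (\<integral>\<^sup>+ \<omega>. ennreal (exp ((\<xi> \<omega>)\<^sup>2 / t\<^sup>2)) \<partial>P) \<le> 2}. ennreal t)"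

definition psi2_norm_vec :: "nat \<Rightarrow> 'a measure \<Rightarrow> ('a \<Rightarrow> vec) \<Rightarrow> ennreal" where
  "psi2_norm_vec d P X =
     (SUP v\<in>{v. L2_set v {..<d} = 1}. psi2_norm P (\<lambda>\<omega>. inner_vec d (X \<omega>) v))"


subsection \<open>Privacy\<close>

text \<open>
  \<open>RN_deriv Q P\<close> is \<open>dP/dQ\<close>, and \<open>absolutely_continuous Q P\<close> says \<open>P \<lless> Q\<close>. The definition is meant
  for probability measures on a common sigma-algebra; there \<open>dP/dQ\<close> is finite almost everywhere
  and the integral is at least 1, so neither \<^const>\<open>enn2real\<close> nor \<^const>\<open>ln\<close> meets a junk value.
\<close>

definition renyi_div :: "real \<Rightarrow> 'a measure \<Rightarrow> 'a measure \<Rightarrow> ereal" where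
  "renyi_div l P Q =
     (let I = (\<integral>\<^sup>+ x. ennreal (enn2real (RN_deriv Q P x) powr l) \<partial>Q)
      in if absolutely_continuous Q P \<and> I < \<infinity> then ereal (1 / (l - 1) * ln (enn2real I)) else \<infinity>)"

definition adjacent :: "nat \<Rightarrow> dataset \<Rightarrow> dataset \<Rightarrow> bool" where
  "adjacent n S S' \<longleftrightarrow> card {k\<in>{..<n}. S k \<noteq> S' k} = 1"

text \<open>
  A randomized estimator is a Markov kernel from datasets to matrices: \<open>A S\<close> is the law of the
  output on input \<open>S\<close> over the internal randomness.
\<close>

definition zcdp_estimators :: "nat \<Rightarrow> nat \<Rightarrow> real \<Rightarrow> (dataset \<Rightarrow> mtx measure) set" where
  "zcdp_estimators n d \<rho> =
     {A \<in> data_space n d \<rightarrow>\<^sub>M prob_algebra (mat_space d).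
        \<forall>S\<in>space (data_space n d). \<forall>S'\<in>space (data_space n d). adjacent n S S' \<longrightarrow>
          (\<forall>l>1. renyi_div l (A S) (A S') \<le> ereal (\<rho> * l))}"


subsection \<open>Covariance classes\<close>

definition psd :: "nat \<Rightarrow> mtx \<Rightarrow> bool" where
  "psd d A \<longleftrightarrow> (\<forall>i<d. \<forall>j<d. A (i, j) = A (j, i)) \<and>
     (\<forall>x::vec. 0 \<le> (\<Sum>i<d. \<Sum>j<d. x i * A (i, j) * x j))"

definition scalar_mat :: "real \<Rightarrow> mtx" where
  "scalar_mat c = (\<lambda>(i, j). if i = j then c else 0)"

definition bounded_cov_mats :: "nat \<Rightarrow> real \<Rightarrow> mtx set" where
  "bounded_cov_mats d M0 =
     {A \<in> space (mat_space d). psd d A \<and> psd d (\<lambda>ij. scalar_mat M0 ij - A ij)}"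

definition pointwise_decay_class :: "real \<Rightarrow> real \<Rightarrow> real \<Rightarrow> nat \<Rightarrow> mtx set" where
  "pointwise_decay_class \<alpha> M0 M d =
     {A \<in> bounded_cov_mats d M0.
        \<forall>i<d. \<forall>j<d. i \<noteq> j \<longrightarrow> \<bar>A (i, j)\<bar> \<le> M * \<bar>real i - real j\<bar> powr (- (\<alpha> + 1))}"

definition row_tail_class :: "real \<Rightarrow> real \<Rightarrow> real \<Rightarrow> nat \<Rightarrow> mtx set" where
  "row_tail_class \<alpha> M0 M d =
     {A \<in> bounded_cov_mats d M0.
        \<forall>k::nat. 1 \<le> k \<longrightarrow> (\<forall>j<d.
          (\<Sum>i | i < d \<and> \<bar>real i - real j\<bar> > real k. \<bar>A (i, j)\<bar>) \<le> M * real k powr (- \<alpha>))}"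


subsection \<open>Statistical model and minimax risk\<close>

definition mean_vec :: "vec measure \<Rightarrow> vec" where
  "mean_vec P = (\<lambda>i. \<integral>x. x i \<partial>P)"

definition cov_mat :: "nat \<Rightarrow> vec measure \<Rightarrow> mtx" where
  "cov_mat d P = (\<lambda>(i, j)\<in>{..<d} \<times> {..<d}. \<integral>x. (x i - mean_vec P i) * (x j - mean_vec P j) \<partial>P)"

text \<open>
  The square-integrability clause only ensures that the Bochner integrals defining mean and
  covariance are genuine; it is already implied by the sub-Gaussian bound.
\<close>

definition model_dists ::
    "(real \<Rightarrow> real \<Rightarrow> real \<Rightarrow> nat \<Rightarrow> mtx set) \<Rightarrow> real \<Rightarrow> real \<Rightarrow> real \<Rightarrow> real \<Rightarrow> nat
      \<Rightarrow> vec measure set" where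
  "model_dists J \<alpha> K M0 M d =
     {P. prob_space P \<and> sets P = sets (vec_space d) \<and>
         (\<forall>i<d. integrable P (\<lambda>x. (x i)\<^sup>2)) \<and>
         psi2_norm_vec d P (\<lambda>x i. x i - mean_vec P i) \<le> ennreal K \<and>
         cov_mat d P \<in> J \<alpha> M0 M d}"

definition risk :: "nat \<Rightarrow> nat \<Rightarrow> (dataset \<Rightarrow> mtx measure) \<Rightarrow> vec measure \<Rightarrow> ennreal" where
  "risk n d A P =
     ennreal (1 / real d) *
     (\<integral>\<^sup>+ S. (\<integral>\<^sup>+ B. ennreal ((frob_norm d (\<lambda>ij. B ij - cov_mat d P ij))\<^sup>2) \<partial>A S)
        \<partial>(\<Pi>\<^sub>M k\<in>{..<n}. P))"

end

theory Submission
  imports Defs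
begin

text \<open>
  Both terms of the bound come from one family of laws and one identity, bounded in two ways.

  The family. Cut the coordinates into blocks of length \<open>2k\<close>. In each block the first \<open>k\<close>
  coordinates \<open>Y\<close> are independent fair signs; given them, the last \<open>k\<close> coordinates \<open>Z\<close> are
  independent signs, and \<open>Z\<^sub>i\<close> has conditional mean \<open>\<tau> (\<Sum>j. \<theta>\<^sub>i\<^sub>j Y\<^sub>j)\<close>. The parameter \<open>\<theta>\<close> ranges over the
  cube \<open>[-1,1]\<^sup>E\<close>, where \<open>E\<close> is the set of pairs \<open>(i, j)\<close> in a common block; it has at least
  \<open>kd/4\<close> elements. For \<open>\<tau>k \<le> 1/2\<close> this is a probability law, and three facts hold uniformly in \<open>k\<close>
  and \<open>d\<close>: linear forms are sub-Gaussian; the covariance of \<open>Z\<^sub>i\<close> and \<open>Y\<^sub>j\<close> is exactly \<open>\<tau>\<theta>\<^sub>i\<^sub>j\<close>, while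
  every off-diagonal entry is at most \<open>\<tau>\<close> and vanishes between blocks; and the Fisher information
  matrix of one observation is at most \<open>2\<tau>\<^sup>2\<close> times the identity. The conditional construction
  is what makes this range of \<open>\<tau>\<close> available: a density of signs that is affine in the whole matrix \<open>\<theta>\<close>
  is positive only for much smaller \<open>\<tau>\<close>. So, after multiplication by a constant, the laws belong
  to both models as soon as \<open>\<tau> (2k)\<^bsup>\<alpha>+1\<^esup>\<close> is below a constant, and the risk, normalised by \<open>d\<close>, is at
  least a constant times \<open>\<tau>\<^sup>2/d\<close> times the squared error of estimating \<open>\<theta>\<close>.

  The identity. Let \<open>T\<close> be an estimator of \<open>\<theta>\<close> with squared error at most \<open>R\<close> on the whole cube, and
  let \<open>V(\<theta>)\<close> be the expectation of \<open>\<Sum>e. (1 - \<theta>\<^sub>e\<^sup>2) (T\<^sub>e - \<theta>\<^sub>e) S\<^sub>e\<close>, with \<open>S\<close> the score of the sample. The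
  correlation of \<open>T\<^sub>e\<close> with \<open>S\<^sub>e\<close> is the derivative of the mean of \<open>T\<^sub>e\<close> in \<open>\<theta>\<^sub>e\<close>. The weight vanishes
  on the boundary of the cube, so integration by parts shows that some \<open>\<theta>\<close> has
  \<open>V(\<theta>) \<ge> p/3 - R\<close>, with \<open>p\<close> the number of parameters (\<open>attack_lower_bound\<close>).

  The two upper bounds. By Cauchy-Schwarz and the bound on the information, \<open>V\<close> is at most
  \<open>\<surd>(R n p \<tau>\<^sup>2)\<close> up to a constant (\<open>attack_le_nonprivate\<close>). Under privacy, write \<open>V\<close> as the sum of
  the contributions of the \<open>n\<close> observations. If the observation were replaced by a fresh one in
  the input of the estimator, its contribution would have mean zero and variance at most \<open>2\<tau>\<^sup>2R\<close>;
  and the replacement changes the output law by a chi-square divergence of at most \<open>e\<^bsup>2\<rho>\<^esup> - 1\<close>, which is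
  of order \<open>\<rho>\<close>. So \<open>V\<close> is at most \<open>n \<surd>(\<rho> \<tau>\<^sup>2 R)\<close> up to a constant (\<open>attack_le_private\<close>).

  Hence \<open>R\<close> is at least a constant times \<open>p\<close>, and the risk at least a constant times \<open>k\<tau>\<^sup>2\<close>, if
  \<open>n\<tau>\<^sup>2 \<le> 1\<close>, or if \<open>n\<^sup>2\<rho>\<tau>\<^sup>2\<close> is at most a constant times \<open>kd\<close> (\<open>minimax_risk_ge\<close>). For the first term
  take \<open>\<tau>\<^sup>2\<close> of order \<open>1/n\<close>; the decay condition then allows \<open>k\<close> up to the order of
  \<open>min(n\<^bsup>1/(2\<alpha>+2)\<^esup>, d)\<close>. For the second take \<open>\<tau>\<^sup>2\<close> of order \<open>kd/(\<rho>n\<^sup>2)\<close>, which allows \<open>k\<close> up to the order of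
  \<open>min((\<rho>n\<^sup>2/d)\<^bsup>1/(2\<alpha>+3)\<^esup>, d)\<close>. The values of \<open>k\<tau>\<^sup>2\<close> are the two terms of the rate.
\<close>

section \<open>Moments under product weights\<close>

lemma sum_PiE_prod_one:
  fixes w :: "'i \<Rightarrow> 'a \<Rightarrow> real"
  assumes "finite I" "finite A" "\<And>i. i \<in> I \<Longrightarrow> (\<Sum>a\<in>A. w i a) = 1"
  shows "(\<Sum>z\<in>I \<rightarrow>\<^sub>E A. \<Prod>l\<in>I. w l (z l)) = 1"
  using prod_sum_PiE[of I "\<lambda>_. A" w] assms by simp

lemma sum_PiE_marginal:
  fixes w :: "'i \<Rightarrow> 'a \<Rightarrow> real"
  assumes "finite I" "finite A" "\<And>i. i \<in> I \<Longrightarrow> (\<Sum>a\<in>A. w i a) = 1" "i \<in> I"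
  shows "(\<Sum>z\<in>I \<rightarrow>\<^sub>E A. (\<Prod>l\<in>I. w l (z l)) * f (z i)) = (\<Sum>a\<in>A. w i a * f a)"
proof -
  let ?g = "\<lambda>l a. w l a * (if l = i then f a else 1)"
  have "(\<Prod>l\<in>I. w l (z l)) * f (z i) = (\<Prod>l\<in>I. ?g l (z l))" for z
    using assms(1,4) by (simp add: prod.distrib)
  then have "(\<Sum>z\<in>I \<rightarrow>\<^sub>E A. (\<Prod>l\<in>I. w l (z l)) * f (z i)) = (\<Prod>l\<in>I. \<Sum>a\<in>A. ?g l a)"
    using prod_sum_PiE[of I "\<lambda>_. A" ?g] assms(1,2) by simp
  also have "\<dots> = (\<Prod>l\<in>I. if l = i then \<Sum>a\<in>A. w i a * f a else 1)"
    using assms(3) by (intro prod.cong) auto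
  finally show ?thesis using assms(1,4) by simp
qed

lemma sum_PiE_marginal2:
  fixes w :: "'i \<Rightarrow> 'a \<Rightarrow> real"
  assumes "finite I" "finite A" "\<And>i. i \<in> I \<Longrightarrow> (\<Sum>a\<in>A. w i a) = 1" "i \<in> I" "j \<in> I" "i \<noteq> j"
  shows "(\<Sum>z\<in>I \<rightarrow>\<^sub>E A. (\<Prod>l\<in>I. w l (z l)) * (f (z i) * g (z j)))
       = (\<Sum>a\<in>A. w i a * f a) * (\<Sum>a\<in>A. w j a * g a)"
proof -
  let ?g = "\<lambda>l a. w l a * ((if l = i then f a else 1) * (if l = j then g a else 1))"
  have "(\<Prod>l\<in>I. w l (z l)) * (f (z i) * g (z j)) = (\<Prod>l\<in>I. ?g l (z l))" for z
    using assms(1,4,5) by (simp add: prod.distrib)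
  then have "(\<Sum>z\<in>I \<rightarrow>\<^sub>E A. (\<Prod>l\<in>I. w l (z l)) * (f (z i) * g (z j))) = (\<Prod>l\<in>I. \<Sum>a\<in>A. ?g l a)"
    using prod_sum_PiE[of I "\<lambda>_. A" ?g] assms(1,2) by simp
  also have "\<dots> = (\<Prod>l\<in>I. (if l = i then \<Sum>a\<in>A. w i a * f a else 1) *
      (if l = j then \<Sum>a\<in>A. w j a * g a else 1))"
    using assms(3,6) by (intro prod.cong) auto
  finally show ?thesis using assms(1,4,5) by (simp add: prod.distrib)
qed

text \<open>
  Covariance of two sums over independent coordinates. It serves for the fair signs, for the
  conditional signs and for the independent observations of a sample. Centring of one of the
  two sums already removes the mixed terms.
\<close>

lemma sum_PiE_covariance:
  fixes w :: "'i \<Rightarrow> 'a \<Rightarrow> real"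
  assumes fin: "finite I" "finite A" and w: "\<And>i. i \<in> I \<Longrightarrow> (\<Sum>a\<in>A. w i a) = 1"
    and f: "\<And>i. i \<in> I \<Longrightarrow> (\<Sum>a\<in>A. w i a * f i a) = 0"
  shows "(\<Sum>z\<in>I \<rightarrow>\<^sub>E A. (\<Prod>l\<in>I. w l (z l)) * ((\<Sum>i\<in>I. f i (z i)) * (\<Sum>i\<in>I. g i (z i))))
       = (\<Sum>i\<in>I. \<Sum>a\<in>A. w i a * (f i a * g i a))"
proof -
  have "(\<Sum>z\<in>I \<rightarrow>\<^sub>E A. (\<Prod>l\<in>I. w l (z l)) * ((\<Sum>i\<in>I. f i (z i)) * (\<Sum>i\<in>I. g i (z i))))
      = (\<Sum>z\<in>I \<rightarrow>\<^sub>E A. \<Sum>i\<in>I. \<Sum>j\<in>I. (\<Prod>l\<in>I. w l (z l)) * (f i (z i) * g j (z j)))"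
    by (intro sum.cong refl, subst sum_product, simp only: sum_distrib_left)
  also have "\<dots> = (\<Sum>i\<in>I. \<Sum>j\<in>I. \<Sum>z\<in>I \<rightarrow>\<^sub>E A. (\<Prod>l\<in>I. w l (z l)) * (f i (z i) * g j (z j)))"
    by (subst sum.swap, intro sum.cong refl, subst sum.swap, rule refl)
  also have "\<dots> = (\<Sum>i\<in>I. \<Sum>j\<in>I. if i = j then \<Sum>a\<in>A. w i a * (f i a * g i a) else 0)"
  proof (intro sum.cong refl)
    fix i j assume ij: "i \<in> I" "j \<in> I"
    show "(\<Sum>z\<in>I \<rightarrow>\<^sub>E A. (\<Prod>l\<in>I. w l (z l)) * (f i (z i) * g j (z j)))
        = (if i = j then \<Sum>a\<in>A. w i a * (f i a * g i a) else 0)"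
    proof (cases "i = j")
      case True
      then show ?thesis
        using sum_PiE_marginal[OF fin w ij(1), where f = "\<lambda>a. f i a * g i a"] by simp
    next
      case False
      then show ?thesis
        using sum_PiE_marginal2[OF fin w ij False, where f = "f i" and g = "g j"] f[OF ij(1)] by simp
    qed
  qed
  finally show ?thesis using fin by simp
qed

section \<open>Privacy and differences of means\<close>

text \<open>
  The order two divergence bounds the chi-square divergence: with \<open>r = dP/dQ\<close> the second moment
  of \<open>r - 1\<close> is at most \<open>e\<^bsup>2\<rho>\<^esup> - 1\<close>, and the difference of the means is the integral of \<open>(r - 1) f\<close>.
  The product is split with a free parameter \<open>\<eta>\<close> instead of Cauchy-Schwarz, so that the bound is
  linear in the second moment of \<open>f\<close> and can be summed over datasets before \<open>\<eta>\<close> is chosen.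
\<close>

lemma renyi_two_mean_gap:
  fixes f :: "'a \<Rightarrow> real"
  assumes P: "prob_space P" and Q: "prob_space Q" and sets: "sets P = sets Q"
    and div: "renyi_div 2 P Q \<le> ereal (\<rho> * 2)"
    and f[measurable]: "f \<in> borel_measurable Q"
    and fP: "integrable P (\<lambda>x. (f x)\<^sup>2)" and fQ: "integrable Q (\<lambda>x. (f x)\<^sup>2)"
    and \<eta>: "\<eta> > 0"
  shows "(\<integral>x. f x \<partial>P) \<le> (\<integral>x. f x \<partial>Q) + \<eta> / 2 * (exp (2 * \<rho>) - 1) + (\<integral>x. (f x)\<^sup>2 \<partial>Q) / (2 * \<eta>)"
proof -
  interpret P: prob_space P by fact
  interpret Q: prob_space Q by fact
  define r where "r x = enn2real (RN_deriv Q P x)" for x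
  define I where "I = (\<integral>\<^sup>+ x. ennreal (r x powr 2) \<partial>Q)"
  have ac: "absolutely_continuous Q P" and Ifin: "I < \<infinity>" and le: "ln (enn2real I) \<le> 2 * \<rho>"
    using div by (auto simp: renyi_div_def Let_def I_def r_def split: if_splits)
  have rm[measurable]: "r \<in> borel_measurable Q" unfolding r_def by measurable
  have r0: "0 \<le> r x" for x by (simp add: r_def)
  have rn: "AE x in Q. RN_deriv Q P x = ennreal (r x)"
    using Q.RN_deriv_finite[OF P.sigma_finite_measure_axioms ac sets]
    by eventually_elim (auto simp: r_def less_top)
  have Pd: "P = density Q r"
  proof -
    have "P = density Q (RN_deriv Q P)" using Q.density_RN_deriv[OF ac sets] by simp
    also have "\<dots> = density Q r" by (rule density_cong) (use rn in auto)
    finally show ?thesis .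
  qed
  have I2: "I = (\<integral>\<^sup>+ x. ennreal ((r x)\<^sup>2) \<partial>Q)"
    unfolding I_def by (intro nn_integral_cong) (use r0 in \<open>auto simp: powr_numeral\<close>)
  have intr2: "integrable Q (\<lambda>x. (r x)\<^sup>2)"
    using Ifin I2 by (intro integrableI_nonneg) auto
  have Ieq: "(\<integral>x. (r x)\<^sup>2 \<partial>Q) = enn2real I"
    unfolding I2 by (rule integral_eq_nn_integral) auto
  have Ile: "enn2real I \<le> exp (2 * \<rho>)"
  proof (cases "enn2real I = 0")
    case False
    then have "0 < enn2real I" using enn2real_nonneg[of I] by linarith
    then show ?thesis using le by (metis exp_le_cancel_iff exp_ln)
  qed simp
  have intr: "integrable Q r" 
    by (rule Q.square_integrable_imp_integrable) (use intr2 in auto)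
  have r1: "(\<integral>x. r x \<partial>Q) = 1"
  proof -
    have "integral\<^sup>L P (\<lambda>x. 1::real) = (\<integral>x. r x * 1 \<partial>Q)"
      unfolding Pd using r0 by (subst integral_density) auto
    then show ?thesis using P.prob_space by simp
  qed
  have mP[measurable]: "f \<in> borel_measurable P" using f sets by (simp cong: measurable_cong_sets)
  have fPi: "integrable P f" by (rule P.square_integrable_imp_integrable) (use fP in auto)
  have fQi: "integrable Q f" by (rule Q.square_integrable_imp_integrable) (use fQ in auto)
  have eqP: "(\<integral>x. f x \<partial>P) = (\<integral>x. r x * f x \<partial>Q)"
    unfolding Pd using r0 by (subst integral_density) auto
  have intrf: "integrable Q (\<lambda>x. r x * f x)"
    using fPi unfolding Pd using r0 by (subst (asm) integrable_density) auto
  have "(\<integral>x. f x \<partial>P) - (\<integral>x. f x \<partial>Q) = (\<integral>x. (r x - 1) * f x \<partial>Q)"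
    unfolding eqP using intrf fQi by (simp add: left_diff_distrib)
  also have "\<dots> \<le> (\<integral>x. \<eta> / 2 * ((r x)\<^sup>2 - 2 * r x + 1) + (f x)\<^sup>2 / (2 * \<eta>) \<partial>Q)"
  proof (rule integral_mono)
    show "integrable Q (\<lambda>x. (r x - 1) * f x)" using intrf fQi by (simp add: left_diff_distrib)
    show "integrable Q (\<lambda>x. \<eta> / 2 * ((r x)\<^sup>2 - 2 * r x + 1) + (f x)\<^sup>2 / (2 * \<eta>))"
      using intr2 intr fQ by auto
    fix x
    have "0 \<le> (\<eta> * (r x - 1) - f x)\<^sup>2 / (2 * \<eta>)" using \<eta> by simp
    also have "\<dots> = \<eta> / 2 * ((r x)\<^sup>2 - 2 * r x + 1) + (f x)\<^sup>2 / (2 * \<eta>) - (r x - 1) * f x"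
      using \<eta> by (simp add: field_simps power2_eq_square)
    finally show "(r x - 1) * f x \<le> \<eta> / 2 * ((r x)\<^sup>2 - 2 * r x + 1) + (f x)\<^sup>2 / (2 * \<eta>)" by simp
  qed
  also have "\<dots> = \<eta> / 2 * (enn2real I - 1) + (\<integral>x. (f x)\<^sup>2 \<partial>Q) / (2 * \<eta>)"
    using intr2 intr fQ r1 Ieq Q.prob_space by simp
  also have "\<dots> \<le> \<eta> / 2 * (exp (2 * \<rho>) - 1) + (\<integral>x. (f x)\<^sup>2 \<partial>Q) / (2 * \<eta>)"
    using Ile \<eta> by (simp add: mult_left_mono)
  finally show ?thesis by simp
qed

section \<open>Integration by parts on the cube\<close>

abbreviation cube :: "'e set \<Rightarrow> ('e \<Rightarrow> real) set" where
  "cube E \<equiv> E \<rightarrow>\<^sub>E {-1..1}"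

text \<open>
  Lebesgue measure restricted factor by factor, so that the space of the product is the cube
  itself and no almost-everywhere statement about the cube is necessary. Of its total mass
  only the positivity matters.
\<close>

definition cube_measure :: "'e set \<Rightarrow> ('e \<Rightarrow> real) measure" where
  "cube_measure E = (\<Pi>\<^sub>M e\<in>E. restrict_space lborel {-1..1})"

lemma space_cube_measure: "space (cube_measure E) = cube E"
  by (simp add: cube_measure_def space_PiM)

lemma cube_coordinate_measurable [measurable]:
  assumes "e \<in> E"
  shows "(\<lambda>\<theta>. \<theta> e) \<in> borel_measurable (cube_measure E)"
proof -
  have "(\<lambda>x::real. x) \<in> restrict_space lborel {-1..1} \<rightarrow>\<^sub>M borel"
    by (rule measurable_restrict_space1) simp
  from measurable_compose[OF measurable_component_singleton[OF assms] this]
  show ?thesis by (simp add: cube_measure_def)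
qed

lemma finite_measure_segment: "finite_measure (restrict_space lborel {-1..1::real})"
  by (rule finite_measureI) (simp add: emeasure_restrict_space space_restrict_space)

interpretation cube_factors: product_sigma_finite "\<lambda>_. restrict_space lborel {-1..1::real}"
  by (intro product_sigma_finite.intro finite_measure.axioms(1) finite_measure_segment)

lemma emeasure_cube_measure:
  assumes "finite E"
  shows "emeasure (cube_measure E) (space (cube_measure E)) = 2 ^ card E"
proof -
  have "emeasure (cube_measure E) (space (cube_measure E))
      = (\<Prod>e\<in>E. emeasure (restrict_space lborel {-1..1::real}) {-1..1})"
    unfolding space_cube_measure unfolding cube_measure_def
    by (rule cube_factors.emeasure_PiM) (use assms in \<open>auto simp: sets_restrict_space\<close>)
  then show ?thesis by (simp add: emeasure_restrict_space)
qed

lemma integral_cube_partial_derivative: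
  fixes F D :: "('e \<Rightarrow> real) \<Rightarrow> real"
  assumes E: "finite E" "e \<in> E"
    and meas: "D \<in> borel_measurable (cube_measure E)"
    and bound: "\<And>\<theta>. \<theta> \<in> cube E \<Longrightarrow> \<bar>D \<theta>\<bar> \<le> C"
    and deriv: "\<And>\<theta>. \<theta> \<in> cube E \<Longrightarrow>
      ((\<lambda>t. F (\<theta>(e := t))) has_real_derivative D \<theta>) (at (\<theta> e) within {-1..1})"
    and boundary: "\<And>\<theta>. \<theta> \<in> cube E \<Longrightarrow> F (\<theta>(e := 1)) = F (\<theta>(e := -1))"
  shows "integrable (cube_measure E) D" "(\<integral>\<theta>. D \<theta> \<partial>cube_measure E) = 0"
proof -
  have fin: "finite_measure (cube_measure E)"
    by (rule finite_measureI) (simp add: emeasure_cube_measure[OF E(1)] power_eq_top_ennreal)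
  show int: "integrable (cube_measure E) D"
  proof (rule finite_measure.integrable_const_bound[OF fin _ meas])
    show "AE \<theta> in cube_measure E. norm (D \<theta>) \<le> C"
      using bound by (intro AE_I2) (simp add: space_cube_measure)
  qed
  define I where "I = E - {e}"
  have I: "finite I" "e \<notin> I" "insert e I = E" using E by (auto simp: I_def)
  have inner: "(\<integral>y. D (x(e := y)) \<partial>restrict_space lborel {-1..1}) = 0"
    if x: "x \<in> space (\<Pi>\<^sub>M e\<in>I. restrict_space lborel {-1..1::real})" for x
  proof -
    have xc: "x(e := y) \<in> cube E" if "y \<in> {-1..1}" for y
      using x that unfolding I(3)[symmetric] by (auto simp: space_PiM intro!: PiE_fun_upd)
    have "((\<lambda>y. D (x(e := y))) has_integral F (x(e := 1)) - F (x(e := -1))) {-1..1}"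
    proof (rule fundamental_theorem_of_calculus)
      fix y :: real assume y: "y \<in> {-1..1}"
      show "((\<lambda>t. F (x(e := t))) has_vector_derivative D (x(e := y))) (at y within {-1..1})"
        using deriv[OF xc[OF y]] by (simp add: has_real_derivative_iff_has_vector_derivative)
    qed simp
    moreover have "F (x(e := 1)) = F (x(e := -1))" using boundary[OF xc[of 1]] by simp
    ultimately have h: "((\<lambda>y. D (x(e := y))) has_integral 0) {-1..1}" by simp
    have m: "(\<lambda>y. D (x(e := y))) \<in> borel_measurable (restrict_space lborel {-1..1})"
    proof -
      have "(\<lambda>y. x(e := y)) \<in> restrict_space lborel {-1..1} \<rightarrow>\<^sub>M cube_measure E"
        unfolding cube_measure_def I(3)[symmetric]
        by (rule measurable_fun_upd[OF _ measurable_const[OF x]]) auto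
      then show ?thesis using meas by (rule measurable_compose)
    qed
    have "integrable (restrict_space lborel {-1..1}) (\<lambda>y. D (x(e := y)))"
    proof (rule finite_measure.integrable_const_bound[OF finite_measure_segment _ m])
      show "AE y in restrict_space lborel {-1..1}. norm (D (x(e := y))) \<le> C"
        using bound[OF xc] by (intro AE_I2) (simp add: space_restrict_space)
    qed
    then have "set_integrable lborel {-1..1} (\<lambda>y. D (x(e := y)))"
      by (simp add: set_integrable_def integrable_restrict_space)
    then have "(LINT y:{-1..1}|lborel. D (x(e := y))) = integral {-1..1} (\<lambda>y. D (x(e := y)))"
      by (rule set_borel_integral_eq_integral)
    then have "(LINT y:{-1..1}|lborel. D (x(e := y))) = 0"
      using h by (simp add: integral_unique)
    then show ?thesis by (simp add: set_lebesgue_integral_def integral_restrict_space)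
  qed
  have "(\<integral>\<theta>. D \<theta> \<partial>cube_measure E) = (\<integral>x. (\<integral>y. D (x(e := y)) \<partial>restrict_space lborel {-1..1})
      \<partial>(\<Pi>\<^sub>M e\<in>I. restrict_space lborel {-1..1}))"
    using cube_factors.product_integral_insert[OF I(1,2), of D] int by (simp add: cube_measure_def I(3))
  also have "\<dots> = 0"
    using inner by (subst Bochner_Integration.integral_cong[OF refl, of _ _ "\<lambda>_. 0"]) auto
  finally show "(\<integral>\<theta>. D \<theta> \<partial>cube_measure E) = 0" .
qed

text \<open>
  A vector field whose components agree on opposite faces has divergence of mean zero, so a
  constant upper bound for the divergence cannot be negative.
\<close>

lemma divergence_upper_bound_nonneg:
  fixes F D :: "'e \<Rightarrow> ('e \<Rightarrow> real) \<Rightarrow> real"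
  assumes E: "finite E" 
    and meas: "\<And>e. e \<in> E \<Longrightarrow> D e \<in> borel_measurable (cube_measure E)"
    and bound: "\<And>e \<theta>. e \<in> E \<Longrightarrow> \<theta> \<in> cube E \<Longrightarrow> \<bar>D e \<theta>\<bar> \<le> C e"
    and deriv: "\<And>e \<theta>. e \<in> E \<Longrightarrow> \<theta> \<in> cube E \<Longrightarrow>
      ((\<lambda>t. F e (\<theta>(e := t))) has_real_derivative D e \<theta>) (at (\<theta> e) within {-1..1})"
    and boundary: "\<And>e \<theta>. e \<in> E \<Longrightarrow> \<theta> \<in> cube E \<Longrightarrow> F e (\<theta>(e := 1)) = F e (\<theta>(e := -1))"
    and upper: "\<And>\<theta>. \<theta> \<in> cube E \<Longrightarrow> (\<Sum>e\<in>E. D e \<theta>) \<le> c"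
  shows "0 \<le> (c :: real)"
proof -
  have fin: "finite_measure (cube_measure E)"
    by (rule finite_measureI) (simp add: emeasure_cube_measure[OF E] power_eq_top_ennreal)
  note partial = integral_cube_partial_derivative[OF E _ meas bound deriv boundary]
  have "0 = (\<integral>\<theta>. (\<Sum>e\<in>E. D e \<theta>) \<partial>cube_measure E)"
    using partial by (subst Bochner_Integration.integral_sum) auto
  also have "\<dots> \<le> (\<integral>\<theta>. c \<partial>cube_measure E)"
    using partial finite_measure.integrable_const[OF fin] upper
    by (intro integral_mono Bochner_Integration.integrable_sum) (auto simp: space_cube_measure)
  also have "\<dots> = 2 ^ card E * c"
  proof -
    have "(2 :: ennreal) ^ card E = ennreal (2 ^ card E)"
      by (metis ennreal_numeral ennreal_power zero_le_numeral)
    then show ?thesis using emeasure_cube_measure[OF E] by (simp add: measure_def)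
  qed
  finally have "0 \<le> 2 ^ card E * c" .
  moreover have "(0::real) < 2 ^ card E" by simp
  ultimately show ?thesis by (metis zero_le_mult_iff not_le)
qed

section \<open>The score attack\<close>

text \<open>
  A family of laws on a finite sample space, indexed by a cube, with score \<open>s\<close>, that is, the
  logarithmic derivative of \<open>q\<close>. The number \<open>L\<close> bounds the largest eigenvalue of the Fisher information
  matrix. The bound \<open>C\<close> is qualitative and only makes integrals over the cube finite.
\<close>

locale scored_family =
  fixes \<Omega> :: "'w set" and E :: "'e set"
    and q :: "('e \<Rightarrow> real) \<Rightarrow> 'w \<Rightarrow> real"
    and s :: "('e \<Rightarrow> real) \<Rightarrow> 'e \<Rightarrow> 'w \<Rightarrow> real"
    and L C :: real
  assumes finite_sample: "finite \<Omega>" and finite_index: "finite E" and L_nonneg: "0 \<le> L"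
    and q_pos: "\<And>\<theta> \<omega>. \<theta> \<in> cube E \<Longrightarrow> \<omega> \<in> \<Omega> \<Longrightarrow> 0 < q \<theta> \<omega>"
    and q_sum: "\<And>\<theta>. \<theta> \<in> cube E \<Longrightarrow> (\<Sum>\<omega>\<in>\<Omega>. q \<theta> \<omega>) = 1"
    and q_deriv: "\<And>\<theta> e \<omega>. \<theta> \<in> cube E \<Longrightarrow> e \<in> E \<Longrightarrow> \<omega> \<in> \<Omega> \<Longrightarrow>
      ((\<lambda>t. q (\<theta>(e := t)) \<omega>) has_real_derivative q \<theta> \<omega> * s \<theta> e \<omega>) (at (\<theta> e) within {-1..1})"
    and q_meas [measurable]: "\<And>\<omega>. \<omega> \<in> \<Omega> \<Longrightarrow> (\<lambda>\<theta>. q \<theta> \<omega>) \<in> borel_measurable (cube_measure E)"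
    and s_meas [measurable]: "\<And>e \<omega>. e \<in> E \<Longrightarrow> \<omega> \<in> \<Omega> \<Longrightarrow> (\<lambda>\<theta>. s \<theta> e \<omega>) \<in> borel_measurable (cube_measure E)"
    and s_mean: "\<And>\<theta> e. \<theta> \<in> cube E \<Longrightarrow> e \<in> E \<Longrightarrow> (\<Sum>\<omega>\<in>\<Omega>. q \<theta> \<omega> * s \<theta> e \<omega>) = 0"
    and s_bound: "\<And>\<theta> e \<omega>. \<theta> \<in> cube E \<Longrightarrow> e \<in> E \<Longrightarrow> \<omega> \<in> \<Omega> \<Longrightarrow> \<bar>s \<theta> e \<omega>\<bar> \<le> C"
    and fisher: "\<And>\<theta> u. \<theta> \<in> cube E \<Longrightarrow>
      (\<Sum>\<omega>\<in>\<Omega>. q \<theta> \<omega> * (\<Sum>e\<in>E. u e * s \<theta> e \<omega>)\<^sup>2) \<le> L * (\<Sum>e\<in>E. (u e)\<^sup>2)"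

text \<open>
  An estimator is a family of laws \<open>\<mu> S\<close> on an arbitrary output space together with real
  functions \<open>T\<close> of the output, one for each parameter.
\<close>

locale estimated_family = scored_family \<Omega> E q s L C
  for \<Omega> :: "'w set" and E :: "'e set" and q s L C +
  fixes n :: nat and \<mu> :: "(nat \<Rightarrow> 'w) \<Rightarrow> 'b measure" and T :: "'e \<Rightarrow> 'b \<Rightarrow> real"
  assumes \<mu>_prob: "\<And>S. S \<in> {..<n} \<rightarrow>\<^sub>E \<Omega> \<Longrightarrow> prob_space (\<mu> S)"
    and T_meas [measurable]: "\<And>S e. S \<in> {..<n} \<rightarrow>\<^sub>E \<Omega> \<Longrightarrow> e \<in> E \<Longrightarrow> T e \<in> borel_measurable (\<mu> S)"
    and T_square: "\<And>S e. S \<in> {..<n} \<rightarrow>\<^sub>E \<Omega> \<Longrightarrow> e \<in> E \<Longrightarrow> integrable (\<mu> S) (\<lambda>B. (T e B)\<^sup>2)"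
begin

definition data_prob :: "('e \<Rightarrow> real) \<Rightarrow> (nat \<Rightarrow> 'w) \<Rightarrow> real" where
  "data_prob \<theta> S = (\<Prod>k<n. q \<theta> (S k))"

definition data_score :: "('e \<Rightarrow> real) \<Rightarrow> 'e \<Rightarrow> (nat \<Rightarrow> 'w) \<Rightarrow> real" where
  "data_score \<theta> e S = (\<Sum>k<n. s \<theta> e (S k))"

definition data :: "(nat \<Rightarrow> 'w) set" where "data = {..<n} \<rightarrow>\<^sub>E \<Omega>"

definition mse :: "('e \<Rightarrow> real) \<Rightarrow> real" where
  "mse \<theta> = (\<Sum>S\<in>data. data_prob \<theta> S * (\<integral>B. (\<Sum>e\<in>E. (T e B - \<theta> e)\<^sup>2) \<partial>\<mu> S))"

text \<open>
  The weight \<open>1 - (\<theta> e)\<^sup>2\<close> vanishes on the faces of the cube, so integrating by parts leaves no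
  boundary term.
\<close>

definition attack :: "('e \<Rightarrow> real) \<Rightarrow> real" where
  "attack \<theta> = (\<Sum>S\<in>data. data_prob \<theta> S *
     (\<integral>B. (\<Sum>e\<in>E. (1 - (\<theta> e)\<^sup>2) * (T e B - \<theta> e) * data_score \<theta> e S) \<partial>\<mu> S))"

lemma finite_data: "finite data"
  by (simp add: data_def finite_PiE finite_sample)

lemma data_component: "S \<in> data \<Longrightarrow> k < n \<Longrightarrow> S k \<in> \<Omega>"
  by (auto simp: data_def PiE_iff)

lemma T_integrable: "S \<in> data \<Longrightarrow> e \<in> E \<Longrightarrow> integrable (\<mu> S) (T e)"
  unfolding data_def
  by (rule finite_measure.square_integrable_imp_integrable)
     (use \<mu>_prob T_square T_meas in \<open>auto simp: prob_space_def\<close>)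

lemma T_shift_square_integrable: 
  assumes "S \<in> data" "e \<in> E" shows "integrable (\<mu> S) (\<lambda>B. (T e B - c)\<^sup>2)"
proof -
  interpret prob_space "\<mu> S" using assms \<mu>_prob by (simp add: data_def)
  show ?thesis
    using T_integrable[OF assms] T_square[of S e] assms
    by (simp add: power2_diff data_def)
qed

lemma data_prob_pos: "\<theta> \<in> cube E \<Longrightarrow> S \<in> data \<Longrightarrow> 0 < data_prob \<theta> S"
  unfolding data_prob_def by (intro prod_pos) (auto simp: q_pos data_component)

lemma data_prob_sum: "\<theta> \<in> cube E \<Longrightarrow> (\<Sum>S\<in>data. data_prob \<theta> S) = 1"
  unfolding data_prob_def data_def by (rule sum_PiE_prod_one) (auto simp: finite_sample q_sum)

lemma data_prob_le_one: "\<theta> \<in> cube E \<Longrightarrow> S \<in> data \<Longrightarrow> data_prob \<theta> S \<le> 1"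
  using member_le_sum[of S data "data_prob \<theta>"] data_prob_sum[of \<theta>] data_prob_pos[of \<theta>] finite_data
  by (simp add: less_imp_le)

lemma data_prob_score_mean:
  assumes "\<theta> \<in> cube E" "e \<in> E"
  shows "(\<Sum>S\<in>data. data_prob \<theta> S * data_score \<theta> e S) = 0"
proof -
  have "(\<Sum>S\<in>data. data_prob \<theta> S * data_score \<theta> e S) = (\<Sum>k<n. \<Sum>S\<in>data. data_prob \<theta> S * s \<theta> e (S k))"
    unfolding data_score_def sum_distrib_left by (rule sum.swap)
  also have "\<dots> = (\<Sum>k<n. 0)"
    unfolding data_prob_def data_def
    by (intro sum.cong refl, subst sum_PiE_marginal)
       (use assms in \<open>auto simp: finite_sample q_sum s_mean\<close>)
  finally show ?thesis by simp
qed

lemma data_prob_score_square: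
  assumes "\<theta> \<in> cube E" "e \<in> E"
  shows "(\<Sum>S\<in>data. data_prob \<theta> S * (data_score \<theta> e S)\<^sup>2) \<le> n * L"
proof -
  have "(\<Sum>S\<in>data. data_prob \<theta> S * (data_score \<theta> e S)\<^sup>2) = (\<Sum>k<n. \<Sum>\<omega>\<in>\<Omega>. q \<theta> \<omega> * (s \<theta> e \<omega> * s \<theta> e \<omega>))"
    unfolding data_prob_def data_score_def data_def power2_eq_square
    by (rule sum_PiE_covariance) (use assms in \<open>auto simp: finite_sample q_sum s_mean\<close>)
  moreover have "(\<Sum>\<omega>\<in>\<Omega>. q \<theta> \<omega> * (s \<theta> e \<omega> * s \<theta> e \<omega>)) \<le> L"
    using fisher[OF assms(1), of "\<lambda>e'. if e' = e then 1 else 0"] assms(2) finite_index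
    by (simp add: if_distrib[of "\<lambda>x. x * _"] if_distrib[of "\<lambda>x. x ^ _"] power2_eq_square cong: if_cong)
  ultimately show ?thesis by (simp add: mult_left_mono)
qed

lemma data_prob_deriv:
  assumes "\<theta> \<in> cube E" "e \<in> E" "S \<in> data"
  shows "((\<lambda>t. data_prob (\<theta>(e := t)) S) has_real_derivative data_prob \<theta> S * data_score \<theta> e S) (at (\<theta> e) within {-1..1})"
proof -
  have "((\<lambda>t. \<Prod>k<m. q (\<theta>(e := t)) (S k)) has_real_derivative
      (\<Prod>k<m. q \<theta> (S k)) * (\<Sum>k<m. s \<theta> e (S k))) (at (\<theta> e) within {-1..1})" if "m \<le> n" for m
    using that
  proof (induction m)
    case (Suc m)
    have "((\<lambda>t. (\<Prod>k<m. q (\<theta>(e := t)) (S k)) * q (\<theta>(e := t)) (S m)) has_real_derivative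
        (\<Prod>k<m. q \<theta> (S k)) * (\<Sum>k<m. s \<theta> e (S k)) * q \<theta> (S m)
        + q \<theta> (S m) * s \<theta> e (S m) * (\<Prod>k<m. q \<theta> (S k))) (at (\<theta> e) within {-1..1})"
    proof -
      have "((\<lambda>t. \<Prod>k<m. q (\<theta>(e := t)) (S k)) has_real_derivative
        (\<Prod>k<m. q \<theta> (S k)) * (\<Sum>k<m. s \<theta> e (S k))) (at (\<theta> e) within {-1..1})"
        by (rule Suc.IH) (use Suc.prems in simp)
      moreover have "((\<lambda>t. q (\<theta>(e := t)) (S m)) has_real_derivative q \<theta> (S m) * s \<theta> e (S m))
          (at (\<theta> e) within {-1..1})"
        using Suc.prems by (intro q_deriv assms data_component) auto
      ultimately show ?thesis
        by (rule DERIV_mult[THEN DERIV_cong]) (simp only: fun_upd_triv)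
    qed
    then show ?case
      unfolding prod.lessThan_Suc by (rule DERIV_cong) (simp add: algebra_simps)
  qed simp
  from this[of n] show ?thesis by (simp add: data_prob_def data_score_def)
qed

text \<open>
  The score mean being zero, \<open>attack \<theta>\<close> is the sum of \<open>(1 - (\<theta> e)\<^sup>2) g' e \<theta>\<close>, with \<open>g e \<theta>\<close> the mean of
  \<open>T e\<close> and \<open>g' e\<close> its partial derivative. The field \<open>(1 - (\<theta> e)\<^sup>2) (g e \<theta> - \<theta> e / 3)\<close> vanishes on the faces. Its
  divergence is \<open>attack \<theta> - card E / 3\<close> plus the sum of \<open>(\<theta> e)\<^sup>2 - 2 \<theta> e g e \<theta>\<close>, and this sum is at
  most the squared error, which exceeds it by the second moments of the \<open>T e\<close>. The correction \<open>\<theta> e / 3\<close>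
  is chosen to replace the mean of \<open>(\<theta> e)\<^sup>2\<close> over the cube by its value \<open>1/3\<close>.
\<close>

theorem attack_lower_bound:
  assumes attack: "\<And>\<theta>. \<theta> \<in> cube E \<Longrightarrow> attack \<theta> \<le> B"
    and mse: "\<And>\<theta>. \<theta> \<in> cube E \<Longrightarrow> mse \<theta> \<le> R"
  shows "card E / 3 \<le> B + R"
proof -
  define t where "t e S = (\<integral>B. T e B \<partial>\<mu> S)" for e S
  define g where "g e \<theta> = (\<Sum>S\<in>data. data_prob \<theta> S * t e S)" for e \<theta>
  define g' where "g' e \<theta> = (\<Sum>S\<in>data. data_prob \<theta> S * data_score \<theta> e S * t e S)" for e \<theta>
  define F where "F e \<theta> = (1 - (\<theta> e)\<^sup>2) * (g e \<theta> - \<theta> e / 3)" for e \<theta>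
  define D where "D e \<theta> = (1 - (\<theta> e)\<^sup>2) * (g' e \<theta> - 1 / 3) - 2 * \<theta> e * (g e \<theta> - \<theta> e / 3)" for e \<theta>
  have t_bound: "\<bar>g e \<theta>\<bar> \<le> (\<Sum>S\<in>data. \<bar>t e S\<bar>)" "\<bar>g' e \<theta>\<bar> \<le> (\<Sum>S\<in>data. (n * C) * \<bar>t e S\<bar>)"
    if "\<theta> \<in> cube E" "e \<in> E" for e \<theta>
  proof -
    note \<theta>e = that
    show "\<bar>g e \<theta>\<bar> \<le> (\<Sum>S\<in>data. \<bar>t e S\<bar>)"
      unfolding g_def
    proof (rule sum_abs[THEN order_trans], rule sum_mono)
      fix S assume S: "S \<in> data"
      have "\<bar>data_prob \<theta> S * t e S\<bar> = data_prob \<theta> S * \<bar>t e S\<bar>"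
        using data_prob_pos[OF that(1) S] by (simp add: abs_mult)
      also have "\<dots> \<le> \<bar>t e S\<bar>"
        using data_prob_pos[OF that(1) S] data_prob_le_one[OF that(1) S] by (intro mult_left_le_one_le) auto
      finally show "\<bar>data_prob \<theta> S * t e S\<bar> \<le> \<bar>t e S\<bar>" .
    qed
    have total: "\<bar>data_score \<theta> e S\<bar> \<le> n * C" if S: "S \<in> data" for S
    proof -
      have "\<bar>data_score \<theta> e S\<bar> \<le> (\<Sum>k<n. C)" unfolding data_score_def
        by (rule sum_abs[THEN order_trans], rule sum_mono, rule s_bound[OF \<theta>e], rule data_component[OF S]) simp
      then show ?thesis by simp
    qed
    show "\<bar>g' e \<theta>\<bar> \<le> (\<Sum>S\<in>data. (n * C) * \<bar>t e S\<bar>)"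
      unfolding g'_def
    proof (rule sum_abs[THEN order_trans], rule sum_mono)
      fix S assume S: "S \<in> data"
      have "\<bar>data_prob \<theta> S * data_score \<theta> e S * t e S\<bar> = data_prob \<theta> S * (\<bar>data_score \<theta> e S\<bar> * \<bar>t e S\<bar>)"
        using data_prob_pos[OF that(1) S] by (simp add: abs_mult)
      also have "\<dots> \<le> 1 * (n * C * \<bar>t e S\<bar>)"
        using data_prob_pos[OF that(1) S] data_prob_le_one[OF that(1) S] total[OF S]
        by (intro mult_mono) (auto intro: mult_right_mono)
      finally show "\<bar>data_prob \<theta> S * data_score \<theta> e S * t e S\<bar> \<le> n * C * \<bar>t e S\<bar>" by simp
    qed
  qed
  have "0 \<le> B + R - card E / 3"
  proof (rule divergence_upper_bound_nonneg[OF finite_index, where F = F and D = D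
        and C = "\<lambda>e. ((\<Sum>S\<in>data. (n * C) * \<bar>t e S\<bar>) + 1 / 3) + 2 * ((\<Sum>S\<in>data. \<bar>t e S\<bar>) + 1 / 3)"])
    fix e assume e: "e \<in> E"
    have [measurable]: "(\<lambda>\<theta>. data_prob \<theta> S) \<in> borel_measurable (cube_measure E)"
      "(\<lambda>\<theta>. data_score \<theta> e S) \<in> borel_measurable (cube_measure E)" if "S \<in> data" for S
      unfolding data_prob_def data_score_def
      by (intro borel_measurable_prod borel_measurable_sum q_meas s_meas e data_component[OF that]; simp)+
    have [measurable]: "(\<lambda>\<theta>. \<theta> e) \<in> borel_measurable (cube_measure E)"
      using e by (rule cube_coordinate_measurable)
    have [measurable]: "(\<lambda>\<theta>. g e \<theta>) \<in> borel_measurable (cube_measure E)"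
      "(\<lambda>\<theta>. g' e \<theta>) \<in> borel_measurable (cube_measure E)"
      unfolding g_def g'_def by (intro borel_measurable_sum borel_measurable_times borel_measurable_const; simp)+
    have "(\<lambda>\<theta>. D e \<theta>) \<in> borel_measurable (cube_measure E)"
      unfolding D_def
      by (intro borel_measurable_diff borel_measurable_times borel_measurable_power borel_measurable_divide
          borel_measurable_const; fact)
    then show "D e \<in> borel_measurable (cube_measure E)" .
    fix \<theta> :: "'e \<Rightarrow> real" assume \<theta>: "\<theta> \<in> cube E"
    have \<theta>e: "\<bar>\<theta> e\<bar> \<le> 1" using PiE_mem[OF \<theta> e] by (simp add: abs_le_iff)
    then have \<theta>2: "0 \<le> 1 - (\<theta> e)\<^sup>2" "1 - (\<theta> e)\<^sup>2 \<le> 1" by (auto simp: abs_square_le_1)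
    show "\<bar>D e \<theta>\<bar> \<le> ((\<Sum>S\<in>data. (n * C) * \<bar>t e S\<bar>) + 1 / 3) + 2 * ((\<Sum>S\<in>data. \<bar>t e S\<bar>) + 1 / 3)"
    proof -
      have "\<bar>D e \<theta>\<bar> \<le> \<bar>1 - (\<theta> e)\<^sup>2\<bar> * \<bar>g' e \<theta> - 1 / 3\<bar> + \<bar>2 * \<theta> e\<bar> * \<bar>g e \<theta> - \<theta> e / 3\<bar>"
        unfolding D_def abs_mult[symmetric] by (rule abs_triangle_ineq4)
      also have "\<dots> \<le> 1 * ((\<Sum>S\<in>data. (n * C) * \<bar>t e S\<bar>) + 1 / 3) + 2 * ((\<Sum>S\<in>data. \<bar>t e S\<bar>) + 1 / 3)"
        using \<theta>2 \<theta>e t_bound[OF \<theta> e]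
        by (intro add_mono mult_mono) (auto simp: abs_mult)
      finally show ?thesis by simp
    qed
    have g_deriv: "((\<lambda>u. g e (\<theta>(e := u))) has_real_derivative g' e \<theta>) (at (\<theta> e) within {-1..1})"
      unfolding g_def g'_def
      by (intro DERIV_sum DERIV_cmult_right data_prob_deriv[OF \<theta> e])
    show "((\<lambda>u. F e (\<theta>(e := u))) has_real_derivative D e \<theta>) (at (\<theta> e) within {-1..1})"
    proof -
      have "((\<lambda>u. 1 - u\<^sup>2) has_real_derivative - 2 * \<theta> e) (at (\<theta> e) within {-1..1})"
        by (auto intro!: derivative_eq_intros)
      moreover have "((\<lambda>u. g e (\<theta>(e := u)) - u / 3) has_real_derivative g' e \<theta> - 1 / 3) (at (\<theta> e) within {-1..1})"
        by (intro DERIV_diff g_deriv) (auto intro!: derivative_eq_intros)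
      ultimately have "((\<lambda>u. (1 - u\<^sup>2) * (g e (\<theta>(e := u)) - u / 3)) has_real_derivative D e \<theta>) (at (\<theta> e) within {-1..1})"
        by (rule DERIV_mult[THEN DERIV_cong]) (simp add: D_def)
      then show ?thesis by (simp add: F_def)
    qed
    show "F e (\<theta>(e := 1)) = F e (\<theta>(e := - 1))" by (simp add: F_def)
  next
    fix \<theta> :: "'e \<Rightarrow> real" assume \<theta>: "\<theta> \<in> cube E"
    have int: "prob_space (\<mu> S)" if "S \<in> data" for S using \<mu>_prob that by (simp add: data_def)
    have A: "attack \<theta> = (\<Sum>e\<in>E. (1 - (\<theta> e)\<^sup>2) * g' e \<theta>)"
    proof -
      have "attack \<theta> = (\<Sum>S\<in>data. \<Sum>e\<in>E. data_prob \<theta> S * ((1 - (\<theta> e)\<^sup>2) * (t e S - \<theta> e) * data_score \<theta> e S))"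
        unfolding attack_def
      proof (intro sum.cong refl)
        fix S assume S: "S \<in> data"
        interpret prob_space "\<mu> S" by (rule int[OF S])
        show "data_prob \<theta> S * (\<integral>B. (\<Sum>e\<in>E. (1 - (\<theta> e)\<^sup>2) * (T e B - \<theta> e) * data_score \<theta> e S) \<partial>\<mu> S)
            = (\<Sum>e\<in>E. data_prob \<theta> S * ((1 - (\<theta> e)\<^sup>2) * (t e S - \<theta> e) * data_score \<theta> e S))"
          unfolding t_def using T_integrable[OF S] prob_space
          by (subst Bochner_Integration.integral_sum) (auto simp: sum_distrib_left)
      qed
      also have "\<dots> = (\<Sum>e\<in>E. \<Sum>S\<in>data. data_prob \<theta> S * ((1 - (\<theta> e)\<^sup>2) * (t e S - \<theta> e) * data_score \<theta> e S))"
        by (rule sum.swap)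
      also have "\<dots> = (\<Sum>e\<in>E. (1 - (\<theta> e)\<^sup>2) * g' e \<theta> - (1 - (\<theta> e)\<^sup>2) * \<theta> e * (\<Sum>S\<in>data. data_prob \<theta> S * data_score \<theta> e S))"
        unfolding g'_def sum_distrib_left sum_subtractf[symmetric]
        by (intro sum.cong refl) (simp add: algebra_simps)
      also have "\<dots> = (\<Sum>e\<in>E. (1 - (\<theta> e)\<^sup>2) * g' e \<theta>)"
        using data_prob_score_mean[OF \<theta>] by simp
      finally show ?thesis .
    qed
    have M: "(\<Sum>e\<in>E. (\<theta> e)\<^sup>2 - 2 * \<theta> e * g e \<theta>) \<le> mse \<theta>"
    proof -
      have "(\<Sum>e\<in>E. (\<theta> e)\<^sup>2 - 2 * \<theta> e * g e \<theta>)
          = (\<Sum>e\<in>E. (\<theta> e)\<^sup>2 * (\<Sum>S\<in>data. data_prob \<theta> S) - 2 * \<theta> e * g e \<theta>)"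
        using data_prob_sum[OF \<theta>] by simp
      also have "\<dots> = (\<Sum>e\<in>E. \<Sum>S\<in>data. data_prob \<theta> S * ((\<theta> e)\<^sup>2 - 2 * \<theta> e * t e S))"
        unfolding g_def sum_distrib_left sum_subtractf[symmetric]
        by (intro sum.cong refl) (simp add: algebra_simps)
      also have "\<dots> = (\<Sum>S\<in>data. data_prob \<theta> S * (\<Sum>e\<in>E. (\<theta> e)\<^sup>2 - 2 * \<theta> e * t e S))"
        unfolding sum_distrib_left by (rule sum.swap)
      also have "\<dots> \<le> mse \<theta>"
        unfolding mse_def
      proof (intro sum_mono mult_left_mono)
        fix S assume S: "S \<in> data"
        interpret prob_space "\<mu> S" by (rule int[OF S])
        show "0 \<le> data_prob \<theta> S" using data_prob_pos[OF \<theta> S] by simp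
        have "(\<integral>B. (\<Sum>e\<in>E. (T e B - \<theta> e)\<^sup>2) \<partial>\<mu> S) = (\<Sum>e\<in>E. \<integral>B. (T e B - \<theta> e)\<^sup>2 \<partial>\<mu> S)"
          using T_shift_square_integrable[OF S] by (intro Bochner_Integration.integral_sum)
        also have "\<dots> = (\<Sum>e\<in>E. (\<integral>B. (T e B)\<^sup>2 \<partial>\<mu> S) + ((\<theta> e)\<^sup>2 - 2 * \<theta> e * t e S))"
          unfolding t_def using T_integrable[OF S] T_square S prob_space
          by (intro sum.cong refl) (simp add: power2_diff data_def)
        finally show "(\<Sum>e\<in>E. (\<theta> e)\<^sup>2 - 2 * \<theta> e * t e S) \<le> (\<integral>B. (\<Sum>e\<in>E. (T e B - \<theta> e)\<^sup>2) \<partial>\<mu> S)"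
          by (simp add: sum.distrib sum_nonneg)
      qed
      finally show ?thesis .
    qed
    have "(\<Sum>e\<in>E. D e \<theta>) = (\<Sum>e\<in>E. (1 - (\<theta> e)\<^sup>2) * g' e \<theta>) + (\<Sum>e\<in>E. (\<theta> e)\<^sup>2 - 2 * \<theta> e * g e \<theta>)
        - (\<Sum>e\<in>E. 1 / 3)"
      unfolding D_def sum.distrib[symmetric] sum_subtractf[symmetric]
      by (intro sum.cong refl) (simp add: algebra_simps power2_eq_square)
    also have "\<dots> \<le> B + R - card E / 3"
      using attack[OF \<theta>] mse[OF \<theta>] M unfolding A by simp
    finally show "(\<Sum>e\<in>E. D e \<theta>) \<le> B + R - card E / 3" .
  qed
  then show ?thesis by simp
qed

lemma shifted_mse_integral:
  assumes "S \<in> data"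
  shows "integrable (\<mu> S) (\<lambda>B. \<Sum>e\<in>E. (T e B - \<theta> e)\<^sup>2)"
  using T_shift_square_integrable[OF assms] by (intro Bochner_Integration.integrable_sum)

lemma cube_weight_bounds:
  fixes \<theta> :: "'e \<Rightarrow> real"
  assumes "\<theta> \<in> cube E" "e \<in> E"
  shows "0 \<le> 1 - (\<theta> e)\<^sup>2" "1 - (\<theta> e)\<^sup>2 \<le> 1"
proof -
  have "\<bar>\<theta> e\<bar> \<le> 1" using PiE_mem[OF assms] by (simp add: abs_le_iff)
  then show "0 \<le> 1 - (\<theta> e)\<^sup>2" "1 - (\<theta> e)\<^sup>2 \<le> 1" by (simp_all add: abs_square_le_1)
qed

text \<open>
  Cauchy-Schwarz with a free parameter; the second moment of the score of a sample is additive
  over the observations.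
\<close>

lemma attack_le_nonprivate:
  assumes \<theta>: "\<theta> \<in> cube E" and \<eta>: "\<eta> > 0"
  shows "attack \<theta> \<le> mse \<theta> / (2 * \<eta>) + \<eta> / 2 * (n * card E * L)"
proof -
  have "attack \<theta> \<le> (\<Sum>S\<in>data. data_prob \<theta> S * ((\<integral>B. (\<Sum>e\<in>E. (T e B - \<theta> e)\<^sup>2) \<partial>\<mu> S) / (2 * \<eta>)
      + \<eta> / 2 * (\<Sum>e\<in>E. (data_score \<theta> e S)\<^sup>2)))"
    unfolding attack_def
  proof (intro sum_mono mult_left_mono)
    fix S assume S: "S \<in> data"
    show "0 \<le> data_prob \<theta> S" using data_prob_pos[OF \<theta> S] by simp
    interpret prob_space "\<mu> S" using \<mu>_prob S by (simp add: data_def)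
    have "(\<integral>B. (\<Sum>e\<in>E. (1 - (\<theta> e)\<^sup>2) * (T e B - \<theta> e) * data_score \<theta> e S) \<partial>\<mu> S)
        \<le> (\<integral>B. (\<Sum>e\<in>E. (T e B - \<theta> e)\<^sup>2) / (2 * \<eta>) + \<eta> / 2 * (\<Sum>e\<in>E. (data_score \<theta> e S)\<^sup>2) \<partial>\<mu> S)"
    proof (rule integral_mono)
      show "integrable (\<mu> S) (\<lambda>B. \<Sum>e\<in>E. (1 - (\<theta> e)\<^sup>2) * (T e B - \<theta> e) * data_score \<theta> e S)"
        using T_integrable[OF S] by auto
      show "integrable (\<mu> S) (\<lambda>B. (\<Sum>e\<in>E. (T e B - \<theta> e)\<^sup>2) / (2 * \<eta>) + \<eta> / 2 * (\<Sum>e\<in>E. (data_score \<theta> e S)\<^sup>2))"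
        using shifted_mse_integral[OF S] by auto
      fix B
      have "(1 - (\<theta> e)\<^sup>2) * (T e B - \<theta> e) * data_score \<theta> e S \<le> (T e B - \<theta> e)\<^sup>2 / (2 * \<eta>) + \<eta> / 2 * (data_score \<theta> e S)\<^sup>2"
        if e: "e \<in> E" for e
      proof -
        define a where "a = \<bar>T e B - \<theta> e\<bar>"
        define b where "b = \<bar>data_score \<theta> e S\<bar>"
        have "(1 - (\<theta> e)\<^sup>2) * (T e B - \<theta> e) * data_score \<theta> e S \<le> (1 - (\<theta> e)\<^sup>2) * (a * b)"
          unfolding a_def b_def abs_mult[symmetric] mult.assoc
          using cube_weight_bounds[OF \<theta> e] by (intro mult_left_mono) auto
        also have "\<dots> \<le> a * b"
          using cube_weight_bounds[OF \<theta> e] by (intro mult_left_le_one_le) (auto simp: a_def b_def)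
        also have "\<dots> \<le> a\<^sup>2 / (2 * \<eta>) + \<eta> / 2 * b\<^sup>2"
        proof -
          have "0 \<le> (a - \<eta> * b)\<^sup>2 / (2 * \<eta>)" using \<eta> by simp
          also have "\<dots> = a\<^sup>2 / (2 * \<eta>) + \<eta> / 2 * b\<^sup>2 - a * b"
            using \<eta> by (simp add: field_simps power2_eq_square)
          finally show ?thesis by simp
        qed
        finally show ?thesis by (simp add: a_def b_def)
      qed
      then show "(\<Sum>e\<in>E. (1 - (\<theta> e)\<^sup>2) * (T e B - \<theta> e) * data_score \<theta> e S)
          \<le> (\<Sum>e\<in>E. (T e B - \<theta> e)\<^sup>2) / (2 * \<eta>) + \<eta> / 2 * (\<Sum>e\<in>E. (data_score \<theta> e S)\<^sup>2)"
        unfolding sum_divide_distrib sum_distrib_left sum.distrib[symmetric] by (rule sum_mono)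
    qed
    also have "\<dots> = (\<integral>B. (\<Sum>e\<in>E. (T e B - \<theta> e)\<^sup>2) \<partial>\<mu> S) / (2 * \<eta>) + \<eta> / 2 * (\<Sum>e\<in>E. (data_score \<theta> e S)\<^sup>2)"
      using shifted_mse_integral[OF S] prob_space by simp
    finally show "(\<integral>B. (\<Sum>e\<in>E. (1 - (\<theta> e)\<^sup>2) * (T e B - \<theta> e) * data_score \<theta> e S) \<partial>\<mu> S)
        \<le> (\<integral>B. (\<Sum>e\<in>E. (T e B - \<theta> e)\<^sup>2) \<partial>\<mu> S) / (2 * \<eta>) + \<eta> / 2 * (\<Sum>e\<in>E. (data_score \<theta> e S)\<^sup>2)" .
  qed
  also have "\<dots> = mse \<theta> / (2 * \<eta>) + \<eta> / 2 * (\<Sum>S\<in>data. data_prob \<theta> S * (\<Sum>e\<in>E. (data_score \<theta> e S)\<^sup>2))"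
  proof -
    have "(\<Sum>S\<in>data. data_prob \<theta> S * (a S / (2 * \<eta>) + \<eta> / 2 * b S))
        = (\<Sum>S\<in>data. data_prob \<theta> S * a S) / (2 * \<eta>) + \<eta> / 2 * (\<Sum>S\<in>data. data_prob \<theta> S * b S)" for a b
      unfolding sum_divide_distrib sum_distrib_left sum.distrib[symmetric]
      by (intro sum.cong refl) (simp add: algebra_simps)
    then show ?thesis unfolding mse_def .
  qed
  also have "(\<Sum>S\<in>data. data_prob \<theta> S * (\<Sum>e\<in>E. (data_score \<theta> e S)\<^sup>2)) = (\<Sum>e\<in>E. \<Sum>S\<in>data. data_prob \<theta> S * (data_score \<theta> e S)\<^sup>2)"
    unfolding sum_distrib_left by (rule sum.swap)
  also have "mse \<theta> / (2 * \<eta>) + \<eta> / 2 * (\<Sum>e\<in>E. \<Sum>S\<in>data. data_prob \<theta> S * (data_score \<theta> e S)\<^sup>2)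
      \<le> mse \<theta> / (2 * \<eta>) + \<eta> / 2 * (\<Sum>e\<in>E. n * L)"
    using \<eta> data_prob_score_square[OF \<theta>] by (intro add_left_mono mult_left_mono sum_mono) auto
  finally show ?thesis by (simp add: mult.assoc mult.left_commute)
qed

text \<open>
  If \<open>x\<close> is a fresh observation, then the pairs \<open>(S, x)\<close> and \<open>(S(k := x), S k)\<close> have the same
  law, as the second arises from the first by exchanging two independent observations.
\<close>

lemma exchange_fresh_sample:
  assumes k: "k < n"
  shows "(\<Sum>S\<in>data. \<Sum>x\<in>\<Omega>. data_prob \<theta> S * q \<theta> x * G (S(k := x)) (S k))
       = (\<Sum>S\<in>data. \<Sum>x\<in>\<Omega>. data_prob \<theta> S * q \<theta> x * (G S x :: real))"
proof -
  define \<phi> where "\<phi> = (\<lambda>(S :: nat \<Rightarrow> 'w, x). (S(k := x), S k))"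
  have upd: "S(k := x) \<in> data" if "S \<in> data" "x \<in> \<Omega>" for S x
    using that k by (auto simp: data_def PiE_iff extensional_def)
  have weight: "data_prob \<theta> (S(k := x)) * q \<theta> (S k) = data_prob \<theta> S * q \<theta> x" for S x
  proof -
    have "(\<Prod>l\<in>{..<n} - {k}. q \<theta> ((S(k := x)) l)) = (\<Prod>l\<in>{..<n} - {k}. q \<theta> (S l))"
      by (intro prod.cong) auto
    then show ?thesis using k by (simp add: data_prob_def prod.remove[of "{..<n}" k])
  qed
  have "(\<Sum>z\<in>data \<times> \<Omega>. data_prob \<theta> (fst z) * q \<theta> (snd z) * G ((fst z)(k := snd z)) (fst z k))
      = (\<Sum>z\<in>data \<times> \<Omega>. data_prob \<theta> (fst z) * q \<theta> (snd z) * G (fst z) (snd z))"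
    by (rule sum.reindex_bij_witness[where i = \<phi> and j = \<phi>])
       (auto simp: \<phi>_def weight upd data_component k)
  then show ?thesis by (simp add: sum.cartesian_product split_beta)
qed

text \<open>
  The contribution of observation \<open>k\<close> is the mean of \<open>f (S k)\<close> under the output on \<open>S\<close>. Privacy allows
  to pass to the output on \<open>S(k := x)\<close> with \<open>x\<close> fresh. After the exchange of the two observations the
  output is independent of the argument of \<open>f\<close>, so the mean vanishes and the information bound
  controls the second moment by the squared error.
\<close>

lemma attack_le_private:
  assumes \<theta>: "\<theta> \<in> cube E" and \<eta>: "\<eta> > 0"
    and stability: "\<And>S k x f. S \<in> data \<Longrightarrow> k < n \<Longrightarrow> x \<in> \<Omega> \<Longrightarrow>
      f \<in> borel_measurable (\<mu> (S(k := x))) \<Longrightarrow> integrable (\<mu> S) (\<lambda>B. (f B)\<^sup>2) \<Longrightarrow>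
      integrable (\<mu> (S(k := x))) (\<lambda>B. (f B)\<^sup>2) \<Longrightarrow>
      (\<integral>B. f B \<partial>\<mu> S) \<le> (\<integral>B. f B \<partial>\<mu> (S(k := x))) + \<eta> / 2 * \<kappa> + (\<integral>B. (f B)\<^sup>2 \<partial>\<mu> (S(k := x))) / (2 * \<eta>)"
  shows "attack \<theta> \<le> n * (\<eta> / 2 * \<kappa> + L * mse \<theta> / (2 * \<eta>))"
proof -
  define f where "f x B = (\<Sum>e\<in>E. (1 - (\<theta> e)\<^sup>2) * (T e B - \<theta> e) * s \<theta> e x)" for x B
  have upd: "S(k := x) \<in> data" if "S \<in> data" "x \<in> \<Omega>" "k < n" for S x k
    using that by (auto simp: data_def PiE_iff extensional_def)
  have f_meas: "f x \<in> borel_measurable (\<mu> S)" if "S \<in> data" for S x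
  proof -
    have "(\<lambda>B. f x B) \<in> borel_measurable (\<mu> S)"
      unfolding f_def using T_meas that
      by (intro borel_measurable_sum borel_measurable_times borel_measurable_diff borel_measurable_const)
         (auto simp: data_def)
    then show ?thesis .
  qed
  have f_sq: "integrable (\<mu> S) (\<lambda>B. (f x B)\<^sup>2)" if S: "S \<in> data" for S x
  proof (rule Bochner_Integration.integrable_bound)
    show "integrable (\<mu> S) (\<lambda>B. (\<Sum>e\<in>E. ((1 - (\<theta> e)\<^sup>2) * s \<theta> e x)\<^sup>2 * (T e B - \<theta> e)\<^sup>2) * card E)"
      using T_shift_square_integrable[OF S]
      by (intro integrable_mult_left integrable_mult_right Bochner_Integration.integrable_sum) auto
    show "(\<lambda>B. (f x B)\<^sup>2) \<in> borel_measurable (\<mu> S)"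
      using f_meas[OF S] by (intro borel_measurable_power)
    show "AE B in \<mu> S. norm ((f x B)\<^sup>2)
        \<le> norm ((\<Sum>e\<in>E. ((1 - (\<theta> e)\<^sup>2) * s \<theta> e x)\<^sup>2 * (T e B - \<theta> e)\<^sup>2) * card E)"
    proof (rule AE_I2)
      fix B
      have "(f x B)\<^sup>2 \<le> (\<Sum>e\<in>E. ((1 - (\<theta> e)\<^sup>2) * (T e B - \<theta> e) * s \<theta> e x)\<^sup>2) * card E"
        unfolding f_def by (rule sum_squared_le_sum_of_squares)
      also have "\<dots> = (\<Sum>e\<in>E. ((1 - (\<theta> e)\<^sup>2) * s \<theta> e x)\<^sup>2 * (T e B - \<theta> e)\<^sup>2) * card E"
        by (simp add: power_mult_distrib mult_ac)
      finally show "norm ((f x B)\<^sup>2)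
        \<le> norm ((\<Sum>e\<in>E. ((1 - (\<theta> e)\<^sup>2) * s \<theta> e x)\<^sup>2 * (T e B - \<theta> e)\<^sup>2) * card E)"
        by simp
    qed
  qed
  have f_int: "integrable (\<mu> S) (f x)" if S: "S \<in> data" for S x
  proof -
    interpret prob_space "\<mu> S" using \<mu>_prob S by (simp add: data_def)
    show ?thesis by (rule square_integrable_imp_integrable[OF f_meas[OF S] f_sq[OF S]])
  qed
  have f_mean: "(\<Sum>x\<in>\<Omega>. q \<theta> x * f x B) = 0" for B
  proof -
    have "(\<Sum>x\<in>\<Omega>. q \<theta> x * f x B) = (\<Sum>e\<in>E. \<Sum>x\<in>\<Omega>. q \<theta> x * ((1 - (\<theta> e)\<^sup>2) * (T e B - \<theta> e) * s \<theta> e x))"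
      unfolding f_def sum_distrib_left by (rule sum.swap)
    also have "\<dots> = (\<Sum>e\<in>E. (1 - (\<theta> e)\<^sup>2) * (T e B - \<theta> e) * (\<Sum>x\<in>\<Omega>. q \<theta> x * s \<theta> e x))"
      unfolding sum_distrib_left by (intro sum.cong refl) simp
    also have "\<dots> = 0" using s_mean[OF \<theta>] by simp
    finally show ?thesis .
  qed
  have f_var: "(\<Sum>x\<in>\<Omega>. q \<theta> x * (f x B)\<^sup>2) \<le> L * (\<Sum>e\<in>E. (T e B - \<theta> e)\<^sup>2)" for B
  proof -
    have "(\<Sum>x\<in>\<Omega>. q \<theta> x * (f x B)\<^sup>2) \<le> L * (\<Sum>e\<in>E. ((1 - (\<theta> e)\<^sup>2) * (T e B - \<theta> e))\<^sup>2)"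
      unfolding f_def by (rule fisher[OF \<theta>])
    also have "\<dots> \<le> L * (\<Sum>e\<in>E. (T e B - \<theta> e)\<^sup>2)"
    proof (intro mult_left_mono sum_mono L_nonneg)
      fix e assume e: "e \<in> E"
      have "(1 - (\<theta> e)\<^sup>2)\<^sup>2 \<le> 1"
        using cube_weight_bounds[OF \<theta> e] by (simp add: power_le_one)
      then show "((1 - (\<theta> e)\<^sup>2) * (T e B - \<theta> e))\<^sup>2 \<le> (T e B - \<theta> e)\<^sup>2"
        unfolding power_mult_distrib by (intro mult_left_le_one_le) auto
    qed
    finally show ?thesis .
  qed
  define V where "V k = (\<Sum>S\<in>data. data_prob \<theta> S * (\<integral>B. f (S k) B \<partial>\<mu> S))" for k
  have V_le: "V k \<le> \<eta> / 2 * \<kappa> + L * mse \<theta> / (2 * \<eta>)" if k: "k < n" for k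
  proof -
    define G where "G S x = (\<integral>B. f x B \<partial>\<mu> S) + \<eta> / 2 * \<kappa> + (\<integral>B. (f x B)\<^sup>2 \<partial>\<mu> S) / (2 * \<eta>)" for S x
    have "V k = (\<Sum>S\<in>data. \<Sum>x\<in>\<Omega>. data_prob \<theta> S * q \<theta> x * (\<integral>B. f (S k) B \<partial>\<mu> S))"
    proof -
      have "(\<Sum>x\<in>\<Omega>. data_prob \<theta> S * q \<theta> x * c) = data_prob \<theta> S * c" for S c
        using q_sum[OF \<theta>] by (simp add: sum_distrib_left[symmetric] sum_distrib_right[symmetric])
      then show ?thesis by (simp add: V_def)
    qed
    also have "\<dots> \<le> (\<Sum>S\<in>data. \<Sum>x\<in>\<Omega>. data_prob \<theta> S * q \<theta> x * G (S(k := x)) (S k))"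
      unfolding G_def
    proof (intro sum_mono mult_left_mono)
      fix S x assume S: "S \<in> data" and x: "x \<in> \<Omega>"
      show "0 \<le> data_prob \<theta> S * q \<theta> x" using data_prob_pos[OF \<theta> S] q_pos[OF \<theta> x] by simp
      show "(\<integral>B. f (S k) B \<partial>\<mu> S) \<le> (\<integral>B. f (S k) B \<partial>\<mu> (S(k := x))) + \<eta> / 2 * \<kappa>
          + (\<integral>B. (f (S k) B)\<^sup>2 \<partial>\<mu> (S(k := x))) / (2 * \<eta>)"
        by (rule stability[OF S k x f_meas[OF upd[OF S x k]] f_sq[OF S] f_sq[OF upd[OF S x k]]])
    qed
    also have "\<dots> = (\<Sum>S\<in>data. \<Sum>x\<in>\<Omega>. data_prob \<theta> S * q \<theta> x * G S x)"
      by (rule exchange_fresh_sample[OF k])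
    also have "\<dots> = (\<Sum>S\<in>data. data_prob \<theta> S * (\<Sum>x\<in>\<Omega>. q \<theta> x * G S x))"
      by (simp add: sum_distrib_left mult.assoc)
    also have "\<dots> \<le> (\<Sum>S\<in>data. data_prob \<theta> S * (\<eta> / 2 * \<kappa> + L * (\<integral>B. (\<Sum>e\<in>E. (T e B - \<theta> e)\<^sup>2) \<partial>\<mu> S) / (2 * \<eta>)))"
    proof (intro sum_mono mult_left_mono)
      fix S assume S: "S \<in> data"
      show "0 \<le> data_prob \<theta> S" using data_prob_pos[OF \<theta> S] by simp
      have m: "(\<Sum>x\<in>\<Omega>. q \<theta> x * (\<integral>B. f x B \<partial>\<mu> S)) = 0"
      proof -
        have "(\<Sum>x\<in>\<Omega>. q \<theta> x * (\<integral>B. f x B \<partial>\<mu> S)) = (\<integral>B. (\<Sum>x\<in>\<Omega>. q \<theta> x * f x B) \<partial>\<mu> S)"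
          using f_int[OF S] by (subst Bochner_Integration.integral_sum) auto
        then show ?thesis by (simp add: f_mean)
      qed
      have v: "(\<Sum>x\<in>\<Omega>. q \<theta> x * (\<integral>B. (f x B)\<^sup>2 \<partial>\<mu> S)) \<le> L * (\<integral>B. (\<Sum>e\<in>E. (T e B - \<theta> e)\<^sup>2) \<partial>\<mu> S)"
      proof -
        have "(\<Sum>x\<in>\<Omega>. q \<theta> x * (\<integral>B. (f x B)\<^sup>2 \<partial>\<mu> S)) = (\<integral>B. (\<Sum>x\<in>\<Omega>. q \<theta> x * (f x B)\<^sup>2) \<partial>\<mu> S)"
          using f_sq[OF S] by (subst Bochner_Integration.integral_sum) auto
        also have "\<dots> \<le> (\<integral>B. L * (\<Sum>e\<in>E. (T e B - \<theta> e)\<^sup>2) \<partial>\<mu> S)"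
          using f_sq[OF S] shifted_mse_integral[OF S] f_var by (intro integral_mono) auto
        finally show ?thesis by simp
      qed
      have "(\<Sum>x\<in>\<Omega>. q \<theta> x * G S x) = (\<Sum>x\<in>\<Omega>. q \<theta> x * (\<integral>B. f x B \<partial>\<mu> S)) + (\<Sum>x\<in>\<Omega>. q \<theta> x) * (\<eta> / 2 * \<kappa>)
          + (\<Sum>x\<in>\<Omega>. q \<theta> x * (\<integral>B. (f x B)\<^sup>2 \<partial>\<mu> S)) / (2 * \<eta>)"
        unfolding G_def sum_distrib_right sum_divide_distrib sum.distrib[symmetric]
        by (intro sum.cong refl) (simp add: algebra_simps)
      also have "\<dots> \<le> \<eta> / 2 * \<kappa> + L * (\<integral>B. (\<Sum>e\<in>E. (T e B - \<theta> e)\<^sup>2) \<partial>\<mu> S) / (2 * \<eta>)"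
        unfolding m q_sum[OF \<theta>] using v \<eta> by (simp add: divide_right_mono)
      finally show "(\<Sum>x\<in>\<Omega>. q \<theta> x * G S x) \<le> \<eta> / 2 * \<kappa> + L * (\<integral>B. (\<Sum>e\<in>E. (T e B - \<theta> e)\<^sup>2) \<partial>\<mu> S) / (2 * \<eta>)" .
    qed
    also have "\<dots> = (\<Sum>S\<in>data. data_prob \<theta> S) * (\<eta> / 2 * \<kappa>) + L * mse \<theta> / (2 * \<eta>)"
      unfolding mse_def sum_distrib_left sum_distrib_right sum_divide_distrib sum.distrib[symmetric]
      by (intro sum.cong refl) (simp add: algebra_simps)
    finally show ?thesis by (simp add: data_prob_sum[OF \<theta>])
  qed
  have "attack \<theta> = (\<Sum>S\<in>data. \<Sum>k<n. data_prob \<theta> S * (\<integral>B. f (S k) B \<partial>\<mu> S))"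
    unfolding attack_def
  proof (intro sum.cong refl)
    fix S assume S: "S \<in> data"
    have "(\<Sum>e\<in>E. (1 - (\<theta> e)\<^sup>2) * (T e B - \<theta> e) * data_score \<theta> e S) = (\<Sum>k<n. f (S k) B)" for B
      unfolding f_def data_score_def sum_distrib_left by (rule sum.swap)
    then show "data_prob \<theta> S * (\<integral>B. (\<Sum>e\<in>E. (1 - (\<theta> e)\<^sup>2) * (T e B - \<theta> e) * data_score \<theta> e S) \<partial>\<mu> S)
        = (\<Sum>k<n. data_prob \<theta> S * (\<integral>B. f (S k) B \<partial>\<mu> S))"
      using f_int[OF S] by (simp add: sum_distrib_left[symmetric])
  qed
  also have "\<dots> = (\<Sum>k<n. V k)" unfolding V_def by (rule sum.swap)
  also have "\<dots> \<le> (\<Sum>k<n. \<eta> / 2 * \<kappa> + L * mse \<theta> / (2 * \<eta>))"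
    by (intro sum_mono V_le) simp
  finally show ?thesis by simp
qed

text \<open>
  The choice of \<open>\<eta>\<close> makes the term free of the squared error equal to a quarter of the left-hand side
  of \<open>attack_lower_bound\<close>.
\<close>

theorem mse_lower_bound_nonprivate:
  assumes mse: "\<And>\<theta>. \<theta> \<in> cube E \<Longrightarrow> mse \<theta> \<le> R"
    and "0 < n" "0 < L"
  shows "card E / 4 \<le> (1 + 3 * n * L) * R"
proof -
  define \<eta> where "\<eta> = 1 / (6 * n * L)"
  have \<eta>: "\<eta> > 0" using assms by (simp add: \<eta>_def)
  have "card E / 3 \<le> (R / (2 * \<eta>) + \<eta> / 2 * (n * card E * L)) + R"
  proof (rule attack_lower_bound[OF _ mse])
    fix \<theta> :: "'e \<Rightarrow> real" assume \<theta>: "\<theta> \<in> cube E"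
    show "attack \<theta> \<le> R / (2 * \<eta>) + \<eta> / 2 * (n * card E * L)"
      using attack_le_nonprivate[OF \<theta> \<eta>] divide_right_mono[OF mse[OF \<theta>], of "2 * \<eta>"] \<eta> by linarith
  qed
  also have "R / (2 * \<eta>) = 3 * n * L * R" by (simp add: \<eta>_def)
  also have "\<eta> / 2 * (n * card E * L) = card E / 12" using assms by (simp add: \<eta>_def)
  finally show ?thesis by (simp add: algebra_simps)
qed

theorem mse_lower_bound_private:
  fixes \<kappa> :: real
  assumes mse: "\<And>\<theta>. \<theta> \<in> cube E \<Longrightarrow> mse \<theta> \<le> R"
    and "0 < n" "0 < \<kappa>" "E \<noteq> {}"
    and stability: "\<And>S k x f \<eta>. S \<in> data \<Longrightarrow> k < n \<Longrightarrow> x \<in> \<Omega> \<Longrightarrow> 0 < \<eta> \<Longrightarrow>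
      f \<in> borel_measurable (\<mu> (S(k := x))) \<Longrightarrow> integrable (\<mu> S) (\<lambda>B. (f B)\<^sup>2) \<Longrightarrow>
      integrable (\<mu> (S(k := x))) (\<lambda>B. (f B)\<^sup>2) \<Longrightarrow>
      (\<integral>B. f B \<partial>\<mu> S) \<le> (\<integral>B. f B \<partial>\<mu> (S(k := x))) + \<eta> / 2 * \<kappa> + (\<integral>B. (f B)\<^sup>2 \<partial>\<mu> (S(k := x))) / (2 * \<eta>)"
  shows "card E / 4 \<le> (1 + 3 * (n\<^sup>2 * \<kappa> * L / card E)) * R"
proof -
  define p where "p = real (card E)"
  have p: "p > 0" using assms finite_index by (simp add: p_def card_gt_0_iff)
  define \<eta> where "\<eta> = p / (6 * n * \<kappa>)"
  have \<eta>: "\<eta> > 0" using assms p by (simp add: \<eta>_def)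
  have "p / 3 \<le> n * (\<eta> / 2 * \<kappa> + L * R / (2 * \<eta>)) + R"
    unfolding p_def
  proof (rule attack_lower_bound[OF _ mse])
    fix \<theta> :: "'e \<Rightarrow> real" assume \<theta>: "\<theta> \<in> cube E"
    have "attack \<theta> \<le> n * (\<eta> / 2 * \<kappa> + L * mse \<theta> / (2 * \<eta>))"
      by (rule attack_le_private[OF \<theta> \<eta> stability[OF _ _ _ \<eta>]])
    also have "\<dots> \<le> n * (\<eta> / 2 * \<kappa> + L * R / (2 * \<eta>))"
      using mse[OF \<theta>] L_nonneg \<eta> by (intro mult_left_mono add_left_mono divide_right_mono) auto
    finally show "attack \<theta> \<le> n * (\<eta> / 2 * \<kappa> + L * R / (2 * \<eta>))" .
  qed
  also have "n * (\<eta> / 2 * \<kappa> + L * R / (2 * \<eta>)) = p / 12 + 3 * (n\<^sup>2 * \<kappa> * L / p) * R"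
    using assms p by (simp add: \<eta>_def field_simps power2_eq_square)
  finally show ?thesis by (simp add: algebra_simps p_def)
qed

end

section \<open>Sign regressions\<close>

abbreviation signs :: "real set" where "signs \<equiv> {-1, 1}"

text \<open>
  The probability of the sign \<open>a\<close> under the law on \<open>{-1, 1}\<close> with mean \<open>m\<close>.
\<close>

abbreviation biased_sign :: "real \<Rightarrow> real \<Rightarrow> real" where
  "biased_sign m a \<equiv> (1 + a * m) / 2"

text \<open>
  The bound of Hoeffding's lemma for a sign with mean \<open>m\<close>.
\<close>

lemma biased_sign_mgf_le:
  fixes m t :: real
  assumes "\<bar>m\<bar> \<le> 1"
  shows "(\<Sum>a\<in>signs. biased_sign m a * exp (a * t)) \<le> exp (t\<^sup>2 / 2 + m * t)"
proof -
  have *: "(1 + m) / 2 * exp t + (1 - m) / 2 * exp (- t) \<le> exp (t\<^sup>2 / 2 + m * t)"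
    if t: "0 \<le> t" and m: "\<bar>m\<bar> \<le> 1" for t m :: real
  proof -
    define p where "p = (1 + m) / 2"
    have p: "0 \<le> p" "p \<le> 1" using m by (auto simp: p_def)
    have pos: "0 < 1 + p * (exp (2 * t) - 1)"
      using p t by (intro add_pos_nonneg mult_nonneg_nonneg) auto
    have "- (2 * t) * p + ln (1 + p * (exp (2 * t) - 1)) \<le> (2 * t)\<^sup>2 / 8"
      using Hoeffdings_lemma_aux[of "2 * t" p] t p by simp
    then have "ln (1 + p * (exp (2 * t) - 1)) \<le> t\<^sup>2 / 2 + 2 * t * p"
      by (simp add: power2_eq_square)
    then have "1 + p * (exp (2 * t) - 1) \<le> exp (t\<^sup>2 / 2 + 2 * t * p)"
      using pos by (metis exp_le_cancel_iff exp_ln)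
    then have "(1 + p * (exp (2 * t) - 1)) * exp (- t) \<le> exp (t\<^sup>2 / 2 + 2 * t * p) * exp (- t)"
      by (rule mult_right_mono) simp
    moreover have "(1 + p * (exp (2 * t) - 1)) * exp (- t) = p * exp t + (1 - p) * exp (- t)"
      by (simp add: algebra_simps flip: exp_add)
    moreover have "exp (t\<^sup>2 / 2 + 2 * t * p) * exp (- t) = exp (t\<^sup>2 / 2 + m * t)"
      unfolding exp_add[symmetric] by (simp add: p_def algebra_simps)
    moreover have "1 - p = (1 - m) / 2" by (simp add: p_def field_simps)
    ultimately show ?thesis unfolding p_def[symmetric] by simp
  qed
  show ?thesis
  proof (cases "0 \<le> t")
    case True
    then show ?thesis using *[OF True assms] by (simp add: add.commute)
  next
    case False
    then show ?thesis using *[of "- t" "- m"] assms by simp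
  qed
qed

text \<open>
  Independent fair signs on \<open>Y\<close>, and signs on \<open>Z\<close> that are independent given those on \<open>Y\<close>, with means
  linear in them. A pair \<open>(i, j)\<close> in \<open>E\<close> means that \<open>i\<close> depends on \<open>j\<close>. The degree bounds together with
  \<open>\<tau> * k \<le> 1 / 2\<close> keep all conditional means in \<open>[-1/2, 1/2]\<close>.
\<close>

locale sign_regression =
  fixes Y Z :: "nat set" and E :: "(nat \<times> nat) set" and \<tau> :: real and k :: nat
  assumes finite_YZ: "finite Y" "finite Z" and disjoint: "Y \<inter> Z = {}" and edges: "E \<subseteq> Z \<times> Y"
    and degree_Z: "\<And>i. i \<in> Z \<Longrightarrow> card {j\<in>Y. (i, j) \<in> E} \<le> k"
    and degree_Y: "\<And>j. j \<in> Y \<Longrightarrow> card {i\<in>Z. (i, j) \<in> E} \<le> k"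
    and \<tau>_pos: "0 < \<tau>" and \<tau>_small: "\<tau> * k \<le> 1 / 2"
begin

definition coef :: "(nat \<times> nat \<Rightarrow> real) \<Rightarrow> nat \<Rightarrow> nat \<Rightarrow> real" where
  "coef \<theta> i j = (if (i, j) \<in> E then \<tau> * \<theta> (i, j) else 0)"

definition reg :: "(nat \<times> nat \<Rightarrow> real) \<Rightarrow> (nat \<Rightarrow> real) \<Rightarrow> nat \<Rightarrow> real" where
  "reg \<theta> y i = (\<Sum>j\<in>Y. coef \<theta> i j * y j)"

definition sample :: "((nat \<Rightarrow> real) \<times> (nat \<Rightarrow> real)) set" where
  "sample = (Y \<rightarrow>\<^sub>E signs) \<times> (Z \<rightarrow>\<^sub>E signs)"

definition prob :: "(nat \<times> nat \<Rightarrow> real) \<Rightarrow> (nat \<Rightarrow> real) \<times> (nat \<Rightarrow> real) \<Rightarrow> real" where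
  "prob \<theta> \<omega> = (\<Prod>j\<in>Y. biased_sign 0 (fst \<omega> j)) * (\<Prod>i\<in>Z. biased_sign (reg \<theta> (fst \<omega>) i) (snd \<omega> i))"

definition score :: "(nat \<times> nat \<Rightarrow> real) \<Rightarrow> nat \<times> nat \<Rightarrow> (nat \<Rightarrow> real) \<times> (nat \<Rightarrow> real) \<Rightarrow> real" where
  "score \<theta> e \<omega> = \<tau> * fst \<omega> (snd e) * (snd \<omega> (fst e) / (1 + snd \<omega> (fst e) * reg \<theta> (fst \<omega>) (fst e)))"

definition expect :: "(nat \<times> nat \<Rightarrow> real) \<Rightarrow> ((nat \<Rightarrow> real) \<times> (nat \<Rightarrow> real) \<Rightarrow> real) \<Rightarrow> real" where
  "expect \<theta> h = (\<Sum>\<omega>\<in>sample. prob \<theta> \<omega> * h \<omega>)"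

lemma finite_edges: "finite E"
  using edges finite_YZ by (meson finite_SigmaI finite_subset)

lemma edge_sum: "(\<Sum>e\<in>E. f e) = (\<Sum>i\<in>Z. \<Sum>j\<in>Y. if (i, j) \<in> E then f (i, j) else 0)"
proof -
  have "(\<Sum>e\<in>E. f e) = (\<Sum>e\<in>Z \<times> Y. if e \<in> E then f e else 0)"
    using edges finite_YZ by (simp add: sum.inter_restrict[symmetric] Int_absorb1)
  then show ?thesis by (simp add: sum.cartesian_product)
qed

lemma coef_bound:
  assumes "\<theta> \<in> cube E"
  shows "\<bar>coef \<theta> i j\<bar> \<le> (if (i, j) \<in> E then \<tau> else 0)"
proof (cases "(i, j) \<in> E")
  case True
  then have "\<bar>\<theta> (i, j)\<bar> \<le> 1" using PiE_mem[OF assms True] by (simp add: abs_le_iff)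
  then show ?thesis using True \<tau>_pos by (simp add: coef_def abs_mult)
qed (simp add: coef_def)

lemma coef_row_sum:
  assumes "\<theta> \<in> cube E" "i \<in> Z"
  shows "(\<Sum>j\<in>Y. \<bar>coef \<theta> i j\<bar>) \<le> \<tau> * k"
proof -
  have "(\<Sum>j\<in>Y. \<bar>coef \<theta> i j\<bar>) \<le> (\<Sum>j\<in>Y. if (i, j) \<in> E then \<tau> else 0)"
    by (intro sum_mono coef_bound assms)
  also have "\<dots> = \<tau> * card {j\<in>Y. (i, j) \<in> E}"
    using finite_YZ by (simp add: sum.inter_filter[symmetric])
  also have "\<dots> \<le> \<tau> * k" using degree_Z[OF assms(2)] \<tau>_pos by simp
  finally show ?thesis .
qed

lemma reg_bound:
  assumes "\<theta> \<in> cube E" "i \<in> Z" "y \<in> Y \<rightarrow>\<^sub>E signs"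
  shows "\<bar>reg \<theta> y i\<bar> \<le> 1 / 2"
proof -
  have "\<bar>reg \<theta> y i\<bar> \<le> (\<Sum>j\<in>Y. \<bar>coef \<theta> i j * y j\<bar>)" unfolding reg_def by (rule sum_abs)
  also have "\<dots> = (\<Sum>j\<in>Y. \<bar>coef \<theta> i j\<bar>)"
    by (intro sum.cong refl) (use PiE_mem[OF assms(3)] in \<open>force simp: abs_mult\<close>)
  also have "\<dots> \<le> \<tau> * k" by (rule coef_row_sum[OF assms(1,2)])
  finally show ?thesis using \<tau>_small by simp
qed

lemma one_plus_reg:
  assumes "\<theta> \<in> cube E" "i \<in> Z" "y \<in> Y \<rightarrow>\<^sub>E signs" "a \<in> signs"
  shows "1 / 2 \<le> 1 + a * reg \<theta> y i"
  using reg_bound[OF assms(1-3)] assms(4) by (auto simp: abs_le_iff)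

lemma expect_iterated:
  "expect \<theta> h = (\<Sum>y\<in>Y \<rightarrow>\<^sub>E signs. (\<Prod>j\<in>Y. biased_sign 0 (y j)) *
     (\<Sum>z\<in>Z \<rightarrow>\<^sub>E signs. (\<Prod>i\<in>Z. biased_sign (reg \<theta> y i) (z i)) * h (y, z)))"
  unfolding expect_def sample_def prob_def sum_distrib_left
  by (subst sum.cartesian_product) (simp add: mult.assoc split_beta)

lemma finite_signs_PiE: "finite (Y \<rightarrow>\<^sub>E signs)" "finite (Z \<rightarrow>\<^sub>E signs)"
  using finite_YZ by (simp_all add: finite_PiE)

lemma finite_sample: "finite sample"
  unfolding sample_def using finite_signs_PiE by simp

lemma biased_sign_sum: "(\<Sum>a\<in>signs. biased_sign m a) = 1"
  by (simp add: field_simps)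

lemma expect_of_y:
  "expect \<theta> (\<lambda>\<omega>. h (fst \<omega>)) = (\<Sum>y\<in>Y \<rightarrow>\<^sub>E signs. (\<Prod>j\<in>Y. biased_sign 0 (y j)) * h y)"
  unfolding expect_iterated fst_conv sum_distrib_right[symmetric]
  by (subst sum_PiE_prod_one) (use finite_YZ biased_sign_sum in auto)

lemma expect_one: "expect \<theta> (\<lambda>_. 1) = 1"
proof -
  have "(\<Sum>y\<in>Y \<rightarrow>\<^sub>E signs. (\<Prod>j\<in>Y. biased_sign 0 (y j)) * 1) = 1"
    unfolding mult_1_right by (rule sum_PiE_prod_one) (use finite_YZ biased_sign_sum in auto)
  then show ?thesis using expect_of_y[of \<theta> "\<lambda>_. 1"] by simp
qed

lemma expect_y: "j \<in> Y \<Longrightarrow> expect \<theta> (\<lambda>\<omega>. fst \<omega> j) = 0"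
  using expect_of_y[of \<theta> "\<lambda>y. y j"]
    sum_PiE_marginal[of Y signs "\<lambda>_. biased_sign 0" j "\<lambda>a. a"] finite_YZ by simp

lemma expect_yy:
  assumes "j \<in> Y" "j' \<in> Y"
  shows "expect \<theta> (\<lambda>\<omega>. fst \<omega> j * fst \<omega> j') = (if j = j' then 1 else 0)"
proof (cases "j = j'")
  case True
  then show ?thesis
    using expect_of_y[of \<theta> "\<lambda>y. y j * y j"]
      sum_PiE_marginal[of Y signs "\<lambda>_. biased_sign 0" j "\<lambda>a. a * a"] finite_YZ assms by simp
next
  case False
  then show ?thesis
    using expect_of_y[of \<theta> "\<lambda>y. y j * y j'"]
      sum_PiE_marginal2[of Y signs "\<lambda>_. biased_sign 0" j j' "\<lambda>a. a" "\<lambda>a. a"] finite_YZ assms by simp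
qed

lemma linear_y_covariance:
  "(\<Sum>y\<in>Y \<rightarrow>\<^sub>E signs. (\<Prod>j\<in>Y. biased_sign 0 (y j)) * ((\<Sum>j\<in>Y. u j * y j) * (\<Sum>j\<in>Y. v j * y j)))
   = (\<Sum>j\<in>Y. u j * v j)"
  using sum_PiE_covariance[of Y signs "\<lambda>_. biased_sign 0" "\<lambda>j a. u j * a" "\<lambda>j a. v j * a"] finite_YZ
  by simp

lemma expect_zy:
  assumes "i \<in> Z" "j \<in> Y"
  shows "expect \<theta> (\<lambda>\<omega>. snd \<omega> i * fst \<omega> j) = coef \<theta> i j"
proof -
  have "expect \<theta> (\<lambda>\<omega>. snd \<omega> i * fst \<omega> j)
      = (\<Sum>y\<in>Y \<rightarrow>\<^sub>E signs. (\<Prod>j\<in>Y. biased_sign 0 (y j)) * (reg \<theta> y i * y j))"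
    unfolding expect_iterated fst_conv snd_conv
    by (intro sum.cong refl arg_cong2[of _ _ _ _ "(*)"], subst sum_PiE_marginal[where f = "\<lambda>a. a * _"])
       (use assms finite_YZ in \<open>auto simp: field_simps\<close>)
  also have "\<dots> = (\<Sum>y\<in>Y \<rightarrow>\<^sub>E signs. (\<Prod>j\<in>Y. biased_sign 0 (y j)) *
      ((\<Sum>j\<in>Y. coef \<theta> i j * y j) * (\<Sum>j'\<in>Y. (if j' = j then 1 else 0) * y j')))"
    using assms finite_YZ by (simp add: reg_def if_distrib[of "\<lambda>x. x * _"] cong: if_cong)
  also have "\<dots> = (\<Sum>j'\<in>Y. coef \<theta> i j' * (if j' = j then 1 else 0))"
    by (rule linear_y_covariance)
  also have "\<dots> = coef \<theta> i j"
    using assms finite_YZ by (simp add: if_distrib cong: if_cong)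
  finally show ?thesis .
qed

lemma expect_z:
  assumes "i \<in> Z"
  shows "expect \<theta> (\<lambda>\<omega>. snd \<omega> i) = 0"
proof -
  have "expect \<theta> (\<lambda>\<omega>. snd \<omega> i) = (\<Sum>y\<in>Y \<rightarrow>\<^sub>E signs. (\<Prod>j\<in>Y. biased_sign 0 (y j)) * reg \<theta> y i)"
    unfolding expect_iterated fst_conv snd_conv
    by (intro sum.cong refl arg_cong2[of _ _ _ _ "(*)"], subst sum_PiE_marginal[where f = "\<lambda>a. a"])
       (use assms finite_YZ in \<open>auto simp: field_simps\<close>)
  also have "\<dots> = (\<Sum>j\<in>Y. coef \<theta> i j * expect \<theta> (\<lambda>\<omega>. fst \<omega> j))"
    unfolding expect_of_y[of \<theta> "\<lambda>y. y _"] reg_def sum_distrib_left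
    by (subst sum.swap) (simp add: mult_ac)
  also have "\<dots> = 0" by (simp add: expect_y)
  finally show ?thesis .
qed

lemma expect_zz:
  assumes "i \<in> Z" "i' \<in> Z" "i \<noteq> i'"
  shows "expect \<theta> (\<lambda>\<omega>. snd \<omega> i * snd \<omega> i') = (\<Sum>j\<in>Y. coef \<theta> i j * coef \<theta> i' j)"
proof -
  have "expect \<theta> (\<lambda>\<omega>. snd \<omega> i * snd \<omega> i')
      = (\<Sum>y\<in>Y \<rightarrow>\<^sub>E signs. (\<Prod>j\<in>Y. biased_sign 0 (y j)) * (reg \<theta> y i * reg \<theta> y i'))"
    unfolding expect_iterated fst_conv snd_conv
    by (intro sum.cong refl arg_cong2[of _ _ _ _ "(*)"], subst sum_PiE_marginal2[where f = "\<lambda>a. a" and g = "\<lambda>a. a"])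
       (use assms finite_YZ in \<open>auto simp: field_simps\<close>)
  then show ?thesis unfolding reg_def linear_y_covariance .
qed

lemma reg_update:
  assumes "(i, j) \<in> E"
  shows "reg (\<theta>((i, j) := t)) y i' = (if i' = i then reg \<theta> y i + \<tau> * (t - \<theta> (i, j)) * y j else reg \<theta> y i')"
proof (cases "i' = i")
  case True
  have j: "j \<in> Y" using assms edges by auto
  have "coef (\<theta>((i, j) := t)) i j' * y j' = coef \<theta> i j' * y j' + (if j' = j then \<tau> * (t - \<theta> (i, j)) * y j else 0)" for j'
    using assms by (auto simp: coef_def algebra_simps)
  then show ?thesis using True j finite_YZ by (simp add: reg_def sum.distrib)
next
  case False
  then have "coef (\<theta>((i, j) := t)) i' j' = coef \<theta> i' j'" for j' by (simp add: coef_def)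
  then show ?thesis using False by (simp add: reg_def)
qed

lemma prob_pos:
  assumes "\<theta> \<in> cube E" "\<omega> \<in> sample"
  shows "0 < prob \<theta> \<omega>"
proof -
  have "0 < biased_sign (reg \<theta> (fst \<omega>) i) (snd \<omega> i)" if "i \<in> Z" for i
    using one_plus_reg[OF assms(1) that, of "fst \<omega>" "snd \<omega> i"] assms(2) that
    by (auto simp: sample_def mem_Times_iff dest: PiE_mem)
  then show ?thesis unfolding prob_def by (intro mult_pos_pos prod_pos) auto
qed

text \<open>
  A parameter \<open>\<theta> (i, j)\<close> enters only the factor of coordinate \<open>i\<close>, and this factor is affine in it.
\<close>

lemma prob_derivative:
  assumes \<theta>: "\<theta> \<in> cube E" and e: "e \<in> E" and \<omega>: "\<omega> \<in> sample"
  shows "((\<lambda>t. prob (\<theta>(e := t)) \<omega>) has_real_derivative prob \<theta> \<omega> * score \<theta> e \<omega>) (at (\<theta> e) within {-1..1})"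
proof -
  obtain i j where ij: "e = (i, j)" by force
  have i: "i \<in> Z" using e edges ij by auto
  obtain y z where yz: "\<omega> = (y, z)" by force
  have y: "y \<in> Y \<rightarrow>\<^sub>E signs" and z: "z i \<in> signs" using \<omega> yz i by (auto simp: sample_def)
  define c where "c = (\<Prod>j\<in>Y. biased_sign 0 (y j)) * (\<Prod>i'\<in>Z - {i}. biased_sign (reg \<theta> y i') (z i'))"
  have prob_eq: "prob (\<theta>(e := t)) \<omega> = c * ((1 + z i * (reg \<theta> y i + \<tau> * (t - \<theta> e) * y j)) / 2)" for t
  proof -
    have "(\<Prod>i'\<in>Z. biased_sign (reg (\<theta>(e := t)) y i') (z i'))
        = biased_sign (reg \<theta> y i + \<tau> * (t - \<theta> e) * y j) (z i) * (\<Prod>i'\<in>Z - {i}. biased_sign (reg \<theta> y i') (z i'))"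
      using e by (subst prod.remove[OF finite_YZ(2) i]) (simp add: ij reg_update)
    then show ?thesis by (simp add: prob_def c_def yz)
  qed
  have "1 + z i * reg \<theta> y i \<noteq> 0" using one_plus_reg[OF \<theta> i y z] by linarith
  moreover have "prob \<theta> \<omega> = c * ((1 + z i * reg \<theta> y i) / 2)"
    using prob_eq[of "\<theta> e"] by simp
  ultimately have s: "prob \<theta> \<omega> * score \<theta> e \<omega> = c * (z i * (\<tau> * y j) / 2)"
    by (simp add: score_def ij yz divide_simps)
  show ?thesis unfolding prob_eq s
    by (rule derivative_eq_intros refl | simp)+
qed

lemma coef_measurable: "(\<lambda>\<theta>. coef \<theta> i j) \<in> borel_measurable (cube_measure E)"
proof (cases "(i, j) \<in> E")
  case True
  then show ?thesis
    unfolding coef_def by (simp add: borel_measurable_times cube_coordinate_measurable)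
qed (simp add: coef_def)

lemma reg_measurable: "(\<lambda>\<theta>. reg \<theta> y i) \<in> borel_measurable (cube_measure E)"
  unfolding reg_def by (intro borel_measurable_sum borel_measurable_times coef_measurable borel_measurable_const)

lemma score_mean:
  assumes \<theta>: "\<theta> \<in> cube E" and e: "e \<in> E"
  shows "expect \<theta> (score \<theta> e) = 0"
proof -
  obtain i j where ij: "e = (i, j)" by force
  have i: "i \<in> Z" using e edges ij by auto
  have "(\<Sum>z\<in>Z \<rightarrow>\<^sub>E signs. (\<Prod>i\<in>Z. biased_sign (reg \<theta> y i) (z i)) * score \<theta> e (y, z)) = 0"
    if y: "y \<in> Y \<rightarrow>\<^sub>E signs" for y
  proof -
    have "(\<Sum>z\<in>Z \<rightarrow>\<^sub>E signs. (\<Prod>i\<in>Z. biased_sign (reg \<theta> y i) (z i)) * score \<theta> e (y, z))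
        = (\<Sum>a\<in>signs. biased_sign (reg \<theta> y i) a * (\<tau> * y j * (a / (1 + a * reg \<theta> y i))))"
      unfolding score_def ij fst_conv snd_conv
      by (rule sum_PiE_marginal[where f = "\<lambda>a. \<tau> * y j * (a / (1 + a * reg \<theta> y i))"])
         (use i finite_YZ in \<open>auto simp: field_simps\<close>)
    also have "\<dots> = 0"
      using one_plus_reg[OF \<theta> i y, of 1] one_plus_reg[OF \<theta> i y, of "-1"]
      by (simp add: field_simps)
    finally show ?thesis .
  qed
  then show ?thesis unfolding expect_iterated by simp
qed

lemma score_bound:
  assumes \<theta>: "\<theta> \<in> cube E" and e: "e \<in> E" and \<omega>: "\<omega> \<in> sample"
  shows "\<bar>score \<theta> e \<omega>\<bar> \<le> 2 * \<tau>"
proof -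
  obtain i j where ij: "e = (i, j)" by force
  have i: "i \<in> Z" and j: "j \<in> Y" using e edges ij by auto
  obtain y z where yz: "\<omega> = (y, z)" by force
  have y: "y \<in> Y \<rightarrow>\<^sub>E signs" and z: "z i \<in> signs" using \<omega> yz i by (auto simp: sample_def)
  have yj: "\<bar>y j\<bar> = 1" and zi: "\<bar>z i\<bar> = 1" using PiE_mem[OF y j] z by auto
  have "\<bar>score \<theta> e \<omega>\<bar> = \<tau> / (1 + z i * reg \<theta> y i)"
    using one_plus_reg[OF \<theta> i y z] yj zi \<tau>_pos by (simp add: score_def ij yz abs_mult)
  also have "\<dots> \<le> \<tau> / (1 / 2)"
    using one_plus_reg[OF \<theta> i y z] \<tau>_pos by (intro divide_left_mono) auto
  finally show ?thesis by simp
qed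

text \<open>
  Given the signs on \<open>Y\<close>, the scores of different \<open>i\<close> are independent and centred, so the form is a
  sum over \<open>i\<close> of squared linear forms in \<open>Y\<close>, divided by \<open>1 - m\<^sup>2\<close> with \<open>\<bar>m\<bar> \<le> 1/2\<close>; averaging over \<open>Y\<close>
  then makes it diagonal. No factor counts the parameters.
\<close>

lemma fisher_information_bound:
  assumes \<theta>: "\<theta> \<in> cube E"
  shows "expect \<theta> (\<lambda>\<omega>. (\<Sum>e\<in>E. u e * score \<theta> e \<omega>)\<^sup>2) \<le> 2 * \<tau>\<^sup>2 * (\<Sum>e\<in>E. (u e)\<^sup>2)"
proof -
  have lin: "(\<Sum>e\<in>E. u e * score \<theta> e (y, z)) = (\<Sum>i\<in>Z. reg u y i * (z i / (1 + z i * reg \<theta> y i)))" for y z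
    unfolding edge_sum reg_def[of u] sum_distrib_right
    by (intro sum.cong refl) (simp add: score_def coef_def)
  have inner: "(\<Sum>z\<in>Z \<rightarrow>\<^sub>E signs. (\<Prod>i\<in>Z. biased_sign (reg \<theta> y i) (z i)) * (\<Sum>e\<in>E. u e * score \<theta> e (y, z))\<^sup>2)
      \<le> (\<Sum>i\<in>Z. 2 * (reg u y i)\<^sup>2)" if y: "y \<in> Y \<rightarrow>\<^sub>E signs" for y
  proof -
    define g where "g i a = reg u y i * (a / (1 + a * reg \<theta> y i))" for i a
    have nz: "1 / 2 \<le> 1 + reg \<theta> y i" "1 / 2 \<le> 1 - reg \<theta> y i" if "i \<in> Z" for i
      using one_plus_reg[OF \<theta> that y, of 1] one_plus_reg[OF \<theta> that y, of "-1"] by auto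
    have "(\<Sum>z\<in>Z \<rightarrow>\<^sub>E signs. (\<Prod>i\<in>Z. biased_sign (reg \<theta> y i) (z i)) * (\<Sum>e\<in>E. u e * score \<theta> e (y, z))\<^sup>2)
        = (\<Sum>i\<in>Z. \<Sum>a\<in>signs. biased_sign (reg \<theta> y i) a * (g i a * g i a))"
      unfolding lin power2_eq_square g_def[symmetric]
    proof (rule sum_PiE_covariance)
      fix i assume i: "i \<in> Z"
      show "(\<Sum>a\<in>signs. biased_sign (reg \<theta> y i) a * g i a) = 0"
        using nz[OF i] by (simp add: g_def field_simps)
    qed (use finite_YZ biased_sign_sum in auto)
    also have "\<dots> \<le> (\<Sum>i\<in>Z. 2 * (reg u y i)\<^sup>2)"
    proof (intro sum_mono)
      fix i assume i: "i \<in> Z"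
      define r where "r = reg \<theta> y i"
      have r: "1 / 2 \<le> 1 + r" "1 / 2 \<le> 1 - r" using nz[OF i] by (auto simp: r_def)
      have "(\<Sum>a\<in>signs. biased_sign (reg \<theta> y i) a * (g i a * g i a))
          = (reg u y i)\<^sup>2 * ((1 / (1 - r) + 1 / (1 + r)) / 2)"
        using r by (simp add: g_def r_def[symmetric] divide_simps power2_eq_square) (simp add: algebra_simps)
      also have "\<dots> \<le> (reg u y i)\<^sup>2 * 2"
      proof (rule mult_left_mono)
        have "1 / (1 - r) \<le> 1 / (1 / 2)" "1 / (1 + r) \<le> 1 / (1 / 2)"
          using r by (intro divide_left_mono; simp)+
        then show "(1 / (1 - r) + 1 / (1 + r)) / 2 \<le> 2" by simp
      qed simp
      finally show "(\<Sum>a\<in>signs. biased_sign (reg \<theta> y i) a * (g i a * g i a)) \<le> 2 * (reg u y i)\<^sup>2"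
        by simp
    qed
    finally show ?thesis .
  qed
  have "expect \<theta> (\<lambda>\<omega>. (\<Sum>e\<in>E. u e * score \<theta> e \<omega>)\<^sup>2)
      \<le> (\<Sum>y\<in>Y \<rightarrow>\<^sub>E signs. (\<Prod>j\<in>Y. biased_sign 0 (y j)) * (\<Sum>i\<in>Z. 2 * (reg u y i)\<^sup>2))"
    unfolding expect_iterated by (intro sum_mono mult_left_mono inner prod_nonneg) auto
  also have "\<dots> = (\<Sum>i\<in>Z. 2 * (\<Sum>y\<in>Y \<rightarrow>\<^sub>E signs. (\<Prod>j\<in>Y. biased_sign 0 (y j)) * (reg u y i)\<^sup>2))"
    unfolding sum_distrib_left by (subst sum.swap) (simp add: mult_ac)
  also have "\<dots> = (\<Sum>i\<in>Z. 2 * (\<Sum>j\<in>Y. coef u i j * coef u i j))"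
    unfolding reg_def power2_eq_square linear_y_covariance ..
  also have "\<dots> = 2 * \<tau>\<^sup>2 * (\<Sum>e\<in>E. (u e)\<^sup>2)"
    unfolding edge_sum sum_distrib_left
    by (intro sum.cong refl) (simp add: coef_def power2_eq_square)
  finally show ?thesis .
qed

text \<open>
  Integrating out \<open>Z\<close> costs \<open>exp (t\<^sup>2 b / 2)\<close> and turns the linear form into one in \<open>Y\<close> with
  coefficients \<open>v j + c j\<close>. By the degree bounds the vector \<open>c\<close> has at most half the length of \<open>v\<close>
  restricted to \<open>Z\<close>.
\<close>

lemma expect_exp_le:
  assumes \<theta>: "\<theta> \<in> cube E"
  shows "expect \<theta> (\<lambda>\<omega>. exp (t * ((\<Sum>j\<in>Y. v j * fst \<omega> j) + (\<Sum>i\<in>Z. v i * snd \<omega> i))))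
      \<le> exp (t\<^sup>2 * (\<Sum>i\<in>Y \<union> Z. (v i)\<^sup>2))"
proof -
  define b where "b = (\<Sum>i\<in>Z. (v i)\<^sup>2)"
  define c where "c j = (\<Sum>i\<in>Z. v i * coef \<theta> i j)" for j
  have inner: "(\<Sum>z\<in>Z \<rightarrow>\<^sub>E signs. (\<Prod>i\<in>Z. biased_sign (reg \<theta> y i) (z i)) *
        exp (t * ((\<Sum>j\<in>Y. v j * y j) + (\<Sum>i\<in>Z. v i * z i))))
      \<le> exp (t\<^sup>2 * b / 2) * (\<Prod>j\<in>Y. exp (y j * (t * (v j + c j))))"
    if y: "y \<in> Y \<rightarrow>\<^sub>E signs" for y
  proof -
    define A where "A = exp (t * (\<Sum>j\<in>Y. v j * y j))"
    have "(\<Sum>z\<in>Z \<rightarrow>\<^sub>E signs. (\<Prod>i\<in>Z. biased_sign (reg \<theta> y i) (z i)) *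
          exp (t * ((\<Sum>j\<in>Y. v j * y j) + (\<Sum>i\<in>Z. v i * z i))))
        = A * (\<Sum>z\<in>Z \<rightarrow>\<^sub>E signs. \<Prod>i\<in>Z. biased_sign (reg \<theta> y i) (z i) * exp (z i * (t * v i)))"
      unfolding sum_distrib_left A_def prod.distrib using finite_YZ
      by (intro sum.cong refl) (simp add: distrib_left exp_add sum_distrib_left exp_sum mult_ac)
    also have "(\<Sum>z\<in>Z \<rightarrow>\<^sub>E signs. \<Prod>i\<in>Z. biased_sign (reg \<theta> y i) (z i) * exp (z i * (t * v i)))
        = (\<Prod>i\<in>Z. \<Sum>a\<in>signs. biased_sign (reg \<theta> y i) a * exp (a * (t * v i)))"
      by (rule prod_sum_PiE[symmetric]) (use finite_YZ in auto)
    also have "A * \<dots> \<le> A * (\<Prod>i\<in>Z. exp ((t * v i)\<^sup>2 / 2 + reg \<theta> y i * (t * v i)))"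
    proof (intro mult_left_mono prod_mono conjI)
      fix i assume i: "i \<in> Z"
      have r: "\<bar>reg \<theta> y i\<bar> \<le> 1" using reg_bound[OF \<theta> i y] by simp
      show "(\<Sum>a\<in>signs. biased_sign (reg \<theta> y i) a * exp (a * (t * v i))) \<le> exp ((t * v i)\<^sup>2 / 2 + reg \<theta> y i * (t * v i))"
        by (rule biased_sign_mgf_le[OF r])
      show "0 \<le> (\<Sum>a\<in>signs. biased_sign (reg \<theta> y i) a * exp (a * (t * v i)))"
        using r by (intro sum_nonneg) (auto simp: abs_le_iff)
    qed (simp add: A_def)
    also have "\<dots> = exp (t * (\<Sum>j\<in>Y. v j * y j) + (\<Sum>i\<in>Z. (t * v i)\<^sup>2 / 2 + reg \<theta> y i * (t * v i)))"
      using finite_YZ by (simp add: A_def exp_add exp_sum)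
    also have "t * (\<Sum>j\<in>Y. v j * y j) + (\<Sum>i\<in>Z. (t * v i)\<^sup>2 / 2 + reg \<theta> y i * (t * v i))
        = t\<^sup>2 * b / 2 + (\<Sum>j\<in>Y. y j * (t * (v j + c j)))"
    proof -
      have "(\<Sum>i\<in>Z. reg \<theta> y i * (t * v i)) = (\<Sum>j\<in>Y. y j * (t * c j))"
        unfolding reg_def c_def sum_distrib_left sum_distrib_right
        by (subst sum.swap) (simp add: mult_ac)
      moreover have "(\<Sum>i\<in>Z. (t * v i)\<^sup>2 / 2) = t\<^sup>2 * b / 2"
        by (simp add: b_def power_mult_distrib sum_distrib_left sum_divide_distrib)
      moreover have "t * (\<Sum>j\<in>Y. v j * y j) = (\<Sum>j\<in>Y. y j * (t * v j))"
        by (simp add: sum_distrib_left mult_ac)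
      ultimately show ?thesis by (simp add: sum.distrib distrib_left)
    qed
    also have "exp \<dots> = exp (t\<^sup>2 * b / 2) * (\<Prod>j\<in>Y. exp (y j * (t * (v j + c j))))"
      using finite_YZ by (simp add: exp_add exp_sum)
    finally show ?thesis .
  qed
  have "expect \<theta> (\<lambda>\<omega>. exp (t * ((\<Sum>j\<in>Y. v j * fst \<omega> j) + (\<Sum>i\<in>Z. v i * snd \<omega> i))))
      \<le> (\<Sum>y\<in>Y \<rightarrow>\<^sub>E signs. (\<Prod>j\<in>Y. biased_sign 0 (y j)) * (exp (t\<^sup>2 * b / 2) * (\<Prod>j\<in>Y. exp (y j * (t * (v j + c j))))))"
    unfolding expect_iterated fst_conv snd_conv
    by (intro sum_mono mult_left_mono inner prod_nonneg) auto
  also have "\<dots> = exp (t\<^sup>2 * b / 2) * (\<Sum>y\<in>Y \<rightarrow>\<^sub>E signs. \<Prod>j\<in>Y. biased_sign 0 (y j) * exp (y j * (t * (v j + c j))))"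
    unfolding sum_distrib_left prod.distrib by (intro sum.cong refl) (simp add: mult_ac)
  also have "(\<Sum>y\<in>Y \<rightarrow>\<^sub>E signs. \<Prod>j\<in>Y. biased_sign 0 (y j) * exp (y j * (t * (v j + c j))))
      = (\<Prod>j\<in>Y. \<Sum>a\<in>signs. biased_sign 0 a * exp (a * (t * (v j + c j))))"
    by (rule prod_sum_PiE[symmetric]) (use finite_YZ in auto)
  also have "exp (t\<^sup>2 * b / 2) * \<dots> \<le> exp (t\<^sup>2 * b / 2) * (\<Prod>j\<in>Y. exp ((t * (v j + c j))\<^sup>2 / 2 + 0 * (t * (v j + c j))))"
    by (intro mult_left_mono prod_mono conjI biased_sign_mgf_le sum_nonneg) auto
  also have "\<dots> = exp (t\<^sup>2 * (b / 2 + (\<Sum>j\<in>Y. (v j + c j)\<^sup>2) / 2))"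
  proof -
    have "(\<Sum>j\<in>Y. (t * (v j + c j))\<^sup>2 / 2) = t\<^sup>2 * ((\<Sum>j\<in>Y. (v j + c j)\<^sup>2) / 2)"
      unfolding power_mult_distrib by (simp add: sum_distrib_left sum_divide_distrib)
    then show ?thesis
      using finite_YZ by (simp add: exp_sum[symmetric] exp_add[symmetric] distrib_left[of "t\<^sup>2"])
  qed
  also have "\<dots> \<le> exp (t\<^sup>2 * (\<Sum>i\<in>Y \<union> Z. (v i)\<^sup>2))"
  proof -
    have c2: "(\<Sum>j\<in>Y. (c j)\<^sup>2) \<le> b / 4"
    proof -
      have "(c j)\<^sup>2 \<le> \<tau>\<^sup>2 * k * (\<Sum>i\<in>Z. if (i, j) \<in> E then (v i)\<^sup>2 else 0)" if j: "j \<in> Y" for j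
      proof -
        define N where "N = {i\<in>Z. (i, j) \<in> E}"
        have "c j = (\<Sum>i\<in>N. v i * coef \<theta> i j)"
          unfolding c_def N_def using finite_YZ by (intro sum.mono_neutral_right) (auto simp: coef_def)
        then have "(c j)\<^sup>2 \<le> (\<Sum>i\<in>N. (v i * coef \<theta> i j)\<^sup>2) * card N"
          by (simp add: sum_squared_le_sum_of_squares)
        also have "\<dots> \<le> (\<Sum>i\<in>N. \<tau>\<^sup>2 * (v i)\<^sup>2) * k"
        proof (intro mult_mono sum_mono)
          fix i assume "i \<in> N"
          then have "\<bar>coef \<theta> i j\<bar> \<le> \<tau>" using coef_bound[OF \<theta>, of i j] by (simp add: N_def)
          then have "(coef \<theta> i j)\<^sup>2 \<le> \<tau>\<^sup>2" using power_mono[of "\<bar>coef \<theta> i j\<bar>" \<tau> 2] by simp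
          then show "(v i * coef \<theta> i j)\<^sup>2 \<le> \<tau>\<^sup>2 * (v i)\<^sup>2"
            by (simp add: power_mult_distrib mult.commute[of "\<tau>\<^sup>2"] mult_left_mono)
        qed (use degree_Y[OF j] in \<open>auto simp: N_def intro: sum_nonneg\<close>)
        also have "\<dots> = \<tau>\<^sup>2 * k * (\<Sum>i\<in>Z. if (i, j) \<in> E then (v i)\<^sup>2 else 0)"
          unfolding N_def using finite_YZ by (simp add: sum_distrib_left[symmetric] sum.inter_filter)
        finally show ?thesis .
      qed
      then have "(\<Sum>j\<in>Y. (c j)\<^sup>2) \<le> (\<Sum>j\<in>Y. \<tau>\<^sup>2 * k * (\<Sum>i\<in>Z. if (i, j) \<in> E then (v i)\<^sup>2 else 0))"
        by (rule sum_mono)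
      also have "\<dots> = \<tau>\<^sup>2 * k * (\<Sum>i\<in>Z. \<Sum>j\<in>Y. if (i, j) \<in> E then (v i)\<^sup>2 else 0)"
        unfolding sum_distrib_left[symmetric] by (subst sum.swap) (rule refl)
      also have "\<dots> = \<tau>\<^sup>2 * k * (\<Sum>i\<in>Z. card {j\<in>Y. (i, j) \<in> E} * (v i)\<^sup>2)"
        using finite_YZ by (simp add: sum.inter_filter[symmetric])
      also have "\<dots> \<le> \<tau>\<^sup>2 * k * (\<Sum>i\<in>Z. k * (v i)\<^sup>2)"
        using degree_Z by (intro mult_left_mono sum_mono mult_right_mono) auto
      also have "\<dots> = (\<tau> * k)\<^sup>2 * b"
        by (simp add: b_def sum_distrib_left[symmetric] power2_eq_square)
      also have "\<dots> \<le> (1 / 2)\<^sup>2 * b"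
        using \<tau>_pos \<tau>_small by (intro mult_right_mono power_mono) (auto simp: b_def intro: sum_nonneg)
      finally show ?thesis by (simp add: power2_eq_square)
    qed
    have "(\<Sum>j\<in>Y. (v j + c j)\<^sup>2) \<le> (\<Sum>j\<in>Y. 2 * (v j)\<^sup>2 + 2 * (c j)\<^sup>2)"
    proof (intro sum_mono)
      fix j
      have "0 \<le> (v j - c j)\<^sup>2" by simp
      then show "(v j + c j)\<^sup>2 \<le> 2 * (v j)\<^sup>2 + 2 * (c j)\<^sup>2" by (simp add: power2_sum power2_diff)
    qed
    also have "\<dots> \<le> 2 * (\<Sum>j\<in>Y. (v j)\<^sup>2) + b / 2"
      using c2 by (simp add: sum.distrib sum_distrib_left[symmetric])
    finally have "b / 2 + (\<Sum>j\<in>Y. (v j + c j)\<^sup>2) / 2 \<le> (\<Sum>j\<in>Y. (v j)\<^sup>2) + b"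
      using sum_nonneg[of Z "\<lambda>i. (v i)\<^sup>2"] by (simp add: b_def)
    also have "\<dots> = (\<Sum>i\<in>Y \<union> Z. (v i)\<^sup>2)"
      using finite_YZ disjoint by (simp add: b_def sum.union_disjoint)
    finally show ?thesis by (simp add: mult_left_mono)
  qed
  finally show ?thesis .
qed

sublocale scored_family sample E prob score "2 * \<tau>\<^sup>2" "2 * \<tau>"
proof
  show "finite sample" "finite E" by (rule finite_sample finite_edges)+
  show "0 \<le> 2 * \<tau>\<^sup>2" by simp
  fix \<theta> :: "nat \<times> nat \<Rightarrow> real" assume \<theta>: "\<theta> \<in> cube E"
  show "(\<Sum>\<omega>\<in>sample. prob \<theta> \<omega>) = 1" using expect_one[of \<theta>] by (simp add: expect_def)
  show "(\<Sum>\<omega>\<in>sample. prob \<theta> \<omega> * (\<Sum>e\<in>E. u e * score \<theta> e \<omega>)\<^sup>2) \<le> 2 * \<tau>\<^sup>2 * (\<Sum>e\<in>E. (u e)\<^sup>2)" for u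
    using fisher_information_bound[OF \<theta>, of u] by (simp add: expect_def)
  show "(\<Sum>\<omega>\<in>sample. prob \<theta> \<omega> * score \<theta> e \<omega>) = 0" if "e \<in> E" for e
    using score_mean[OF \<theta> that] by (simp add: expect_def)
next
  fix \<omega>
  show "(\<lambda>\<theta>. prob \<theta> \<omega>) \<in> borel_measurable (cube_measure E)"
    unfolding prob_def
    by (intro borel_measurable_times borel_measurable_prod borel_measurable_divide borel_measurable_add
        borel_measurable_const reg_measurable)
  show "(\<lambda>\<theta>. score \<theta> e \<omega>) \<in> borel_measurable (cube_measure E)" for e
    unfolding score_def
    by (intro borel_measurable_times borel_measurable_divide borel_measurable_add
        borel_measurable_const reg_measurable)
qed (fact prob_pos prob_derivative score_bound)+

end

section \<open>Finitely supported laws\<close>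

text \<open>
  The law of \<open>\<phi>\<close> when its argument is drawn from \<open>\<Omega>\<close> with probabilities \<open>p\<close>. The map \<open>\<phi>\<close> may
  identify sample points.
\<close>

definition finite_law :: "'w set \<Rightarrow> ('w \<Rightarrow> real) \<Rightarrow> 'a measure \<Rightarrow> ('w \<Rightarrow> 'a) \<Rightarrow> 'a measure" where
  "finite_law \<Omega> p M \<phi> = distr (point_measure \<Omega> (\<lambda>\<omega>. ennreal (p \<omega>))) M \<phi>"

lemma sets_finite_law [simp, measurable_cong]: "sets (finite_law \<Omega> p M \<phi>) = sets M"
  by (simp add: finite_law_def)

lemma measurable_point_measure: "\<phi> \<in> \<Omega> \<rightarrow> space M \<Longrightarrow> \<phi> \<in> point_measure \<Omega> p \<rightarrow>\<^sub>M M"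
  by (auto simp: measurable_def space_point_measure sets_point_measure)

lemma nn_integral_finite_law:
  assumes "finite \<Omega>" "\<phi> \<in> \<Omega> \<rightarrow> space M" "f \<in> borel_measurable M"
  shows "(\<integral>\<^sup>+x. f x \<partial>finite_law \<Omega> p M \<phi>) = (\<Sum>\<omega>\<in>\<Omega>. ennreal (p \<omega>) * f (\<phi> \<omega>))"
  unfolding finite_law_def
  using assms by (simp add: nn_integral_distr measurable_point_measure nn_integral_point_measure_finite)

lemma integral_finite_law:
  fixes f :: "'a \<Rightarrow> real"
  assumes "finite \<Omega>" "\<phi> \<in> \<Omega> \<rightarrow> space M" "f \<in> borel_measurable M" "\<And>\<omega>. \<omega> \<in> \<Omega> \<Longrightarrow> 0 \<le> p \<omega>"
  shows "(\<integral>x. f x \<partial>finite_law \<Omega> p M \<phi>) = (\<Sum>\<omega>\<in>\<Omega>. p \<omega> * f (\<phi> \<omega>))"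
  unfolding finite_law_def
  using assms by (simp add: integral_distr measurable_point_measure lebesgue_integral_point_measure_finite)

lemma integrable_finite_law:
  fixes f :: "'a \<Rightarrow> real"
  assumes "finite \<Omega>" "\<phi> \<in> \<Omega> \<rightarrow> space M" "f \<in> borel_measurable M"
  shows "integrable (finite_law \<Omega> p M \<phi>) f"
proof (rule integrableI_bounded)
  show "f \<in> borel_measurable (finite_law \<Omega> p M \<phi>)" using assms by measurable
  show "(\<integral>\<^sup>+x. ennreal (norm (f x)) \<partial>finite_law \<Omega> p M \<phi>) < \<infinity>"
    using assms by (subst nn_integral_finite_law) (auto simp: ennreal_mult_less_top)
qed

lemma prob_space_finite_law:
  assumes "finite \<Omega>" "\<phi> \<in> \<Omega> \<rightarrow> space M" "\<And>\<omega>. \<omega> \<in> \<Omega> \<Longrightarrow> 0 \<le> p \<omega>" "(\<Sum>\<omega>\<in>\<Omega>. p \<omega>) = 1"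
  shows "prob_space (finite_law \<Omega> p M \<phi>)"
proof
  have "emeasure (finite_law \<Omega> p M \<phi>) (space (finite_law \<Omega> p M \<phi>))
      = (\<integral>\<^sup>+x. 1 \<partial>finite_law \<Omega> p M \<phi>)" by simp
  also have "\<dots> = (\<Sum>\<omega>\<in>\<Omega>. ennreal (p \<omega>))"
    by (subst nn_integral_finite_law) (use assms in auto)
  also have "\<dots> = 1" using assms by simp
  finally show "emeasure (finite_law \<Omega> p M \<phi>) (space (finite_law \<Omega> p M \<phi>)) = 1" .
qed

lemma nn_integral_PiM_finite_law:
  assumes \<Omega>: "finite \<Omega>" "\<phi> \<in> \<Omega> \<rightarrow> space M" "\<And>\<omega>. \<omega> \<in> \<Omega> \<Longrightarrow> 0 \<le> p \<omega>" "(\<Sum>\<omega>\<in>\<Omega>. p \<omega>) = 1"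
    and I: "finite I" and f: "f \<in> borel_measurable (\<Pi>\<^sub>M i\<in>I. M)"
  shows "(\<integral>\<^sup>+x. f x \<partial>(\<Pi>\<^sub>M i\<in>I. finite_law \<Omega> p M \<phi>))
       = (\<Sum>S\<in>I \<rightarrow>\<^sub>E \<Omega>. ennreal (\<Prod>i\<in>I. p (S i)) * f (\<lambda>i\<in>I. \<phi> (S i)))"
  using I f
proof (induction I arbitrary: f rule: finite_induct)
  case empty
  then show ?case by (simp add: PiM_empty nn_integral_count_space_finite restrict_def)
next
  case (insert i I)
  define P where "P = finite_law \<Omega> p M \<phi>"
  interpret product_prob_space "\<lambda>_. P" "insert i I"
    unfolding P_def using prob_space_finite_law[OF \<Omega>]
    by (intro product_prob_spaceI)
  have [simp]: "sets (\<Pi>\<^sub>M i\<in>J. P) = sets (\<Pi>\<^sub>M i\<in>J. M)" for J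
    by (rule sets_PiM_cong) (auto simp: P_def)
  note [measurable] = insert.prems
  have upd: "(\<lambda>x. f (x(i := c))) \<in> borel_measurable (\<Pi>\<^sub>M i\<in>I. M)" if "c \<in> space M" for c
  proof -
    have "(\<lambda>x. x(i := c)) \<in> (\<Pi>\<^sub>M i\<in>I. M) \<rightarrow>\<^sub>M (\<Pi>\<^sub>M i\<in>insert i I. M)"
      by (rule measurable_fun_upd[where J = I]) (use that in auto)
    then show ?thesis using insert.prems by (rule measurable_compose)
  qed
  have inner: "(\<integral>\<^sup>+y. f (x(i := y)) \<partial>P) = (\<Sum>\<omega>\<in>\<Omega>. ennreal (p \<omega>) * f (x(i := \<phi> \<omega>)))"
    if x: "x \<in> space (\<Pi>\<^sub>M i\<in>I. P)" for x
    unfolding P_def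
  proof (rule nn_integral_finite_law[OF \<Omega>(1,2)])
    have "space P = space M" unfolding P_def by (simp add: finite_law_def)
    then have "x \<in> space (\<Pi>\<^sub>M i\<in>I. M)" using x by (simp add: space_PiM)
    then have "(\<lambda>y. x(i := y)) \<in> M \<rightarrow>\<^sub>M (\<Pi>\<^sub>M i\<in>insert i I. M)"
      by (intro measurable_fun_upd[where J = I]) auto
    then show "(\<lambda>y. f (x(i := y))) \<in> borel_measurable M" using insert.prems by (rule measurable_compose)
  qed
  have "(\<integral>\<^sup>+x. f x \<partial>(\<Pi>\<^sub>M i\<in>insert i I. P)) = (\<integral>\<^sup>+x. (\<integral>\<^sup>+y. f (x(i := y)) \<partial>P) \<partial>(\<Pi>\<^sub>M i\<in>I. P))"
    by (rule product_nn_integral_insert)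
       (use insert in \<open>auto cong: measurable_cong_sets\<close>)
  also have "\<dots> = (\<integral>\<^sup>+x. (\<Sum>\<omega>\<in>\<Omega>. ennreal (p \<omega>) * f (x(i := \<phi> \<omega>))) \<partial>(\<Pi>\<^sub>M i\<in>I. P))"
    by (rule nn_integral_cong) (rule inner)
  also have "\<dots> = (\<Sum>S\<in>I \<rightarrow>\<^sub>E \<Omega>. ennreal (\<Prod>i\<in>I. p (S i)) *
      (\<Sum>\<omega>\<in>\<Omega>. ennreal (p \<omega>) * f ((\<lambda>i\<in>I. \<phi> (S i))(i := \<phi> \<omega>))))"
    unfolding P_def
    by (rule insert.IH, intro borel_measurable_sum borel_measurable_times_ennreal upd borel_measurable_const)
       (use \<Omega>(2) in auto)
  also have "\<dots> = (\<Sum>z\<in>\<Omega> \<times> (I \<rightarrow>\<^sub>E \<Omega>). ennreal (p (fst z) * (\<Prod>i\<in>I. p (snd z i))) * f ((\<lambda>i\<in>I. \<phi> (snd z i))(i := \<phi> (fst z))))"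
  proof -
    have "(\<Sum>S\<in>I \<rightarrow>\<^sub>E \<Omega>. ennreal (\<Prod>i\<in>I. p (S i)) * (\<Sum>\<omega>\<in>\<Omega>. ennreal (p \<omega>) * f ((\<lambda>i\<in>I. \<phi> (S i))(i := \<phi> \<omega>))))
        = (\<Sum>S\<in>I \<rightarrow>\<^sub>E \<Omega>. \<Sum>\<omega>\<in>\<Omega>. ennreal (p \<omega> * (\<Prod>i\<in>I. p (S i))) * f ((\<lambda>i\<in>I. \<phi> (S i))(i := \<phi> \<omega>)))"
      unfolding sum_distrib_left
    proof (intro sum.cong refl)
      fix S \<omega> assume S: "S \<in> I \<rightarrow>\<^sub>E \<Omega>" and \<omega>: "\<omega> \<in> \<Omega>"
      have "0 \<le> (\<Prod>i\<in>I. p (S i))" using S \<Omega>(3) by (intro prod_nonneg) (auto dest: PiE_mem)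
      then show "ennreal (\<Prod>i\<in>I. p (S i)) * (ennreal (p \<omega>) * f ((\<lambda>i\<in>I. \<phi> (S i))(i := \<phi> \<omega>)))
          = ennreal (p \<omega> * (\<Prod>i\<in>I. p (S i))) * f ((\<lambda>i\<in>I. \<phi> (S i))(i := \<phi> \<omega>))"
        using \<Omega>(3)[OF \<omega>] by (simp add: ennreal_mult mult_ac)
    qed
    also have "\<dots> = (\<Sum>\<omega>\<in>\<Omega>. \<Sum>S\<in>I \<rightarrow>\<^sub>E \<Omega>. ennreal (p \<omega> * (\<Prod>i\<in>I. p (S i))) * f ((\<lambda>i\<in>I. \<phi> (S i))(i := \<phi> \<omega>)))"
      by (rule sum.swap)
    finally show ?thesis by (simp add: sum.cartesian_product split_beta)
  qed
  also have "\<dots> = (\<Sum>S\<in>insert i I \<rightarrow>\<^sub>E \<Omega>. ennreal (\<Prod>i\<in>insert i I. p (S i)) * f (\<lambda>i\<in>insert i I. \<phi> (S i)))"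
    unfolding PiE_insert_eq
  proof (subst sum.reindex, goal_cases)
    case 1
    show ?case by (rule inj_combinator[OF insert.hyps(2)])
  next
    case 2
    show ?case
    proof (intro sum.cong refl)
      fix z assume "z \<in> \<Omega> \<times> (I \<rightarrow>\<^sub>E \<Omega>)"
      obtain \<omega> S where z: "z = (\<omega>, S)" by force
      have "(\<Prod>j\<in>I. p ((S(i := \<omega>)) j)) = (\<Prod>j\<in>I. p (S j))"
        using insert.hyps by (intro prod.cong) auto
      moreover have "(\<lambda>j\<in>insert i I. \<phi> ((S(i := \<omega>)) j)) = (\<lambda>j\<in>I. \<phi> (S j))(i := \<phi> \<omega>)"
        using insert.hyps by (auto simp: fun_eq_iff restrict_def)
      ultimately show "ennreal (p (fst z) * (\<Prod>i\<in>I. p (snd z i))) * f ((\<lambda>i\<in>I. \<phi> (snd z i))(i := \<phi> (fst z)))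
          = ((\<lambda>S. ennreal (\<Prod>i\<in>insert i I. p (S i)) * f (\<lambda>i\<in>insert i I. \<phi> (S i))) \<circ> (\<lambda>(y, g). g(i := y))) z"
        using insert.hyps by (simp add: z)
    qed
  qed
  finally show ?case unfolding P_def .
qed

lemma nn_integral_gaussian_tilt:
  "(\<integral>\<^sup>+g. ennreal (std_normal_density g * exp (g * c)) \<partial>lborel) = ennreal (exp (c\<^sup>2 / 2))"
proof -
  have one: "(\<integral>\<^sup>+g. ennreal (normal_density c 1 g) \<partial>lborel) = 1"
  proof -
    interpret prob_space "density lborel (normal_density c 1)" by (rule prob_space_normal_density) simp
    show ?thesis using emeasure_space_1 by (simp add: emeasure_density)
  qed
  have "std_normal_density g * exp (g * c) = exp (c\<^sup>2 / 2) * normal_density c 1 g" for g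
    by (simp add: normal_density_def exp_add[symmetric] power2_eq_square field_simps)
  then show ?thesis using one by (simp add: ennreal_mult nn_integral_cmult)
qed

lemma nn_integral_gaussian_square:
  "(\<integral>\<^sup>+g. ennreal (std_normal_density g * exp (3 * g\<^sup>2 / 8)) \<partial>lborel) = 2"
proof -
  have one: "(\<integral>\<^sup>+g. ennreal (normal_density 0 2 g) \<partial>lborel) = 1"
  proof -
    interpret prob_space "density lborel (normal_density 0 2)" by (rule prob_space_normal_density) simp
    show ?thesis using emeasure_space_1 by (simp add: emeasure_density)
  qed
  have "std_normal_density g * exp (3 * g\<^sup>2 / 8) = 2 * normal_density 0 2 g" for g
  proof -
    have "sqrt (pi * 8) = 2 * sqrt (2 * pi)"
      using real_sqrt_mult[of 4 "2 * pi"] by (simp add: mult.commute)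
    then show ?thesis
      by (simp add: normal_density_def exp_add[symmetric] power2_eq_square field_simps)
  qed
  then show ?thesis using one by (simp add: ennreal_mult nn_integral_cmult)
qed

text \<open>
  The exponential of a square is a Gaussian mixture of exponentials of linear functions, which
  turns a bound on the moment generating function into one on the exponential moment of the square. The constant
  \<open>3/16\<close> is the one for which the remaining Gaussian integral equals 2.
\<close>

lemma sum_exp_square_le_two:
  fixes p u :: "'w \<Rightarrow> real"
  assumes "finite \<Omega>" and p: "\<And>\<omega>. \<omega> \<in> \<Omega> \<Longrightarrow> 0 \<le> p \<omega>"
    and mgf: "\<And>t. (\<Sum>\<omega>\<in>\<Omega>. p \<omega> * exp (t * u \<omega>)) \<le> exp (3 / 16 * t\<^sup>2)"
  shows "(\<Sum>\<omega>\<in>\<Omega>. p \<omega> * exp ((u \<omega>)\<^sup>2)) \<le> 2"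
proof -
  have "ennreal (\<Sum>\<omega>\<in>\<Omega>. p \<omega> * exp ((u \<omega>)\<^sup>2))
      = (\<Sum>\<omega>\<in>\<Omega>. ennreal (p \<omega>) * (\<integral>\<^sup>+g. ennreal (std_normal_density g * exp (g * (sqrt 2 * u \<omega>))) \<partial>lborel))"
    unfolding nn_integral_gaussian_tilt using p
    by (subst sum_ennreal[symmetric]) (auto simp: ennreal_mult power_mult_distrib)
  also have "\<dots> = (\<integral>\<^sup>+g. (\<Sum>\<omega>\<in>\<Omega>. ennreal (p \<omega>) * ennreal (std_normal_density g * exp (g * (sqrt 2 * u \<omega>)))) \<partial>lborel)"
    by (simp add: nn_integral_sum nn_integral_cmult)
  also have "\<dots> \<le> (\<integral>\<^sup>+g. ennreal (std_normal_density g * exp (3 * g\<^sup>2 / 8)) \<partial>lborel)"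
  proof (rule nn_integral_mono)
    fix g :: real
    have "(\<Sum>\<omega>\<in>\<Omega>. ennreal (p \<omega>) * ennreal (std_normal_density g * exp (g * (sqrt 2 * u \<omega>))))
        = ennreal (\<Sum>\<omega>\<in>\<Omega>. p \<omega> * (std_normal_density g * exp (g * (sqrt 2 * u \<omega>))))"
      using p by (subst sum_ennreal[symmetric]) (auto simp: ennreal_mult)
    also have "(\<Sum>\<omega>\<in>\<Omega>. p \<omega> * (std_normal_density g * exp (g * (sqrt 2 * u \<omega>))))
        = std_normal_density g * (\<Sum>\<omega>\<in>\<Omega>. p \<omega> * exp ((g * sqrt 2) * u \<omega>))"
      unfolding sum_distrib_left by (intro sum.cong refl) (simp add: mult_ac)
    also have "ennreal \<dots> \<le> ennreal (std_normal_density g * exp (3 / 16 * (g * sqrt 2)\<^sup>2))"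
      by (intro ennreal_leI mult_left_mono mgf) simp
    also have "3 / 16 * (g * sqrt 2)\<^sup>2 = 3 * g\<^sup>2 / 8" by (simp add: power_mult_distrib)
    finally show "(\<Sum>\<omega>\<in>\<Omega>. ennreal (p \<omega>) * ennreal (std_normal_density g * exp (g * (sqrt 2 * u \<omega>))))
        \<le> ennreal (std_normal_density g * exp (3 * g\<^sup>2 / 8))" .
  qed
  also have "\<dots> = ennreal 2" using nn_integral_gaussian_square by simp
  finally show ?thesis by (simp only: ennreal_le_iff zero_le_numeral)
qed

section \<open>Covariance and tails of a sign regression\<close>

context sign_regression
begin

definition coord :: "(nat \<Rightarrow> real) \<times> (nat \<Rightarrow> real) \<Rightarrow> nat \<Rightarrow> real" where
  "coord \<omega> i = (if i \<in> Y then fst \<omega> i else snd \<omega> i)"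

lemma linear_form_coord:
  "(\<Sum>i\<in>Y \<union> Z. v i * coord \<omega> i) = (\<Sum>j\<in>Y. v j * fst \<omega> j) + (\<Sum>i\<in>Z. v i * snd \<omega> i)"
proof -
  have "(\<Sum>i\<in>Z. v i * coord \<omega> i) = (\<Sum>i\<in>Z. v i * snd \<omega> i)"
    using disjoint by (intro sum.cong refl) (auto simp: coord_def)
  moreover have "(\<Sum>i\<in>Y. v i * coord \<omega> i) = (\<Sum>i\<in>Y. v i * fst \<omega> i)"
    by (intro sum.cong refl) (auto simp: coord_def)
  ultimately show ?thesis using finite_YZ disjoint by (simp add: sum.union_disjoint)
qed

lemma expect_exp_square_le:
  assumes \<theta>: "\<theta> \<in> cube E" and v: "s\<^sup>2 * (\<Sum>i\<in>Y \<union> Z. (v i)\<^sup>2) \<le> 3 / 16"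
  shows "expect \<theta> (\<lambda>\<omega>. exp ((s * (\<Sum>i\<in>Y \<union> Z. v i * coord \<omega> i))\<^sup>2)) \<le> 2"
  unfolding expect_def
proof (rule sum_exp_square_le_two[OF finite_sample])
  show "0 \<le> prob \<theta> \<omega>" if "\<omega> \<in> sample" for \<omega>
    using prob_pos[OF \<theta> that] by simp
  fix t
  have "(\<Sum>\<omega>\<in>sample. prob \<theta> \<omega> * exp (t * (s * (\<Sum>i\<in>Y \<union> Z. v i * coord \<omega> i))))
      = expect \<theta> (\<lambda>\<omega>. exp ((t * s) * ((\<Sum>j\<in>Y. v j * fst \<omega> j) + (\<Sum>i\<in>Z. v i * snd \<omega> i))))"
    by (simp add: expect_def linear_form_coord mult.assoc)
  also have "\<dots> \<le> exp ((t * s)\<^sup>2 * (\<Sum>i\<in>Y \<union> Z. (v i)\<^sup>2))"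
    by (rule expect_exp_le[OF \<theta>])
  also have "(t * s)\<^sup>2 * (\<Sum>i\<in>Y \<union> Z. (v i)\<^sup>2) = t\<^sup>2 * (s\<^sup>2 * (\<Sum>i\<in>Y \<union> Z. (v i)\<^sup>2))"
    by (simp add: power_mult_distrib)
  also have "exp \<dots> \<le> exp (3 / 16 * t\<^sup>2)"
    using mult_left_mono[OF v, of "t\<^sup>2"] by simp
  finally show "(\<Sum>\<omega>\<in>sample. prob \<theta> \<omega> * exp (t * (s * (\<Sum>i\<in>Y \<union> Z. v i * coord \<omega> i)))) \<le> exp (3 / 16 * t\<^sup>2)" .
qed

text \<open>
  From \<open>1 + x \<le> exp x\<close> and the exponential bound at the largest admissible scale.
\<close>

lemma expect_square_le:
  assumes \<theta>: "\<theta> \<in> cube E"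
  shows "expect \<theta> (\<lambda>\<omega>. (\<Sum>i\<in>Y \<union> Z. v i * coord \<omega> i)\<^sup>2) \<le> 6 * (\<Sum>i\<in>Y \<union> Z. (v i)\<^sup>2)"
proof (cases "(\<Sum>i\<in>Y \<union> Z. (v i)\<^sup>2) = 0")
  case True
  then have "v i = 0" if "i \<in> Y \<union> Z" for i
    using that finite_YZ by (subst (asm) sum_nonneg_eq_0_iff) auto
  then have "(\<Sum>i\<in>Y \<union> Z. v i * coord \<omega> i) = 0" for \<omega> by (intro sum.neutral) auto
  then show ?thesis using True by (simp add: expect_def)
next
  case False
  define q where "q = (\<Sum>i\<in>Y \<union> Z. (v i)\<^sup>2)"
  have q: "q > 0" using False sum_nonneg[of "Y \<union> Z" "\<lambda>i. (v i)\<^sup>2"] by (simp add: q_def)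
  define s where "s = sqrt (3 / (16 * q))"
  have s2: "s\<^sup>2 = 3 / (16 * q)" using q by (simp add: s_def)
  define u where "u \<omega> = (\<Sum>i\<in>Y \<union> Z. v i * coord \<omega> i)" for \<omega>
  have "1 + s\<^sup>2 * expect \<theta> (\<lambda>\<omega>. (u \<omega>)\<^sup>2) = expect \<theta> (\<lambda>\<omega>. 1 + (s * u \<omega>)\<^sup>2)"
    using expect_one[of \<theta>]
    by (simp add: expect_def distrib_left sum.distrib sum_distrib_left power_mult_distrib mult_ac)
  also have "\<dots> \<le> expect \<theta> (\<lambda>\<omega>. exp ((s * u \<omega>)\<^sup>2))"
    unfolding expect_def using prob_pos[OF \<theta>]
    by (intro sum_mono mult_left_mono) (auto simp: less_imp_le)
  also have "\<dots> \<le> 2"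
    unfolding u_def by (rule expect_exp_square_le[OF \<theta>]) (use q in \<open>simp add: s2 q_def[symmetric]\<close>)
  finally have "s\<^sup>2 * expect \<theta> (\<lambda>\<omega>. (u \<omega>)\<^sup>2) \<le> 1" by simp
  then have "expect \<theta> (\<lambda>\<omega>. (u \<omega>)\<^sup>2) \<le> 16 / 3 * q" using q by (simp add: s2 field_simps)
  also have "\<dots> \<le> 6 * q" using q by simp
  finally show ?thesis by (simp add: u_def q_def)
qed

definition coord_cov :: "(nat \<times> nat \<Rightarrow> real) \<Rightarrow> nat \<Rightarrow> nat \<Rightarrow> real" where
  "coord_cov \<theta> i j = expect \<theta> (\<lambda>\<omega>. coord \<omega> i * coord \<omega> j)"

lemma expect_coord: "i \<in> Y \<union> Z \<Longrightarrow> expect \<theta> (\<lambda>\<omega>. coord \<omega> i) = 0"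
  using expect_y[of i \<theta>] expect_z[of i \<theta>] by (cases "i \<in> Y") (auto simp: coord_def)

lemma coord_cov_sym: "coord_cov \<theta> i j = coord_cov \<theta> j i"
  by (simp add: coord_cov_def mult.commute)

lemma coord_cov_edge:
  assumes "(i, j) \<in> E"
  shows "coord_cov \<theta> i j = \<tau> * \<theta> (i, j)"
proof -
  have "i \<in> Z" "j \<in> Y" "i \<notin> Y" using assms edges disjoint by auto
  then show ?thesis using expect_zy[of i j \<theta>] assms by (simp add: coord_cov_def coord_def coef_def)
qed

lemma coord_cov_cases:
  assumes "i \<in> Y \<union> Z" "j \<in> Y \<union> Z" "i \<noteq> j"
  shows "coord_cov \<theta> i j = (if i \<in> Y \<and> j \<in> Y then 0 else if i \<in> Z \<and> j \<in> Y then coef \<theta> i j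
    else if i \<in> Y \<and> j \<in> Z then coef \<theta> j i else (\<Sum>l\<in>Y. coef \<theta> i l * coef \<theta> j l))"
proof -
  consider "i \<in> Y" "j \<in> Y" | "i \<in> Z" "j \<in> Y" | "i \<in> Y" "j \<in> Z" | "i \<in> Z" "j \<in> Z"
    using assms by auto
  then show ?thesis
  proof cases
    case 1
    then show ?thesis using assms expect_yy[of i j] by (simp add: coord_cov_def coord_def)
  next
    case 2
    then show ?thesis using disjoint expect_zy[of i j] by (auto simp: coord_cov_def coord_def)
  next
    case 3
    then show ?thesis using disjoint expect_zy[of j i] by (auto simp: coord_cov_def coord_def mult.commute)
  next
    case 4
    moreover have "i \<notin> Y" "j \<notin> Y" using 4 disjoint by auto
    ultimately show ?thesis using expect_zz[of i j] assms by (auto simp: coord_cov_def coord_def)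
  qed
qed

text \<open>
  For two coordinates in \<open>Z\<close> the covariance is quadratic in \<open>\<tau>\<close>, and \<open>\<tau> * k \<le> 1 / 2\<close> absorbs one
  factor.
\<close>

lemma coord_cov_bound:
  assumes \<theta>: "\<theta> \<in> cube E" and ij: "i \<in> Y \<union> Z" "j \<in> Y \<union> Z" "i \<noteq> j"
  shows "\<bar>coord_cov \<theta> i j\<bar> \<le> \<tau>"
proof -
  have coef: "\<bar>coef \<theta> i j\<bar> \<le> \<tau>" for i j
    using coef_bound[OF \<theta>, of i j] \<tau>_pos by (auto split: if_splits)
  have "\<bar>\<Sum>l\<in>Y. coef \<theta> i l * coef \<theta> j l\<bar> \<le> \<tau>" if "i \<in> Z"
  proof -
    have "\<bar>\<Sum>l\<in>Y. coef \<theta> i l * coef \<theta> j l\<bar> \<le> (\<Sum>l\<in>Y. \<bar>coef \<theta> i l\<bar> * \<tau>)"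
      by (rule sum_abs[THEN order_trans], rule sum_mono) (auto simp: abs_mult intro: mult_left_mono coef)
    also have "\<dots> \<le> (\<tau> * k) * \<tau>"
      unfolding sum_distrib_right[symmetric] using \<tau>_pos
      by (intro mult_right_mono coef_row_sum[OF \<theta> that]) auto
    also have "\<dots> \<le> 1 * \<tau>" using \<tau>_pos \<tau>_small by (intro mult_right_mono) auto
    finally show ?thesis by simp
  qed
  then show ?thesis using coord_cov_cases[OF ij, of \<theta>] coef \<tau>_pos ij by auto
qed

lemma coord_cov_nonzero:
  assumes ij: "i \<in> Y \<union> Z" "j \<in> Y \<union> Z" "i \<noteq> j" and nz: "coord_cov \<theta> i j \<noteq> 0"
  shows "(i, j) \<in> E \<or> (j, i) \<in> E \<or> (\<exists>l. (i, l) \<in> E \<and> (j, l) \<in> E)"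
proof (rule ccontr)
  assume *: "\<not> ?thesis"
  then have "coef \<theta> i j = 0" "coef \<theta> j i = 0" "(\<Sum>l\<in>Y. coef \<theta> i l * coef \<theta> j l) = 0"
    by (auto simp: coef_def intro!: sum.neutral)
  then show False using nz coord_cov_cases[OF ij, of \<theta>] by (auto split: if_splits)
qed

end

section \<open>From minimax risk to squared error of the parameters\<close>

text \<open>
  The signs, multiplied by a scale \<open>s\<close>, as the coordinates of a random vector in dimension \<open>d\<close>.
\<close>

locale sign_regression_law = sign_regression Y Z E \<tau> k
  for Y Z :: "nat set" and E :: "(nat \<times> nat) set" and \<tau> :: real and k :: nat +
  fixes d :: nat and s :: real
  assumes YZ: "Y \<union> Z = {..<d}" and s_pos: "0 < s"
begin

definition embed :: "(nat \<Rightarrow> real) \<times> (nat \<Rightarrow> real) \<Rightarrow> vec" where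
  "embed \<omega> = (\<lambda>i\<in>{..<d}. s * coord \<omega> i)"

definition law :: "(nat \<times> nat \<Rightarrow> real) \<Rightarrow> vec measure" where
  "law \<theta> = finite_law sample (prob \<theta>) (vec_space d) embed"

lemma embed_space: "embed \<in> A \<rightarrow> space (vec_space d)"
  by (auto simp: embed_def vec_space_def space_PiM)

lemma component_measurable: "i < d \<Longrightarrow> (\<lambda>x. x i) \<in> borel_measurable (vec_space d)"
  unfolding vec_space_def by (rule measurable_component_singleton) simp

lemma sets_law: "sets (law \<theta>) = sets (vec_space d)"
  by (simp add: law_def)

lemma integral_law:
  assumes "\<theta> \<in> cube E" "f \<in> borel_measurable (vec_space d)"
  shows "(\<integral>x. f x \<partial>law \<theta>) = expect \<theta> (\<lambda>\<omega>. f (embed \<omega>))"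
  unfolding law_def expect_def
  by (rule integral_finite_law[OF finite_sample embed_space assms(2)]) (use prob_pos[OF assms(1)] in \<open>simp add: less_imp_le\<close>)

lemma nn_integral_law:
  assumes \<theta>: "\<theta> \<in> cube E" and f: "f \<in> borel_measurable (vec_space d)" "\<And>x. 0 \<le> f x"
  shows "(\<integral>\<^sup>+x. ennreal (f x) \<partial>law \<theta>) = ennreal (expect \<theta> (\<lambda>\<omega>. f (embed \<omega>)))"
proof -
  have "(\<integral>\<^sup>+x. ennreal (f x) \<partial>law \<theta>) = (\<Sum>\<omega>\<in>sample. ennreal (prob \<theta> \<omega>) * ennreal (f (embed \<omega>)))"
    unfolding law_def by (rule nn_integral_finite_law[OF finite_sample embed_space measurable_compose[OF f(1) measurable_ennreal]])
  also have "\<dots> = (\<Sum>\<omega>\<in>sample. ennreal (prob \<theta> \<omega> * f (embed \<omega>)))"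
    using prob_pos[OF \<theta>] f(2) by (intro sum.cong refl) (simp add: ennreal_mult less_imp_le)
  also have "\<dots> = ennreal (\<Sum>\<omega>\<in>sample. prob \<theta> \<omega> * f (embed \<omega>))"
    by (rule sum_ennreal) (use prob_pos[OF \<theta>] f(2) in \<open>simp add: less_imp_le\<close>)
  finally show ?thesis by (simp add: expect_def)
qed

lemma prob_space_law: "\<theta> \<in> cube E \<Longrightarrow> prob_space (law \<theta>)"
  unfolding law_def
  by (rule prob_space_finite_law[OF finite_sample embed_space])
     (use prob_pos q_sum in \<open>auto simp: less_imp_le\<close>)

lemma expect_scale: "expect \<theta> (\<lambda>\<omega>. c * h \<omega>) = c * expect \<theta> h"
  by (simp add: expect_def sum_distrib_left mult_ac)

lemma mean_law:
  assumes "\<theta> \<in> cube E" "i < d"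
  shows "mean_vec (law \<theta>) i = 0"
proof -
  have "mean_vec (law \<theta>) i = expect \<theta> (\<lambda>\<omega>. s * coord \<omega> i)"
    unfolding mean_vec_def integral_law[OF assms(1) component_measurable[OF assms(2)]]
    using assms(2) by (simp add: embed_def)
  moreover have "expect \<theta> (\<lambda>\<omega>. coord \<omega> i) = 0" by (rule expect_coord) (use YZ assms(2) in auto)
  ultimately show ?thesis by (simp add: expect_scale)
qed

lemma cov_law:
  assumes "\<theta> \<in> cube E" "i < d" "j < d"
  shows "cov_mat d (law \<theta>) (i, j) = s\<^sup>2 * coord_cov \<theta> i j"
proof -
  have "cov_mat d (law \<theta>) (i, j) = (\<integral>x. x i * x j \<partial>law \<theta>)"
    using assms by (simp add: cov_mat_def mean_law)
  also have "\<dots> = expect \<theta> (\<lambda>\<omega>. embed \<omega> i * embed \<omega> j)"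
    by (rule integral_law[OF assms(1)]) (intro borel_measurable_times component_measurable assms)
  also have "\<dots> = expect \<theta> (\<lambda>\<omega>. s\<^sup>2 * (coord \<omega> i * coord \<omega> j))"
    using assms by (simp add: embed_def power2_eq_square mult_ac)
  finally show ?thesis by (simp add: expect_scale coord_cov_def)
qed

lemma cov_quadratic_form:
  assumes \<theta>: "\<theta> \<in> cube E"
  shows "(\<Sum>i<d. \<Sum>j<d. x i * cov_mat d (law \<theta>) (i, j) * x j)
    = s\<^sup>2 * expect \<theta> (\<lambda>\<omega>. (\<Sum>i\<in>Y \<union> Z. x i * coord \<omega> i)\<^sup>2)"
proof -
  have "(\<Sum>i<d. \<Sum>j<d. x i * cov_mat d (law \<theta>) (i, j) * x j)
      = (\<Sum>i<d. \<Sum>j<d. \<Sum>\<omega>\<in>sample. s\<^sup>2 * (prob \<theta> \<omega> * ((x i * coord \<omega> i) * (x j * coord \<omega> j))))"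
    by (intro sum.cong refl)
       (simp add: cov_law[OF \<theta>] coord_cov_def expect_def sum_distrib_left sum_distrib_right mult_ac)
  also have "\<dots> = (\<Sum>i<d. \<Sum>\<omega>\<in>sample. \<Sum>j<d. s\<^sup>2 * (prob \<theta> \<omega> * ((x i * coord \<omega> i) * (x j * coord \<omega> j))))"
    by (intro sum.cong refl sum.swap)
  also have "\<dots> = (\<Sum>\<omega>\<in>sample. \<Sum>i<d. \<Sum>j<d. s\<^sup>2 * (prob \<theta> \<omega> * ((x i * coord \<omega> i) * (x j * coord \<omega> j))))"
    by (rule sum.swap)
  also have "\<dots> = s\<^sup>2 * expect \<theta> (\<lambda>\<omega>. (\<Sum>i<d. x i * coord \<omega> i)\<^sup>2)"
    unfolding expect_def sum_distrib_left[of "s\<^sup>2"]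
  proof (intro sum.cong refl)
    fix \<omega>
    have "(\<Sum>i<d. x i * coord \<omega> i)\<^sup>2 = (\<Sum>i<d. \<Sum>j<d. (x i * coord \<omega> i) * (x j * coord \<omega> j))"
      unfolding power2_eq_square by (rule sum_product)
    then show "(\<Sum>i<d. \<Sum>j<d. s\<^sup>2 * (prob \<theta> \<omega> * ((x i * coord \<omega> i) * (x j * coord \<omega> j))))
        = s\<^sup>2 * (prob \<theta> \<omega> * (\<Sum>i<d. x i * coord \<omega> i)\<^sup>2)"
      by (simp only: sum_distrib_left)
  qed
  finally show ?thesis unfolding YZ .
qed

lemma law_bounded_cov:
  assumes \<theta>: "\<theta> \<in> cube E" and s: "6 * s\<^sup>2 \<le> M0"
  shows "cov_mat d (law \<theta>) \<in> bounded_cov_mats d M0"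
proof -
  have sym: "cov_mat d (law \<theta>) (i, j) = cov_mat d (law \<theta>) (j, i)" if "i < d" "j < d" for i j
    using that by (simp add: cov_law[OF \<theta>] coord_cov_sym)
  have nonneg: "0 \<le> expect \<theta> (\<lambda>\<omega>. (h \<omega>)\<^sup>2)" for h
    unfolding expect_def using prob_pos[OF \<theta>] by (intro sum_nonneg) (simp add: less_imp_le)
  have "psd d (cov_mat d (law \<theta>))"
    unfolding psd_def cov_quadratic_form[OF \<theta>] using sym nonneg by simp
  moreover have "psd d (\<lambda>ij. scalar_mat M0 ij - cov_mat d (law \<theta>) ij)"
    unfolding psd_def
  proof (intro conjI allI impI)
    show "scalar_mat M0 (i, j) - cov_mat d (law \<theta>) (i, j) = scalar_mat M0 (j, i) - cov_mat d (law \<theta>) (j, i)"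
      if "i < d" "j < d" for i j using sym[OF that] by (simp add: scalar_mat_def)
    fix x :: vec
    have "s\<^sup>2 * expect \<theta> (\<lambda>\<omega>. (\<Sum>i\<in>Y \<union> Z. x i * coord \<omega> i)\<^sup>2) \<le> s\<^sup>2 * (6 * (\<Sum>i\<in>Y \<union> Z. (x i)\<^sup>2))"
      by (intro mult_left_mono expect_square_le[OF \<theta>]) simp
    also have "\<dots> = 6 * s\<^sup>2 * (\<Sum>i<d. (x i)\<^sup>2)" by (simp add: YZ)
    also have "\<dots> \<le> M0 * (\<Sum>i<d. (x i)\<^sup>2)" by (intro mult_right_mono s sum_nonneg) simp
    also have "\<dots> = (\<Sum>i<d. \<Sum>j<d. x i * scalar_mat M0 (i, j) * x j)"
    proof -
      have "(\<Sum>j<d. x i * scalar_mat M0 (i, j) * x j) = M0 * (x i)\<^sup>2" if "i < d" for i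
      proof -
        have "(\<Sum>j<d. x i * scalar_mat M0 (i, j) * x j) = (\<Sum>j<d. if i = j then M0 * (x i)\<^sup>2 else 0)"
          by (intro sum.cong refl) (simp add: scalar_mat_def power2_eq_square)
        then show ?thesis using that by simp
      qed
      then show ?thesis by (simp add: sum_distrib_left)
    qed
    finally show "0 \<le> (\<Sum>i<d. \<Sum>j<d. x i * (scalar_mat M0 (i, j) - cov_mat d (law \<theta>) (i, j)) * x j)"
      unfolding cov_quadratic_form[OF \<theta>, symmetric]
      by (simp add: right_diff_distrib left_diff_distrib sum_subtractf)
  qed
  moreover have "cov_mat d (law \<theta>) \<in> space (mat_space d)"
    by (simp add: cov_mat_def mat_space_def space_PiM)
  ultimately show ?thesis by (simp add: bounded_cov_mats_def)
qed

lemma law_psi2: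
  assumes \<theta>: "\<theta> \<in> cube E" and K: "0 < K" "s\<^sup>2 \<le> 3 / 16 * K\<^sup>2"
  shows "psi2_norm_vec d (law \<theta>) (\<lambda>x i. x i - mean_vec (law \<theta>) i) \<le> ennreal K"
  unfolding psi2_norm_vec_def
proof (rule SUP_least)
  fix v :: vec assume "v \<in> {v. L2_set v {..<d} = 1}"
  then have v: "(\<Sum>i\<in>Y \<union> Z. (v i)\<^sup>2) = 1" by (simp add: L2_set_def YZ)
  have "(\<integral>\<^sup>+x. ennreal (exp ((inner_vec d (\<lambda>i. x i - mean_vec (law \<theta>) i) v)\<^sup>2 / K\<^sup>2)) \<partial>law \<theta>)
      = (\<integral>\<^sup>+x. ennreal (exp ((\<Sum>i<d. x i * v i)\<^sup>2 / K\<^sup>2)) \<partial>law \<theta>)"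
    by (simp add: inner_vec_def mean_law[OF \<theta>])
  also have "\<dots> = ennreal (expect \<theta> (\<lambda>\<omega>. exp ((\<Sum>i<d. embed \<omega> i * v i)\<^sup>2 / K\<^sup>2)))"
  proof (rule nn_integral_law[OF \<theta>])
    have "(\<lambda>x. \<Sum>i<d. x i * v i) \<in> borel_measurable (vec_space d)"
      by (intro borel_measurable_sum borel_measurable_times component_measurable) auto
    then show "(\<lambda>x. exp ((\<Sum>i<d. x i * v i)\<^sup>2 / K\<^sup>2)) \<in> borel_measurable (vec_space d)"
      by (intro measurable_compose[OF _ borel_measurable_exp] borel_measurable_divide borel_measurable_power borel_measurable_const)
  qed simp
  also have "expect \<theta> (\<lambda>\<omega>. exp ((\<Sum>i<d. embed \<omega> i * v i)\<^sup>2 / K\<^sup>2))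
      = expect \<theta> (\<lambda>\<omega>. exp ((s / K * (\<Sum>i\<in>Y \<union> Z. v i * coord \<omega> i))\<^sup>2))"
  proof -
    have "(\<Sum>i<d. embed \<omega> i * v i) = s * (\<Sum>i\<in>Y \<union> Z. v i * coord \<omega> i)" for \<omega>
      unfolding YZ sum_distrib_left by (intro sum.cong refl) (simp add: embed_def mult_ac)
    then show ?thesis by (simp add: power_mult_distrib power_divide)
  qed
  also have "ennreal \<dots> \<le> 2"
  proof -
    have "expect \<theta> (\<lambda>\<omega>. exp ((s / K * (\<Sum>i\<in>Y \<union> Z. v i * coord \<omega> i))\<^sup>2)) \<le> 2"
      by (rule expect_exp_square_le[OF \<theta>]) (use K in \<open>simp add: v power_divide divide_simps\<close>)
    then have "ennreal (expect \<theta> (\<lambda>\<omega>. exp ((s / K * (\<Sum>i\<in>Y \<union> Z. v i * coord \<omega> i))\<^sup>2))) \<le> ennreal 2"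
      by (rule ennreal_leI)
    then show ?thesis by simp
  qed
  finally show "psi2_norm (law \<theta>) (\<lambda>x. inner_vec d (\<lambda>i. x i - mean_vec (law \<theta>) i) v) \<le> ennreal K"
    unfolding psi2_norm_def using K by (intro INF_lower2[of K]) auto
qed

lemma law_model:
  assumes \<theta>: "\<theta> \<in> cube E" and K: "0 < K" "s\<^sup>2 \<le> 3 / 16 * K\<^sup>2"
    and J: "cov_mat d (law \<theta>) \<in> J \<alpha> M0 M d"
  shows "law \<theta> \<in> model_dists J \<alpha> K M0 M d"
proof -
  have "integrable (law \<theta>) (\<lambda>x. (x i)\<^sup>2)" if "i < d" for i
    unfolding law_def
    by (rule integrable_finite_law[OF finite_sample embed_space])
       (intro borel_measurable_power component_measurable that)
  then show ?thesis
    using prob_space_law[OF \<theta>] sets_law law_psi2[OF \<theta> K] J by (simp add: model_dists_def)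
qed

definition dataset_of :: "nat \<Rightarrow> (nat \<Rightarrow> (nat \<Rightarrow> real) \<times> (nat \<Rightarrow> real)) \<Rightarrow> dataset" where
  "dataset_of n S = (\<lambda>l\<in>{..<n}. embed (S l))"

lemma dataset_of_space: "dataset_of n S \<in> space (data_space n d)"
  using embed_space[of UNIV] by (auto simp: dataset_of_def data_space_def space_PiM)

text \<open>
  The law has finite support, so the expectation over the sample is a finite sum.
\<close>

lemma risk_finite_sum:
  assumes \<theta>: "\<theta> \<in> cube E" and A: "A \<in> data_space n d \<rightarrow>\<^sub>M prob_algebra (mat_space d)"
  shows "risk n d A (law \<theta>) = ennreal (1 / real d) * (\<Sum>S\<in>{..<n} \<rightarrow>\<^sub>E sample. ennreal (\<Prod>l<n. prob \<theta> (S l)) *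
    (\<integral>\<^sup>+B. ennreal ((frob_norm d (\<lambda>ij. B ij - cov_mat d (law \<theta>) ij))\<^sup>2) \<partial>A (dataset_of n S)))"
proof -
  define h where "h B = ennreal ((frob_norm d (\<lambda>ij. B ij - cov_mat d (law \<theta>) ij))\<^sup>2)" for B
  have h: "h \<in> borel_measurable (mat_space d)"
  proof -
    have "(\<lambda>B. \<Sum>ij\<in>{..<d} \<times> {..<d}. (B ij - cov_mat d (law \<theta>) ij)\<^sup>2) \<in> borel_measurable (mat_space d)"
      unfolding mat_space_def
      by (intro borel_measurable_sum borel_measurable_power borel_measurable_diff
          borel_measurable_const measurable_component_singleton)
    then have "(\<lambda>B. ennreal (\<Sum>ij\<in>{..<d} \<times> {..<d}. (B ij - cov_mat d (law \<theta>) ij)\<^sup>2)) \<in> borel_measurable (mat_space d)"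
      by (rule measurable_compose[OF _ measurable_ennreal])
    moreover have "h = (\<lambda>B. ennreal (\<Sum>ij\<in>{..<d} \<times> {..<d}. (B ij - cov_mat d (law \<theta>) ij)\<^sup>2))"
      unfolding h_def[abs_def] frob_norm_def L2_set_def
      by (subst real_sqrt_pow2) (auto intro: sum_nonneg)
    ultimately show ?thesis by (simp only:)
  qed
  have "(\<lambda>S. \<integral>\<^sup>+B. h B \<partial>A S) \<in> borel_measurable (data_space n d)"
    by (rule measurable_compose[OF measurable_prob_algebraD[OF A] nn_integral_measurable_subprob_algebra[OF h]])
  then have meas: "(\<lambda>S. \<integral>\<^sup>+B. h B \<partial>A S) \<in> borel_measurable (\<Pi>\<^sub>M k\<in>{..<n}. vec_space d)"
    unfolding data_space_def .
  have "(\<integral>\<^sup>+S. (\<integral>\<^sup>+B. h B \<partial>A S) \<partial>(\<Pi>\<^sub>M k\<in>{..<n}. law \<theta>))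
      = (\<Sum>S\<in>{..<n} \<rightarrow>\<^sub>E sample. ennreal (\<Prod>l<n. prob \<theta> (S l)) * (\<integral>\<^sup>+B. h B \<partial>A (dataset_of n S)))"
    unfolding law_def dataset_of_def
    by (rule nn_integral_PiM_finite_law[OF finite_sample embed_space _ q_sum[OF \<theta>] finite_lessThan meas])
       (simp add: prob_pos[OF \<theta>] less_imp_le)
  then show ?thesis unfolding risk_def h_def by (rule arg_cong)
qed

text \<open>
  A matrix estimator yields the parameter estimates \<open>B e / (s\<^sup>2 * \<tau>)\<close>, and the entries in \<open>E\<close> alone
  contribute \<open>(s\<^sup>2 * \<tau>)\<^sup>2\<close> times the squared error to the Frobenius loss. Since all samples have positive
  probability, finite risk at one parameter makes the estimates square integrable on every dataset.
\<close>

lemma risk_lower_bounds: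
  assumes A: "A \<in> zcdp_estimators n d \<rho>" and pos: "0 < n" "0 < d" "0 < \<rho>" "0 \<le> r" and E: "E \<noteq> {}"
    and risk: "\<And>\<theta>. \<theta> \<in> cube E \<Longrightarrow> risk n d A (law \<theta>) \<le> ennreal r"
  defines "R \<equiv> real d * r / (s\<^sup>2 * \<tau>)\<^sup>2"
  shows "card E / 4 \<le> (1 + 6 * (n * \<tau>\<^sup>2)) * R"
    and "card E / 4 \<le> (1 + 6 * ((real n)\<^sup>2 * (exp (2 * \<rho>) - 1) * \<tau>\<^sup>2 / card E)) * R"
proof -
  define T :: "nat \<times> nat \<Rightarrow> mtx \<Rightarrow> real" where "T e B = B e / (s\<^sup>2 * \<tau>)" for e B
  define \<mu> where "\<mu> S = A (dataset_of n S)" for S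
  define Q where "Q \<theta> B = (\<Sum>e\<in>E. (T e B - \<theta> e)\<^sup>2)" for \<theta> B
  have E_sub: "E \<subseteq> {..<d} \<times> {..<d}" using edges YZ by auto
  have A_meas: "A \<in> data_space n d \<rightarrow>\<^sub>M prob_algebra (mat_space d)"
    using A by (simp add: zcdp_estimators_def)
  have \<mu>_space: "prob_space (\<mu> S)" "sets (\<mu> S) = sets (mat_space d)" for S
    using measurable_space[OF A_meas dataset_of_space, of S] by (simp_all add: \<mu>_def space_prob_algebra)
  have T_meas: "T e \<in> borel_measurable (\<mu> S)" if "e \<in> E" for e S
  proof -
    have "(\<lambda>B. B e) \<in> borel_measurable (mat_space d)"
      unfolding mat_space_def using that E_sub by (intro measurable_component_singleton) auto
    then have "(\<lambda>B. B e) \<in> borel_measurable (\<mu> S)"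
      using measurable_cong_sets[OF \<mu>_space(2) refl] by blast
    then have "(\<lambda>B. T e B) \<in> borel_measurable (\<mu> S)"
      unfolding T_def by (rule borel_measurable_divide) simp
    then show ?thesis .
  qed
  have Q_meas: "(\<lambda>B. Q \<theta> B) \<in> borel_measurable (\<mu> S)" for \<theta> S
    unfolding Q_def
    by (intro borel_measurable_sum borel_measurable_power borel_measurable_diff borel_measurable_const T_meas)
  have Q_nonneg: "0 \<le> Q \<theta> B" for \<theta> B by (simp add: Q_def sum_nonneg)
  define c where "c = (s\<^sup>2 * \<tau>)\<^sup>2 / d"
  have c: "0 < c" using s_pos \<tau>_pos pos by (simp add: c_def)
  have R_c: "R = r / c" by (simp add: R_def c_def)
  have R_nonneg: "0 \<le> R" using pos by (simp add: R_def)
  have total: "(\<Sum>S\<in>{..<n} \<rightarrow>\<^sub>E sample. ennreal (\<Prod>l<n. prob \<theta> (S l)) * (\<integral>\<^sup>+B. ennreal (Q \<theta> B) \<partial>\<mu> S)) \<le> ennreal R"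
    (is "?X \<le> _") if \<theta>: "\<theta> \<in> cube E" for \<theta>
  proof -
    have frob: "(s\<^sup>2 * \<tau>)\<^sup>2 * Q \<theta> B \<le> (frob_norm d (\<lambda>ij. B ij - cov_mat d (law \<theta>) ij))\<^sup>2" for B
    proof -
      have "(s\<^sup>2 * \<tau>)\<^sup>2 * Q \<theta> B = (\<Sum>e\<in>E. (B e - cov_mat d (law \<theta>) e)\<^sup>2)"
        unfolding Q_def sum_distrib_left
      proof (intro sum.cong refl)
        fix e assume e: "e \<in> E"
        obtain i j where ij: "e = (i, j)" by force
        have "cov_mat d (law \<theta>) e = s\<^sup>2 * \<tau> * \<theta> e"
          using e E_sub cov_law[OF \<theta>, of i j] coord_cov_edge[of i j \<theta>] by (auto simp: ij)
        then show "(s\<^sup>2 * \<tau>)\<^sup>2 * (T e B - \<theta> e)\<^sup>2 = (B e - cov_mat d (law \<theta>) e)\<^sup>2"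
          unfolding power_mult_distrib[symmetric] T_def right_diff_distrib
          using s_pos \<tau>_pos by simp
      qed
      also have "\<dots> \<le> (\<Sum>e\<in>{..<d} \<times> {..<d}. (B e - cov_mat d (law \<theta>) e)\<^sup>2)"
        by (rule sum_mono2) (use E_sub in auto)
      finally show ?thesis by (simp add: frob_norm_def L2_set_def sum_nonneg)
    qed
    have "ennreal c * ?X = ennreal (1 / d) * (\<Sum>S\<in>{..<n} \<rightarrow>\<^sub>E sample. ennreal (\<Prod>l<n. prob \<theta> (S l)) *
        (\<integral>\<^sup>+B. ennreal ((s\<^sup>2 * \<tau>)\<^sup>2 * Q \<theta> B) \<partial>\<mu> S))"
    proof -
      have "(\<integral>\<^sup>+B. ennreal ((s\<^sup>2 * \<tau>)\<^sup>2 * Q \<theta> B) \<partial>\<mu> S) = ennreal ((s\<^sup>2 * \<tau>)\<^sup>2) * (\<integral>\<^sup>+B. ennreal (Q \<theta> B) \<partial>\<mu> S)" for S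
        unfolding ennreal_mult[OF zero_le_power2 Q_nonneg]
        by (rule nn_integral_cmult) (rule measurable_compose[OF Q_meas measurable_ennreal])
      moreover have "ennreal c = ennreal (1 / d) * ennreal ((s\<^sup>2 * \<tau>)\<^sup>2)"
        by (simp add: c_def ennreal_mult[symmetric])
      ultimately show ?thesis by (simp add: sum_distrib_left mult_ac)
    qed
    also have "\<dots> \<le> risk n d A (law \<theta>)"
      unfolding risk_finite_sum[OF \<theta> A_meas] \<mu>_def
      by (intro mult_left_mono sum_mono nn_integral_mono ennreal_leI frob) auto
    also have "\<dots> \<le> ennreal r" by (rule risk[OF \<theta>])
    finally have "ennreal (1 / c) * (ennreal c * ?X) \<le> ennreal (1 / c) * ennreal r"
      by (rule mult_left_mono) simp
    moreover have "ennreal (1 / c) * (ennreal c * ?X) = ?X"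
      using c by (simp add: mult.assoc[symmetric] ennreal_mult[symmetric])
    moreover have "ennreal (1 / c) * ennreal r = ennreal R"
      using c pos by (simp add: ennreal_mult[symmetric] R_c)
    ultimately show ?thesis by simp
  qed
  \<comment> \<open>Every dataset in the support has positive weight, so a finite average forces each term to be finite.\<close>
  have Q_finite: "(\<integral>\<^sup>+B. ennreal (Q \<theta> B) \<partial>\<mu> S) < \<infinity>"
    if \<theta>: "\<theta> \<in> cube E" and S: "S \<in> {..<n} \<rightarrow>\<^sub>E sample" for \<theta> S
  proof -
    have w: "0 < (\<Prod>l<n. prob \<theta> (S l))"
      by (rule prod_pos) (rule prob_pos[OF \<theta> PiE_mem[OF S]])
    have "ennreal (\<Prod>l<n. prob \<theta> (S l)) * (\<integral>\<^sup>+B. ennreal (Q \<theta> B) \<partial>\<mu> S)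
        \<le> (\<Sum>S\<in>{..<n} \<rightarrow>\<^sub>E sample. ennreal (\<Prod>l<n. prob \<theta> (S l)) * (\<integral>\<^sup>+B. ennreal (Q \<theta> B) \<partial>\<mu> S))"
      by (rule member_le_sum[OF S]) (use finite_sample in \<open>auto simp: finite_PiE\<close>)
    also have "\<dots> \<le> ennreal R" by (rule total[OF \<theta>])
    finally have "ennreal (\<Prod>l<n. prob \<theta> (S l)) * (\<integral>\<^sup>+B. ennreal (Q \<theta> B) \<partial>\<mu> S) < \<infinity>"
      by (rule le_less_trans) simp
    moreover have "x < \<infinity>" if "0 < w" "ennreal w * x < \<infinity>" for w :: real and x
      using that by (auto simp: ennreal_mult_less_top)
    ultimately show ?thesis using w by blast
  qed
  have T_square: "integrable (\<mu> S) (\<lambda>B. (T e B)\<^sup>2)" if S: "S \<in> {..<n} \<rightarrow>\<^sub>E sample" and e: "e \<in> E" for S e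
  proof (rule integrableI_bounded)
    show "(\<lambda>B. (T e B)\<^sup>2) \<in> borel_measurable (\<mu> S)" using T_meas[OF e] by (rule borel_measurable_power)
    define \<theta>0 :: "nat \<times> nat \<Rightarrow> real" where "\<theta>0 = (\<lambda>e\<in>E. 0)"
    have \<theta>0: "\<theta>0 \<in> cube E" by (auto simp: \<theta>0_def)
    have "(T e B)\<^sup>2 \<le> Q \<theta>0 B" for B
      using member_le_sum[OF e, of "\<lambda>e. (T e B - \<theta>0 e)\<^sup>2"] finite_edges e by (simp add: Q_def \<theta>0_def)
    then have "(\<integral>\<^sup>+B. ennreal (norm ((T e B)\<^sup>2)) \<partial>\<mu> S) \<le> (\<integral>\<^sup>+B. ennreal (Q \<theta>0 B) \<partial>\<mu> S)"
      by (intro nn_integral_mono ennreal_leI) simp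
    then show "(\<integral>\<^sup>+B. ennreal (norm ((T e B)\<^sup>2)) \<partial>\<mu> S) < \<infinity>"
      using Q_finite[OF \<theta>0 S] by (rule le_less_trans)
  qed
  interpret est: estimated_family sample E prob score "2 * \<tau>\<^sup>2" "2 * \<tau>" n \<mu> T
  proof (intro estimated_family.intro estimated_family_axioms.intro)
    show "scored_family sample E prob score (2 * \<tau>\<^sup>2) (2 * \<tau>)" by (rule scored_family_axioms)
    show "prob_space (\<mu> S)" for S by (rule \<mu>_space(1))
    show "T e \<in> borel_measurable (\<mu> S)" if "e \<in> E" for S e by (rule T_meas[OF that])
    show "integrable (\<mu> S) (\<lambda>B. (T e B)\<^sup>2)" if "S \<in> {..<n} \<rightarrow>\<^sub>E sample" "e \<in> E" for S e
      by (rule T_square[OF that])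
  qed
  have mse: "est.mse \<theta> \<le> R" if \<theta>: "\<theta> \<in> cube E" for \<theta>
  proof -
    have "ennreal (est.mse \<theta>) = (\<Sum>S\<in>{..<n} \<rightarrow>\<^sub>E sample. ennreal (\<Prod>l<n. prob \<theta> (S l)) * (\<integral>\<^sup>+B. ennreal (Q \<theta> B) \<partial>\<mu> S))"
      unfolding est.mse_def est.data_def
    proof (subst sum_ennreal[symmetric], goal_cases)
      case (1 S)
      then show ?case
        using est.data_prob_pos[OF \<theta>, of S]
        by (intro mult_nonneg_nonneg Bochner_Integration.integral_nonneg sum_nonneg) (auto simp: est.data_def)
    next
      case 2
      show ?case
      proof (intro sum.cong refl)
        fix S assume S: "S \<in> {..<n} \<rightarrow>\<^sub>E sample"
        have "(\<integral>\<^sup>+B. ennreal (Q \<theta> B) \<partial>\<mu> S) = ennreal (\<integral>B. Q \<theta> B \<partial>\<mu> S)"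
          using est.shifted_mse_integral[of S \<theta>] S Q_nonneg unfolding Q_def est.data_def
          by (intro nn_integral_eq_integral) auto
        then show "ennreal (est.data_prob \<theta> S * (\<integral>B. (\<Sum>e\<in>E. (T e B - \<theta> e)\<^sup>2) \<partial>\<mu> S))
            = ennreal (\<Prod>l<n. prob \<theta> (S l)) * (\<integral>\<^sup>+B. ennreal (Q \<theta> B) \<partial>\<mu> S)"
          using est.data_prob_pos[OF \<theta>, of S] S
          by (simp add: ennreal_mult' est.data_prob_def est.data_def Q_def less_imp_le)
      qed
    qed
    also have "\<dots> \<le> ennreal R" by (rule total[OF \<theta>])
    finally show ?thesis using R_nonneg by (simp only: ennreal_le_iff)
  qed
  show "card E / 4 \<le> (1 + 6 * (n * \<tau>\<^sup>2)) * R"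
    using est.mse_lower_bound_nonprivate[OF mse] pos \<tau>_pos by (simp add: mult_ac)
  define \<kappa> where "\<kappa> = exp (2 * \<rho>) - 1"
  have \<kappa>: "0 < \<kappa>" using pos by (simp add: \<kappa>_def)
  have "card E / 4 \<le> (1 + 3 * (n\<^sup>2 * \<kappa> * (2 * \<tau>\<^sup>2) / card E)) * R"
  proof (rule est.mse_lower_bound_private[OF mse pos(1) \<kappa> E])
    fix S l x and f :: "mtx \<Rightarrow> real" and \<eta> :: real
    assume S: "S \<in> est.data" and l: "l < n" and x: "x \<in> sample" and \<eta>: "0 < \<eta>"
      and f: "f \<in> borel_measurable (\<mu> (S(l := x)))" "integrable (\<mu> S) (\<lambda>B. (f B)\<^sup>2)"
        "integrable (\<mu> (S(l := x))) (\<lambda>B. (f B)\<^sup>2)"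
    show "(\<integral>B. f B \<partial>\<mu> S) \<le> (\<integral>B. f B \<partial>\<mu> (S(l := x))) + \<eta> / 2 * \<kappa> + (\<integral>B. (f B)\<^sup>2 \<partial>\<mu> (S(l := x))) / (2 * \<eta>)"
    \<comment> \<open>Adjacent datasets differ in exactly one observation, so equal datasets are treated apart.\<close>
    proof (cases "dataset_of n S = dataset_of n (S(l := x))")
      case True
      then have "\<mu> S = \<mu> (S(l := x))" by (simp add: \<mu>_def)
      moreover have "0 \<le> (\<integral>B. (f B)\<^sup>2 \<partial>\<mu> (S(l := x))) / (2 * \<eta>)" "0 \<le> \<eta> / 2 * \<kappa>"
        using \<eta> \<kappa> by auto
      ultimately show ?thesis by simp
    next
      case False
      have off: "dataset_of n S m = dataset_of n (S(l := x)) m" if "m \<noteq> l" for m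
        using that by (simp add: dataset_of_def)
      with False have "dataset_of n S l \<noteq> dataset_of n (S(l := x)) l"
        by (metis ext)
      then have "{m\<in>{..<n}. dataset_of n S m \<noteq> dataset_of n (S(l := x)) m} = {l}"
        using off l by auto
      then have "adjacent n (dataset_of n S) (dataset_of n (S(l := x)))"
        by (simp add: adjacent_def)
      then have "renyi_div 2 (\<mu> S) (\<mu> (S(l := x))) \<le> ereal (\<rho> * 2)"
        using A dataset_of_space by (simp add: zcdp_estimators_def \<mu>_def)
      then show ?thesis
        unfolding \<kappa>_def
        by (intro renyi_two_mean_gap \<mu>_space f \<eta>) (simp_all add: \<mu>_space)
    qed
  qed
  then show "card E / 4 \<le> (1 + 6 * ((real n)\<^sup>2 * (exp (2 * \<rho>) - 1) * \<tau>\<^sup>2 / card E)) * R"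
    by (simp add: \<kappa>_def mult_ac)
qed

end

section \<open>Block designs\<close>

definition block_Y :: "nat \<Rightarrow> nat \<Rightarrow> nat set" where
  "block_Y d k = {j. j < d \<and> j mod (2 * k) < k}"

definition block_Z :: "nat \<Rightarrow> nat \<Rightarrow> nat set" where
  "block_Z d k = {i. i < d \<and> k \<le> i mod (2 * k)}"

definition block_edges :: "nat \<Rightarrow> nat \<Rightarrow> (nat \<times> nat) set" where
  "block_edges d k = {(i, j). i \<in> block_Z d k \<and> j \<in> block_Y d k \<and> i div (2 * k) = j div (2 * k)}"

lemma same_block_inj: "inj_on (\<lambda>i::nat. i mod m) {i. i div m = b}"
  by (rule inj_onI) (metis div_mult_mod_eq mem_Collect_eq)

lemma block_position:
  fixes x m b :: nat
  assumes "x < m"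
  shows "(b * m + x) div m = b" "(b * m + x) mod m = x"
  using assms by simp_all

text \<open>
  A complete block contributes \<open>k\<^sup>2\<close> pairs, and the complete blocks fill at least half of the
  coordinates because there is at least one of them.
\<close>

lemma card_block_edges:
  assumes k: "1 \<le> k" "2 * k \<le> d"
  shows "real k * real d / 4 \<le> card (block_edges d k)"
proof -
  define m where "m = d div (2 * k)"
  define \<phi> where "\<phi> = (\<lambda>(b, u, v). (b * (2 * k) + (k + u), b * (2 * k) + v))"
  have m: "1 \<le> m" using k by (simp add: m_def Suc_le_eq div_greater_zero_iff)
  have inj: "inj_on \<phi> ({..<m} \<times> {..<k} \<times> {..<k})"
  proof (rule inj_onI, clarsimp simp: \<phi>_def)
    fix b u v b' u' v'
    assume *: "u < k" "v < k" "u' < k" "v' < k"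
      "b * (2 * k) + u = b' * (2 * k) + u'" "b * (2 * k) + v = b' * (2 * k) + v'"
    have "u < 2 * k" "u' < 2 * k" using * by simp_all
    then have "b = b'" using block_position(1)[of u "2 * k" b] block_position(1)[of u' "2 * k" b'] *(5) by metis
    then show "b = b' \<and> u = u' \<and> v = v'" using * by simp
  qed
  have sub: "\<phi> ` ({..<m} \<times> {..<k} \<times> {..<k}) \<subseteq> block_edges d k"
  proof (rule image_subsetI)
    fix z assume z: "z \<in> {..<m} \<times> {..<k} \<times> {..<k}"
    obtain b u v where buv: "z = (b, u, v)" by (cases z)
    have *: "b < m" "u < k" "v < k" using z by (simp_all add: buv)
    have "b * (2 * k) + 2 * k \<le> m * (2 * k)"
      using mult_le_mono1[of "Suc b" m "2 * k"] * by simp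
    moreover have "m * (2 * k) \<le> d" by (simp add: m_def)
    ultimately have d: "b * (2 * k) + 2 * k \<le> d" by linarith
    have "(b * (2 * k) + (k + u)) mod (2 * k) = k + u" "(b * (2 * k) + v) mod (2 * k) = v"
      "(b * (2 * k) + (k + u)) div (2 * k) = b" "(b * (2 * k) + v) div (2 * k) = b"
      using * by (intro block_position; linarith)+
    then show "\<phi> z \<in> block_edges d k"
      using d * by (simp add: buv \<phi>_def block_edges_def block_Y_def block_Z_def)
  qed
  have "finite (block_edges d k)"
    by (rule finite_subset[of _ "{..<d} \<times> {..<d}"]) (auto simp: block_edges_def block_Y_def block_Z_def)
  then have "card ({..<m} \<times> {..<k} \<times> {..<k}) \<le> card (block_edges d k)"
    using card_mono[OF _ sub] by (simp add: card_image[OF inj])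
  then have "m * (k * k) \<le> card (block_edges d k)" by (simp add: card_cartesian_product)
  moreover have "k * d \<le> 4 * (m * (k * k))"
  proof -
    have "d = m * (2 * k) + d mod (2 * k)" by (simp only: m_def div_mult_mod_eq)
    moreover have "d mod (2 * k) < 2 * k" using k by simp
    moreover have "2 * k \<le> m * (2 * k)" using m by simp
    ultimately have "d \<le> 4 * (m * k)" by linarith
    then have "k * d \<le> k * (4 * (m * k))" by simp
    then show ?thesis by (simp add: mult_ac)
  qed
  ultimately have "k * d \<le> 4 * card (block_edges d k)" by linarith
  then have "real (k * d) \<le> real (4 * card (block_edges d k))" by (simp only: of_nat_le_iff)
  then show ?thesis by simp
qed

locale block_regression =
  fixes d k :: nat and \<tau> s :: real
  assumes k_pos: "1 \<le> k" and k_le: "2 * k \<le> d"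
    and signal_pos: "0 < \<tau>" and signal_small: "\<tau> * k \<le> 1 / 2" and scale_pos: "0 < s"

sublocale block_regression \<subseteq> sign_regression_law "block_Y d k" "block_Z d k" "block_edges d k" \<tau> k d s
proof
  show "finite (block_Y d k)" "finite (block_Z d k)" by (simp_all add: block_Y_def block_Z_def)
  show "block_Y d k \<inter> block_Z d k = {}" "block_edges d k \<subseteq> block_Z d k \<times> block_Y d k"
    "block_Y d k \<union> block_Z d k = {..<d}"
    by (auto simp: block_Y_def block_Z_def block_edges_def)
  show "0 < \<tau>" "\<tau> * k \<le> 1 / 2" "0 < s" by (rule signal_pos signal_small scale_pos)+
  show "card {j \<in> block_Y d k. (i, j) \<in> block_edges d k} \<le> k" for i
  proof -
    have "card {j \<in> block_Y d k. (i, j) \<in> block_edges d k} \<le> card {..<k}"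
      by (rule card_inj_on_le[of "\<lambda>j. j mod (2 * k)"])
         (auto simp: block_Y_def block_edges_def intro: inj_on_subset[OF same_block_inj[of _ "i div (2 * k)"]])
    then show ?thesis by simp
  qed
  show "card {i \<in> block_Z d k. (i, j) \<in> block_edges d k} \<le> k" for j
  proof -
    have "card {i \<in> block_Z d k. (i, j) \<in> block_edges d k} \<le> card {k..<2 * k}"
      using k_pos
      by (intro card_inj_on_le[of "\<lambda>j. j mod (2 * k)"])
         (auto simp: block_Z_def block_edges_def intro: inj_on_subset[OF same_block_inj[of _ "j div (2 * k)"]])
    then show ?thesis by simp
  qed
qed

context block_regression
begin

lemma cov_off_diagonal:
  assumes \<theta>: "\<theta> \<in> cube (block_edges d k)" and ij: "i < d" "j < d" "i \<noteq> j"
  shows "\<bar>cov_mat d (law \<theta>) (i, j)\<bar> \<le> (if i div (2 * k) = j div (2 * k) then s\<^sup>2 * \<tau> else 0)"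
proof -
  have YZ': "i \<in> block_Y d k \<union> block_Z d k" "j \<in> block_Y d k \<union> block_Z d k" using ij YZ by auto
  have "coord_cov \<theta> i j = 0" if "i div (2 * k) \<noteq> j div (2 * k)"
  proof (rule ccontr)
    have same: "a div (2 * k) = b div (2 * k)" if "(a, b) \<in> block_edges d k" for a b
      using that by (simp add: block_edges_def)
    assume "coord_cov \<theta> i j \<noteq> 0"
    then show False using coord_cov_nonzero[OF YZ' ij(3), of \<theta>] that same by metis
  qed
  then show ?thesis
    using coord_cov_bound[OF \<theta> YZ' ij(3)] s_pos
    by (simp add: cov_law[OF \<theta>] ij abs_mult)
qed

lemma same_block_close: 
  fixes i j :: nat
  assumes "i div (2 * k) = j div (2 * k)"
  shows "\<bar>real i - real j\<bar> \<le> 2 * k"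
proof -
  have "i = (i div (2 * k)) * (2 * k) + i mod (2 * k)" "j = (i div (2 * k)) * (2 * k) + j mod (2 * k)"
    by (simp only: div_mult_mod_eq) (simp only: assms div_mult_mod_eq)
  moreover have "i mod (2 * k) < 2 * k" "j mod (2 * k) < 2 * k" using k_pos by simp_all
  ultimately have "i \<le> j + 2 * k" "j \<le> i + 2 * k" by linarith+
  then show ?thesis by linarith
qed

text \<open>
  Off-diagonal entries are at most \<open>s\<^sup>2 * \<tau>\<close> and vanish at distance \<open>2 * k\<close> and beyond. A row has at
  most \<open>2 * k\<close> nonzero entries, so both decay conditions reduce to the same requirement at
  distance \<open>2 * k\<close>.
\<close>

lemma law_in_class:
  assumes \<theta>: "\<theta> \<in> cube (block_edges d k)" and M0: "6 * s\<^sup>2 \<le> M0"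
    and M: "s\<^sup>2 * \<tau> * (2 * real k) powr (\<alpha> + 1) \<le> M" and \<alpha>: "0 < \<alpha>"
    and J: "J \<in> {row_tail_class, pointwise_decay_class}"
  shows "cov_mat d (law \<theta>) \<in> J \<alpha> M0 M d"
proof -
  note bounded = law_bounded_cov[OF \<theta> M0]
  have k2: "0 < 2 * real k" using k_pos by simp
  have a: "0 \<le> s\<^sup>2 * \<tau>" using \<tau>_pos by simp
  have M_pos: "0 \<le> M" using M a by (meson mult_nonneg_nonneg order_trans powr_ge_zero)
  have decay: "s\<^sup>2 * \<tau> \<le> M * (2 * real k) powr (- (\<alpha> + 1))"
  proof -
    have "0 < (2 * real k) powr (\<alpha> + 1)" using k2 by simp
    then have "s\<^sup>2 * \<tau> \<le> M / (2 * real k) powr (\<alpha> + 1)" using M by (simp only: pos_le_divide_eq)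
    then show ?thesis unfolding powr_minus_divide by simp
  qed
  have "cov_mat d (law \<theta>) \<in> pointwise_decay_class \<alpha> M0 M d"
    unfolding pointwise_decay_class_def
  proof (intro CollectI conjI bounded allI impI)
    fix i j assume ij: "i < d" "j < d" "i \<noteq> j"
    show "\<bar>cov_mat d (law \<theta>) (i, j)\<bar> \<le> M * \<bar>real i - real j\<bar> powr (- (\<alpha> + 1))"
    proof (cases "i div (2 * k) = j div (2 * k)")
      case True
      have "(2 * real k) powr (- (\<alpha> + 1)) \<le> \<bar>real i - real j\<bar> powr (- (\<alpha> + 1))"
        using same_block_close[OF True] ij(3) \<alpha> by (intro powr_mono2') auto
      then have "M * (2 * real k) powr (- (\<alpha> + 1)) \<le> M * \<bar>real i - real j\<bar> powr (- (\<alpha> + 1))"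
        using M_pos by (rule mult_left_mono)
      then show ?thesis using cov_off_diagonal[OF \<theta> ij] True decay by simp
    next
      case False
      then have "\<bar>cov_mat d (law \<theta>) (i, j)\<bar> \<le> 0" using cov_off_diagonal[OF \<theta> ij] by simp
      then show ?thesis using M_pos by simp
    qed
  qed
  moreover have "cov_mat d (law \<theta>) \<in> row_tail_class \<alpha> M0 M d"
    unfolding row_tail_class_def
  proof (intro CollectI conjI bounded allI impI)
    fix l j :: nat assume l: "1 \<le> l" and j: "j < d"
    define N where "N = {i. i < d \<and> \<bar>real i - real j\<bar> > real l}"
    define B where "B = {i. i div (2 * k) = j div (2 * k)}"
    have B: "finite B" "card B \<le> 2 * k"
    proof -
      have inj: "inj_on (\<lambda>i. i mod (2 * k)) B" unfolding B_def by (rule same_block_inj)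
      have sub: "(\<lambda>i. i mod (2 * k)) ` B \<subseteq> {..<2 * k}" using k_pos by auto
      show "finite B" using inj_on_finite[OF inj sub] by simp
      show "card B \<le> 2 * k" using card_inj_on_le[OF inj sub] by simp
    qed
    have N: "finite N" by (simp add: N_def)
    have "(\<Sum>i\<in>N. \<bar>cov_mat d (law \<theta>) (i, j)\<bar>) \<le> (\<Sum>i\<in>N. if i \<in> B then s\<^sup>2 * \<tau> else 0)"
    proof (rule sum_mono)
      fix i assume "i \<in> N"
      then have "i < d" "i \<noteq> j" by (auto simp: N_def)
      then show "\<bar>cov_mat d (law \<theta>) (i, j)\<bar> \<le> (if i \<in> B then s\<^sup>2 * \<tau> else 0)"
        using cov_off_diagonal[OF \<theta> _ j, of i] by (simp add: B_def)
    qed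
    also have "\<dots> = card (N \<inter> B) * (s\<^sup>2 * \<tau>)"
      using N by (simp add: sum.If_cases Int_def)
    also have "\<dots> \<le> M * real l powr (- \<alpha>)"
    proof (cases "N \<inter> B = {}")
      case True
      then show ?thesis using M_pos by simp
    next
      case False
      then obtain i where i: "i div (2 * k) = j div (2 * k)" "\<bar>real i - real j\<bar> > real l"
        by (auto simp: N_def B_def)
      then have lk: "real l \<le> 2 * real k" using same_block_close[OF i(1)] by simp
      have "card (N \<inter> B) \<le> 2 * k" using card_mono[OF B(1), of "N \<inter> B"] B(2) by simp
      then have "real (card (N \<inter> B)) \<le> 2 * real k"
        by (metis of_nat_le_iff of_nat_mult of_nat_numeral)
      then have "card (N \<inter> B) * (s\<^sup>2 * \<tau>) \<le> 2 * real k * (M * (2 * real k) powr (- (\<alpha> + 1)))"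
        using a by (intro mult_mono[OF _ decay]) simp_all
      also have "\<dots> = M * (2 * real k) powr (- \<alpha>)"
      proof -
        have "2 * real k * (2 * real k) powr (- (\<alpha> + 1)) = (2 * real k) powr (- \<alpha>)"
          using powr_mult_base[of "2 * real k" "- (\<alpha> + 1)"] k2 by simp
        then show ?thesis by (simp add: mult.left_commute)
      qed
      also have "\<dots> \<le> M * real l powr (- \<alpha>)"
        using lk l \<alpha> M_pos by (intro mult_left_mono powr_mono2') auto
      finally show ?thesis .
    qed
    finally show "(\<Sum>i | i < d \<and> \<bar>real i - real j\<bar> > real l. \<bar>cov_mat d (law \<theta>) (i, j)\<bar>) \<le> M * real l powr (- \<alpha>)"
      by (simp add: N_def)
  qed
  ultimately show ?thesis using J by auto
qed

text \<open>
  In both resolution regimes the factor in front of \<open>R\<close> in \<open>risk_lower_bounds\<close> is at most 7.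
\<close>

theorem minimax_risk_ge:
  assumes params: "0 < K" "0 < \<alpha>" "6 * s\<^sup>2 \<le> M0" "s\<^sup>2 \<le> 3 / 16 * K\<^sup>2"
    and M: "s\<^sup>2 * \<tau> * (2 * real k) powr (\<alpha> + 1) \<le> M"
    and J: "J \<in> {row_tail_class, pointwise_decay_class}"
    and n: "0 < n" and \<rho>: "0 < \<rho>"
    and resolution: "real n * \<tau>\<^sup>2 \<le> 1 \<or> (real n)\<^sup>2 * (exp (2 * \<rho>) - 1) * \<tau>\<^sup>2 \<le> real k * real d / 4"
    and A: "A \<in> zcdp_estimators n d \<rho>"
  shows "ennreal (k * (s\<^sup>2 * \<tau>)\<^sup>2 / 112) \<le> (SUP P\<in>model_dists J \<alpha> K M0 M d. risk n d A P)"
proof (cases "(SUP P\<in>model_dists J \<alpha> K M0 M d. risk n d A P) = \<top>")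
  case True
  then show ?thesis by (simp only: top_greatest)
next
  case False
  define r where "r = enn2real (SUP P\<in>model_dists J \<alpha> K M0 M d. risk n d A P)"
  have r: "(SUP P\<in>model_dists J \<alpha> K M0 M d. risk n d A P) = ennreal r" "0 \<le> r"
    using False by (simp_all add: r_def less_top[symmetric])
  define p where "p = real (card (block_edges d k))"
  have p: "real k * real d / 4 \<le> p" unfolding p_def by (rule card_block_edges[OF k_pos k_le])
  have kd: "0 < real k * real d" using k_pos k_le by simp
  have E: "block_edges d k \<noteq> {}" using p kd by (auto simp: p_def)
  have risk: "risk n d A (law \<theta>) \<le> ennreal r" if \<theta>: "\<theta> \<in> cube (block_edges d k)" for \<theta>
    unfolding r(1)[symmetric]
    by (intro SUP_upper law_model[OF \<theta> params(1,4)] law_in_class[OF \<theta> params(3) M params(2) J])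
  have d: "0 < d" using k_pos k_le by linarith
  define R where "R = real d * r / (s\<^sup>2 * \<tau>)\<^sup>2"
  have R: "0 \<le> R" using r by (simp add: R_def)
  note bounds = risk_lower_bounds[OF A n d \<rho> r(2) E risk, folded R_def p_def]
  have "p / 4 \<le> 7 * R"
    using resolution
  proof
    assume "real n * \<tau>\<^sup>2 \<le> 1"
    then have "(1 + 6 * (n * \<tau>\<^sup>2)) * R \<le> 7 * R" using R by (intro mult_right_mono) auto
    then show ?thesis using bounds(1) by linarith
  next
    assume "(real n)\<^sup>2 * (exp (2 * \<rho>) - 1) * \<tau>\<^sup>2 \<le> real k * real d / 4"
    then have "(real n)\<^sup>2 * (exp (2 * \<rho>) - 1) * \<tau>\<^sup>2 / p \<le> 1" using p kd by (simp add: field_simps)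
    then have "(1 + 6 * ((real n)\<^sup>2 * (exp (2 * \<rho>) - 1) * \<tau>\<^sup>2 / p)) * R \<le> 7 * R"
      using R by (intro mult_right_mono) auto
    then show ?thesis using bounds(2) by linarith
  qed
  with p have "real k * real d / 16 \<le> 7 * (real d * r / (s\<^sup>2 * \<tau>)\<^sup>2)" by (simp add: R_def)
  then have "k * (s\<^sup>2 * \<tau>)\<^sup>2 / 112 \<le> r"
    using d s_pos \<tau>_pos by (simp add: field_simps)
  then show ?thesis unfolding r(1) by (rule ennreal_leI)
qed

end

section \<open>Choice of the bandwidth\<close>

lemma nat_floor_bounds:
  fixes z :: real
  assumes "1 \<le> z"
  shows "1 \<le> nat \<lfloor>z\<rfloor>" "real (nat \<lfloor>z\<rfloor>) \<le> z" "z / 2 \<le> real (nat \<lfloor>z\<rfloor>)"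
proof -
  have f: "real (nat \<lfloor>z\<rfloor>) = of_int \<lfloor>z\<rfloor>" using assms by simp
  show "1 \<le> nat \<lfloor>z\<rfloor>" using assms by (simp add: le_nat_iff)
  show "real (nat \<lfloor>z\<rfloor>) \<le> z" unfolding f by simp
  have "1 \<le> real (nat \<lfloor>z\<rfloor>)" using \<open>1 \<le> nat \<lfloor>z\<rfloor>\<close> by simp
  moreover have "z < real (nat \<lfloor>z\<rfloor>) + 1" unfolding f by linarith
  ultimately show "z / 2 \<le> real (nat \<lfloor>z\<rfloor>)" by linarith
qed

text \<open>
  Here \<open>\<tau>\<^sup>2 = b\<^sup>2 / n\<close>, and the bandwidth is the largest one, up to \<open>d / 2\<close>, with \<open>k\<^bsup>\<alpha>+1\<^esup> \<le> \<surd>n\<close>. The two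
  cases of the minimum in the rate correspond to the two constraints on \<open>k\<close>.
\<close>

lemma risk_ge_sampling_rate:
  fixes \<alpha> K M0 M s :: real
  assumes params: "0 < K" "0 < \<alpha>" "0 < M" "0 < s" "6 * s\<^sup>2 \<le> M0" "s\<^sup>2 \<le> 3 / 16 * K\<^sup>2"
    and J: "J \<in> {row_tail_class, pointwise_decay_class}"
    and n: "0 < n" and d: "2 \<le> d" and \<rho>: "0 < \<rho>"
    and A: "A \<in> zcdp_estimators n d \<rho>"
  defines "b \<equiv> min (1 / 2) (M / (s\<^sup>2 * 2 powr (\<alpha> + 1)))"
  shows "ennreal (s ^ 4 * b\<^sup>2 / 448 * min (real n powr (- ((2 * \<alpha> + 1) / (2 * (\<alpha> + 1))))) (real d / real n))
      \<le> (SUP P\<in>model_dists J \<alpha> K M0 M d. risk n d A P)"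
proof -
  define x where "x = real n powr (1 / (2 * (\<alpha> + 1)))"
  define z where "z = min x (real d / 2)"
  define k where "k = nat \<lfloor>z\<rfloor>"
  define \<tau> where "\<tau> = b / sqrt n"
  have n1: "1 \<le> real n" using n by simp
  have x1: "1 \<le> x" unfolding x_def using n1 params(2) by (intro ge_one_powr_ge_zero) auto
  have z1: "1 \<le> z" using x1 d by (simp add: z_def)
  note k = nat_floor_bounds[OF z1, folded k_def]
  have b: "0 < b" using params by (simp add: b_def)
  have b_half: "b \<le> 1 / 2" unfolding b_def by (rule min.cobounded1)
  have bM: "s\<^sup>2 * b * 2 powr (\<alpha> + 1) \<le> M"
  proof -
    have "b \<le> M / (s\<^sup>2 * 2 powr (\<alpha> + 1))" by (simp add: b_def)
    then have "b * (s\<^sup>2 * 2 powr (\<alpha> + 1)) \<le> M" using params by (subst (asm) pos_le_divide_eq) auto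
    then show ?thesis by (simp add: mult_ac)
  qed
  have xp: "x powr (\<alpha> + 1) = sqrt n"
  proof -
    have half: "1 / (2 * (\<alpha> + 1)) * (\<alpha> + 1) = 1 / 2" using params(2) by (simp add: field_simps)
    show ?thesis unfolding x_def powr_powr half by (simp add: powr_half_sqrt)
  qed
  have kx: "real k \<le> x" using k(2) by (simp add: z_def)
  have kp: "real k powr (\<alpha> + 1) \<le> sqrt n"
    unfolding xp[symmetric] using kx params(2) by (intro powr_mono2) auto
  have k_sqrt: "real k \<le> sqrt n"
  proof -
    have "real k powr 1 \<le> real k powr (\<alpha> + 1)" using k(1) params(2) by (intro powr_mono) auto
    then show ?thesis using kp k(1) by simp
  qed
  have sq: "0 < sqrt n" using n by simp
  interpret block_regression d k \<tau> s
  proof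
    show "1 \<le> k" by (rule k(1))
    have "real (2 * k) \<le> real d" using k(2) by (simp add: z_def)
    then show "2 * k \<le> d" by (simp only: of_nat_le_iff)
    show "0 < \<tau>" using b sq by (simp add: \<tau>_def)
    have "\<tau> * k = b * (k / sqrt n)" by (simp add: \<tau>_def)
    also have "\<dots> \<le> b * 1" using k_sqrt sq b by (intro mult_left_mono) auto
    finally show "\<tau> * k \<le> 1 / 2" using b_half by simp
    show "0 < s" by (rule params(4))
  qed
  have M: "s\<^sup>2 * \<tau> * (2 * real k) powr (\<alpha> + 1) \<le> M"
  proof -
    have "s\<^sup>2 * \<tau> * (2 * real k) powr (\<alpha> + 1) = s\<^sup>2 * b * 2 powr (\<alpha> + 1) * (real k powr (\<alpha> + 1) / sqrt n)"
      by (simp add: \<tau>_def powr_mult)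
    also have "\<dots> \<le> s\<^sup>2 * b * 2 powr (\<alpha> + 1) * 1"
      using kp sq b by (intro mult_left_mono) auto
    finally show ?thesis using bM by simp
  qed
  have \<tau>2: "\<tau>\<^sup>2 = b\<^sup>2 / n" using n by (simp add: \<tau>_def power_divide)
  have "b\<^sup>2 \<le> 1" using b b_half by (simp add: power_le_one)
  then have res: "real n * \<tau>\<^sup>2 \<le> 1" using n by (simp add: \<tau>2)
  have "s ^ 4 * b\<^sup>2 / 448 * min (real n powr (- ((2 * \<alpha> + 1) / (2 * (\<alpha> + 1))))) (real d / real n)
      \<le> s ^ 4 * b\<^sup>2 / 448 * (4 * k / n)"
  proof (rule mult_left_mono)
    have "- ((2 * \<alpha> + 1) / (2 * (\<alpha> + 1))) = 1 / (2 * (\<alpha> + 1)) + - 1"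
      using params(2) by (simp add: field_simps)
    then have "real n powr (- ((2 * \<alpha> + 1) / (2 * (\<alpha> + 1)))) = x / n"
      using n by (simp only: powr_add x_def) (simp add: powr_minus_divide)
    then have "min (real n powr (- ((2 * \<alpha> + 1) / (2 * (\<alpha> + 1))))) (real d / real n) = min x d / n"
      using n by (simp add: min_divide_distrib_right)
    also have "\<dots> \<le> 2 * z / n" using n x1 by (intro divide_right_mono) (auto simp: z_def)
    also have "\<dots> \<le> 4 * k / n" using k(3) by (intro divide_right_mono) auto
    finally show "min (real n powr (- ((2 * \<alpha> + 1) / (2 * (\<alpha> + 1))))) (real d / real n) \<le> 4 * k / n" .
  qed simp
  also have "\<dots> = k * (s\<^sup>2 * \<tau>)\<^sup>2 / 112"
    by (simp add: power_mult_distrib \<tau>2 mult_ac)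
  finally have "ennreal (s ^ 4 * b\<^sup>2 / 448 * min (real n powr (- ((2 * \<alpha> + 1) / (2 * (\<alpha> + 1))))) (real d / real n))
      \<le> ennreal (k * (s\<^sup>2 * \<tau>)\<^sup>2 / 112)" by (rule ennreal_leI)
  also have "\<dots> \<le> (SUP P\<in>model_dists J \<alpha> K M0 M d. risk n d A P)"
    by (rule minimax_risk_ge[OF params(1,2,5,6) M J n \<rho> disjI1[OF res] A])
  finally show ?thesis .
qed

text \<open>
  Here \<open>\<tau>\<^sup>2 = b\<^sup>2 k q\<close> with \<open>q = d / (\<rho> n\<^sup>2)\<close>, and the bandwidth is the largest one, up to \<open>d / 2\<close>, with
  \<open>k\<^bsup>2\<alpha>+3\<^esup> q \<le> 1\<close>, so the risk is of order \<open>k\<^sup>2 q\<close>. The condition \<open>q \<le> 1\<close> makes room for a bandwidth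
  of at least 1, and the upper bound on \<open>\<rho>\<close> makes \<open>e\<^bsup>2\<rho>\<^esup> - 1\<close> comparable to \<open>\<rho>\<close>.
\<close>

lemma risk_ge_privacy_rate:
  fixes \<alpha> K M0 M s C0 :: real
  assumes params: "0 < K" "0 < \<alpha>" "0 < M" "0 < s" "6 * s\<^sup>2 \<le> M0" "s\<^sup>2 \<le> 3 / 16 * K\<^sup>2"
    and J: "J \<in> {row_tail_class, pointwise_decay_class}"
    and n: "0 < n" and d: "2 \<le> d" and \<rho>: "0 < \<rho>" "\<rho> \<le> C0"
    and small: "real d / (\<rho> * (real n)\<^sup>2) \<le> 1"
    and A: "A \<in> zcdp_estimators n d \<rho>"
  defines "b \<equiv> min (1 / (4 * exp C0)) (M / (s\<^sup>2 * 2 powr (\<alpha> + 1)))"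
  shows "ennreal (s ^ 4 * b\<^sup>2 / 1792 * min ((real d / (\<rho> * (real n)\<^sup>2)) powr ((2 * \<alpha> + 1) / (2 * \<alpha> + 3)))
        (real d ^ 3 / (\<rho> * (real n)\<^sup>2)))
      \<le> (SUP P\<in>model_dists J \<alpha> K M0 M d. risk n d A P)"
proof -
  define q where "q = real d / (\<rho> * (real n)\<^sup>2)"
  define y where "y = q powr (- (1 / (2 * \<alpha> + 3)))"
  define z where "z = min y (real d / 2)"
  define k where "k = nat \<lfloor>z\<rfloor>"
  define \<tau> where "\<tau> = b * sqrt (k * q)"
  have q: "0 < q" "q \<le> 1" using small n d \<rho> by (simp_all add: q_def)
  have y1: "1 \<le> y"
  proof -
    have "q powr (1 / (2 * \<alpha> + 3)) \<le> 1" using q params(2) by (intro powr_le1) auto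
    then show ?thesis using q by (simp add: y_def powr_minus_divide)
  qed
  have z1: "1 \<le> z" using y1 d by (simp add: z_def)
  note k = nat_floor_bounds[OF z1, folded k_def]
  have C0: "0 < C0" using \<rho> by simp
  have b: "0 < b" "b \<le> 1 / 4"
  proof -
    show "0 < b" using params by (simp add: b_def)
    have "b \<le> 1 / (4 * exp C0)" by (simp add: b_def)
    also have "\<dots> \<le> 1 / 4" using C0 by (simp add: field_simps)
    finally show "b \<le> 1 / 4" .
  qed
  have bM: "s\<^sup>2 * b * 2 powr (\<alpha> + 1) \<le> M"
  proof -
    have "b \<le> M / (s\<^sup>2 * 2 powr (\<alpha> + 1))" by (simp add: b_def)
    then have "b * (s\<^sup>2 * 2 powr (\<alpha> + 1)) \<le> M" using params by (subst (asm) pos_le_divide_eq) auto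
    then show ?thesis by (simp add: mult_ac)
  qed
  have k0: "0 < real k" using k(1) by simp
  have ky: "real k \<le> y" using k(2) by (simp add: z_def)
  have kq: "real k powr (2 * \<alpha> + 3) * q \<le> 1"
  proof -
    have "real k powr (2 * \<alpha> + 3) \<le> y powr (2 * \<alpha> + 3)" using ky params(2) by (intro powr_mono2) auto
    also have "\<dots> = q powr (- 1)"
      using params(2) by (simp only: y_def powr_powr) simp
    also have "\<dots> = 1 / q" using q by (simp add: powr_minus_divide)
    finally show ?thesis using q by (simp add: field_simps)
  qed
  \<comment> \<open>This single bound yields the decay condition, and also \<open>\<tau> * k \<le> 1 / 2\<close> because \<open>\<alpha>\<close> is positive.\<close>
  have kq_root: "real k powr (\<alpha> + 1) * sqrt (k * q) \<le> 1"
  proof -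
    have "(real k powr (\<alpha> + 1) * sqrt (k * q))\<^sup>2 = (real k powr (\<alpha> + 1))\<^sup>2 * (k * q)"
      using q by (simp add: power_mult_distrib)
    also have "(real k powr (\<alpha> + 1))\<^sup>2 = real k powr (2 * \<alpha> + 2)"
      by (simp add: power2_eq_square powr_add[symmetric])
    also have "real k powr (2 * \<alpha> + 2) * (k * q) = real k powr (2 * \<alpha> + 3) * q"
    proof -
      have "real k powr (2 * \<alpha> + 3) = real k powr ((2 * \<alpha> + 2) + 1)" by (simp add: algebra_simps)
      also have "\<dots> = real k powr (2 * \<alpha> + 2) * k" using k0 by (simp only: powr_add) simp
      finally show ?thesis by simp
    qed
    also have "\<dots> \<le> 1" by (rule kq)
    finally show ?thesis by (simp add: abs_square_le_1 abs_le_iff)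
  qed
  have k_root: "real k * sqrt (k * q) \<le> 1"
  proof -
    have "real k powr 1 \<le> real k powr (\<alpha> + 1)" using k(1) params(2) by (intro powr_mono) auto
    then have "real k * sqrt (k * q) \<le> real k powr (\<alpha> + 1) * sqrt (k * q)"
      using k0 q by (intro mult_right_mono) auto
    then show ?thesis using kq_root by linarith
  qed
  interpret block_regression d k \<tau> s
  proof
    show "1 \<le> k" by (rule k(1))
    have "real (2 * k) \<le> real d" using k(2) by (simp add: z_def)
    then show "2 * k \<le> d" by (simp only: of_nat_le_iff)
    show "0 < \<tau>" using b k0 q by (simp add: \<tau>_def)
    have "\<tau> * k = b * (k * sqrt (k * q))" by (simp add: \<tau>_def)
    also have "\<dots> \<le> b * 1" using k_root b by (intro mult_left_mono) auto
    finally show "\<tau> * k \<le> 1 / 2" using b by simp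
    show "0 < s" by (rule params(4))
  qed
  have M: "s\<^sup>2 * \<tau> * (2 * real k) powr (\<alpha> + 1) \<le> M"
  proof -
    have "s\<^sup>2 * \<tau> * (2 * real k) powr (\<alpha> + 1) = s\<^sup>2 * b * 2 powr (\<alpha> + 1) * (real k powr (\<alpha> + 1) * sqrt (k * q))"
      by (simp add: \<tau>_def powr_mult)
    also have "\<dots> \<le> s\<^sup>2 * b * 2 powr (\<alpha> + 1) * 1"
      using kq_root b by (intro mult_left_mono) auto
    finally show ?thesis using bM by simp
  qed
  have \<tau>2: "\<tau>\<^sup>2 = b\<^sup>2 * (k * q)" using q by (simp add: \<tau>_def power_mult_distrib)
  have res: "(real n)\<^sup>2 * (exp (2 * \<rho>) - 1) * \<tau>\<^sup>2 \<le> real k * real d / 4"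
  proof -
    have "exp (2 * \<rho>) - 1 \<le> 2 * \<rho> * exp (2 * \<rho>)"
      using exp_ge_add_one_self[of "- (2 * \<rho>)"] by (simp add: exp_minus field_simps)
    also have "\<dots> \<le> 2 * \<rho> * exp (2 * C0)" using \<rho> by (intro mult_left_mono) auto
    finally have e: "exp (2 * \<rho>) - 1 \<le> 2 * \<rho> * exp (2 * C0)" .
    have "b \<le> 1 / (4 * exp C0)" by (simp add: b_def)
    then have "b\<^sup>2 \<le> (1 / (4 * exp C0))\<^sup>2" using b by (intro power_mono) auto
    also have "\<dots> = 1 / (16 * exp (2 * C0))" by (simp add: power2_eq_square exp_add[symmetric])
    finally have b2: "b\<^sup>2 \<le> 1 / (16 * exp (2 * C0))" .
    have nq: "(real n)\<^sup>2 * \<rho> * q = d" using n \<rho> by (simp add: q_def)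
    have "(real n)\<^sup>2 * (exp (2 * \<rho>) - 1) * \<tau>\<^sup>2 = (exp (2 * \<rho>) - 1) * b\<^sup>2 * ((real n)\<^sup>2 * (k * q))"
      by (simp add: \<tau>2)
    also have "\<dots> \<le> (2 * \<rho> * exp (2 * C0)) * (1 / (16 * exp (2 * C0))) * ((real n)\<^sup>2 * (k * q))"
      using e b2 q \<rho> by (intro mult_right_mono mult_mono) auto
    also have "\<dots> = real k * ((real n)\<^sup>2 * \<rho> * q) / 8" by simp
    also have "\<dots> \<le> real k * real d / 4" unfolding nq by simp
    finally show ?thesis .
  qed
  have "s ^ 4 * b\<^sup>2 / 1792 * min (q powr ((2 * \<alpha> + 1) / (2 * \<alpha> + 3))) (real d ^ 3 / (\<rho> * (real n)\<^sup>2))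
      \<le> s ^ 4 * b\<^sup>2 / 1792 * (16 * (real k)\<^sup>2 * q)"
  proof (rule mult_left_mono)
    have "(2 * \<alpha> + 1) / (2 * \<alpha> + 3) = - (1 / (2 * \<alpha> + 3)) + - (1 / (2 * \<alpha> + 3)) + 1"
      using params(2) by (simp add: field_simps)
    then have 1: "q powr ((2 * \<alpha> + 1) / (2 * \<alpha> + 3)) = y\<^sup>2 * q"
      using q by (simp only: powr_add y_def power2_eq_square) simp
    have 2: "real d ^ 3 / (\<rho> * (real n)\<^sup>2) = (real d)\<^sup>2 * q"
      by (simp add: q_def power3_eq_cube power2_eq_square)
    have "min (y\<^sup>2 * q) ((real d)\<^sup>2 * q) \<le> (4 * real k)\<^sup>2 * q"
    proof (cases "y \<le> real d / 2")
      case True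
      then have "y \<le> 4 * real k" using k(3) y1 by (simp add: z_def)
      then have "y\<^sup>2 * q \<le> (4 * real k)\<^sup>2 * q" using y1 q by (intro mult_right_mono power_mono) auto
      then show ?thesis by simp
    next
      case False
      then have "real d \<le> 4 * real k" using k(3) by (simp add: z_def)
      then have "(real d)\<^sup>2 * q \<le> (4 * real k)\<^sup>2 * q" using q by (intro mult_right_mono power_mono) auto
      then show ?thesis by simp
    qed
    then show "min (q powr ((2 * \<alpha> + 1) / (2 * \<alpha> + 3))) (real d ^ 3 / (\<rho> * (real n)\<^sup>2)) \<le> 16 * (real k)\<^sup>2 * q"
      unfolding 1 2 by (simp add: power_mult_distrib)
  qed simp
  also have "\<dots> = k * (s\<^sup>2 * \<tau>)\<^sup>2 / 112"
  proof -
    have "(s\<^sup>2 * \<tau>)\<^sup>2 = s ^ 4 * (b\<^sup>2 * (k * q))"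
      unfolding \<tau>2[symmetric] by (simp add: power_mult_distrib)
    then show ?thesis by (simp add: power2_eq_square[of "real k"])
  qed
  finally have "ennreal (s ^ 4 * b\<^sup>2 / 1792 * min (q powr ((2 * \<alpha> + 1) / (2 * \<alpha> + 3))) (real d ^ 3 / (\<rho> * (real n)\<^sup>2)))
      \<le> ennreal (k * (s\<^sup>2 * \<tau>)\<^sup>2 / 112)" by (rule ennreal_leI)
  also have "\<dots> \<le> (SUP P\<in>model_dists J \<alpha> K M0 M d. risk n d A P)"
    by (rule minimax_risk_ge[OF params(1,2,5,6) M J n \<rho>(1) disjI2[OF res] A])
  finally show ?thesis unfolding q_def .
qed

section \<open>The minimax lower bound\<close>

theorem theorem4p4:
  fixes \<alpha> K M0 M c0 C0 :: real
    and J :: "real \<Rightarrow> real \<Rightarrow> real \<Rightarrow> nat \<Rightarrow> mtx set"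
  assumes "\<alpha> > 0" "K > 0" "M0 > 0" "M > 0"
    and "c0 > 0" "C0 > 0"
    and "J \<in> {row_tail_class, pointwise_decay_class}"
  shows "\<exists>c>0. \<forall>(d :: nat \<Rightarrow> nat) (\<rho> :: nat \<Rightarrow> real).
    (\<forall>\<^sub>F n in sequentially. real (d n) \<ge> c0 * ln (real n)) \<longrightarrow>
    (\<forall>\<^sub>F n in sequentially. 0 < \<rho> n \<and> \<rho> n \<le> C0) \<longrightarrow>
    (\<lambda>n. real (d n) / (\<rho> n * (real n)\<^sup>2)) \<longlonglongrightarrow> 0 \<longrightarrow>
    (\<forall>\<^sub>F n in sequentially.
      (INF A\<in>zcdp_estimators n (d n) (\<rho> n). SUP P\<in>model_dists J \<alpha> K M0 M (d n). risk n (d n) A P)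
      \<ge> ennreal (c *
          (min (real n powr (- ((2 * \<alpha> + 1) / (2 * (\<alpha> + 1))))) (real (d n) / real n) +
           min ((real (d n) / (\<rho> n * (real n)\<^sup>2)) powr ((2 * \<alpha> + 1) / (2 * \<alpha> + 3)))
               (real (d n) ^ 3 / (\<rho> n * (real n)\<^sup>2)))))"
proof -
  define s where "s = sqrt (min (M0 / 6) (3 / 16 * K\<^sup>2))"
  have s: "0 < s" "6 * s\<^sup>2 \<le> M0" "s\<^sup>2 \<le> 3 / 16 * K\<^sup>2"
    using assms(2,3) by (auto simp: s_def min_def)
  define b where "b = min (1 / 2) (M / (s\<^sup>2 * 2 powr (\<alpha> + 1)))"
  define b' where "b' = min (1 / (4 * exp C0)) (M / (s\<^sup>2 * 2 powr (\<alpha> + 1)))"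
  have b: "0 < b" "0 < b'" using assms s by (simp_all add: b_def b'_def)
  define c where "c = min (s ^ 4 * b\<^sup>2 / 448) (s ^ 4 * b'\<^sup>2 / 1792) / 2"
  have c: "0 < c" using b s by (simp add: c_def)
  show ?thesis
  proof (intro exI[of _ c] conjI c allI impI)
    fix d :: "nat \<Rightarrow> nat" and \<rho> :: "nat \<Rightarrow> real"
    assume d_log: "\<forall>\<^sub>F n in sequentially. real (d n) \<ge> c0 * ln (real n)"
      and \<rho>: "\<forall>\<^sub>F n in sequentially. 0 < \<rho> n \<and> \<rho> n \<le> C0"
      and lim: "(\<lambda>n. real (d n) / (\<rho> n * (real n)\<^sup>2)) \<longlonglongrightarrow> 0"
    have "filterlim (\<lambda>n. ln (real n)) at_top sequentially"
      by (rule filterlim_compose[OF ln_at_top filterlim_real_sequentially])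
    then have ln_large: "\<forall>\<^sub>F n in sequentially. 2 / c0 \<le> ln (real n)"
      by (simp add: filterlim_at_top)
    have small: "\<forall>\<^sub>F n in sequentially. real (d n) / (\<rho> n * (real n)\<^sup>2) < 1"
      using lim by (rule order_tendstoD) simp
    show "\<forall>\<^sub>F n in sequentially.
      (INF A\<in>zcdp_estimators n (d n) (\<rho> n). SUP P\<in>model_dists J \<alpha> K M0 M (d n). risk n (d n) A P)
      \<ge> ennreal (c *
          (min (real n powr (- ((2 * \<alpha> + 1) / (2 * (\<alpha> + 1))))) (real (d n) / real n) +
           min ((real (d n) / (\<rho> n * (real n)\<^sup>2)) powr ((2 * \<alpha> + 1) / (2 * \<alpha> + 3)))
               (real (d n) ^ 3 / (\<rho> n * (real n)\<^sup>2))))"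
      using d_log \<rho> ln_large small eventually_gt_at_top[of 0]
    proof eventually_elim
      case (elim n)
      have "2 \<le> c0 * ln (real n)" using elim(3) assms(5) by (simp add: field_simps)
      then have "2 \<le> real (d n)" using elim(1) by linarith
      then have d2: "2 \<le> d n" by simp
      define u where "u = min (real n powr (- ((2 * \<alpha> + 1) / (2 * (\<alpha> + 1))))) (real (d n) / real n)"
      define v where "v = min ((real (d n) / (\<rho> n * (real n)\<^sup>2)) powr ((2 * \<alpha> + 1) / (2 * \<alpha> + 3)))
               (real (d n) ^ 3 / (\<rho> n * (real n)\<^sup>2))"
      have uv: "0 \<le> u" "0 \<le> v" using elim(2) by (simp_all add: u_def v_def)
      have "ennreal (c * (u + v)) \<le> (SUP P\<in>model_dists J \<alpha> K M0 M (d n). risk n (d n) A P)"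
        if A: "A \<in> zcdp_estimators n (d n) (\<rho> n)" for A
      proof -
        have 1: "ennreal (s ^ 4 * b\<^sup>2 / 448 * u) \<le> (SUP P\<in>model_dists J \<alpha> K M0 M (d n). risk n (d n) A P)"
          unfolding b_def u_def
          by (rule risk_ge_sampling_rate[OF assms(2,1,4) s assms(7) elim(5) d2 _ A]) (use elim(2) in simp)
        have 2: "ennreal (s ^ 4 * b'\<^sup>2 / 1792 * v) \<le> (SUP P\<in>model_dists J \<alpha> K M0 M (d n). risk n (d n) A P)"
          unfolding b'_def v_def
          by (rule risk_ge_privacy_rate[OF assms(2,1,4) s assms(7) elim(5) d2 _ _ _ A]) (use elim(2,4) in simp_all)
        have "c * (u + v) \<le> max (s ^ 4 * b\<^sup>2 / 448 * u) (s ^ 4 * b'\<^sup>2 / 1792 * v)"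
        proof -
          have "2 * c * u \<le> s ^ 4 * b\<^sup>2 / 448 * u" "2 * c * v \<le> s ^ 4 * b'\<^sup>2 / 1792 * v"
            using uv by (intro mult_right_mono; simp add: c_def)+
          then show ?thesis by (simp add: distrib_left)
        qed
        then have "ennreal (c * (u + v)) \<le> ennreal (max (s ^ 4 * b\<^sup>2 / 448 * u) (s ^ 4 * b'\<^sup>2 / 1792 * v))"
          by (rule ennreal_leI)
        also have "\<dots> \<le> (SUP P\<in>model_dists J \<alpha> K M0 M (d n). risk n (d n) A P)"
          using 1 2 by (simp add: max_def)
        finally show ?thesis .
      qed
      then show ?case unfolding u_def v_def by (intro INF_greatest)
    qed
  qed
qed

end
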